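(* Let $Z>0$ and $q>0$, and let $f:[0,\infty)\times\mathbb{R}^3\times\mathbb{R}^3\to[0,q]$, $(t,x,\xi)\mapsto f_t(x,\xi)$, be a weak solution of the atomic Vlasov equation $$\partial_t f_t(x,\xi) + \xi\cdot\nabla_x f_t(x,\xi) + \mathfrak{K}_t(x)\cdot\nabla_\xi f_t(x,\xi) = 0,$$ where $$\mathfrak{K}_t(x) = -Z\frac{x}{|x|^3} + \int_{\mathbb{R}^3}\rho_t(y)\frac{x-y}{|x-y|^3}\,\mathrm{d}y,\qquad \rho_t(x)=\int_{\mathbb{R}^3} f_t(x,\xi)\,\frac{\mathrm{d}\xi}{(2\pi)^3}.$$ Assume that $f_t$ has finite energy, where the energy is $$\mathcal{E}_V(f_t) = \int_{\mathbb{R}^3}\int_{\mathbb{R}^3}\frac12|\xi|^2 f_t(x,\xi)\,\frac{\mathrm{d}\xi}{(2\pi)^3}\,\mathrm{d}x - \int_{\mathbb{R}^3}\frac{Z}{|x|}\rho_t(x)\,\mathrm{d}x + \frac12\int_{\mathbb{R}^3}\int_{\mathbb{R}^3}\frac{\rho_t(x)\rho_t(y)}{|x-y|}\,\mathrm{d}x\,\mathrm{d}y .$$ Let $B\subset\mathbb{R}^3$ be bounded and measurable and set $$N_V(t,B) := \int_B\int_{\mathbb{R}^3} f_t(x,\xi)\,\frac{\mathrm{d}\xi}{(2\pi)^3}\,\mathrm{d}x .$$ Then $$\limsup_{T\to\infty}\frac1T\int_0^T N_V(t,B)\,\mathrm{d}t \le 4Z .$$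
   Context: The function $f_t$ is interpreted as the spin-summed phase space density at time $t$ of fermions with $q$ spin states each (for electrons $q=2$), at position $x$ and momentum $\xi$, in atomic units ($\hbar=m=1$, $h=2\pi$). The Pauli principle is the requirement $0\le f_t\le q$. The function $\rho_t$ is the spatial density of electrons, and $N(t)=\int_{\mathbb{R}^3}\rho_t(x)\,\mathrm{d}x$, the number of particles at time $t$, may or may not be finite. There is a single nucleus, of charge $Z$, located at the origin. "Weak solution" is meant in the usual sense of distributions, i.e. the equation holds after integration against smooth compactly supported test functions, with derivatives moved onto the test function. The energy $\mathcal{E}_V(f_t)$ is conserved, i.e. independent of $t$, along the solutions considered; "finite energy" means that this conserved value is finite. *)

theory Defs
  imports "HOL-Analysis.Analysis"
begin

primrec C_k :: "nat \<Rightarrow> ('a::euclidean_space \<Rightarrow> real) \<Rightarrow> bool" where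
  "C_k 0 \<phi> \<longleftrightarrow> continuous_on UNIV \<phi>"
| "C_k (Suc n) \<phi> \<longleftrightarrow> \<phi> differentiable_on UNIV \<and>
     (\<forall>v. C_k n (\<lambda>z. frechet_derivative \<phi> (at z) v))"

text \<open>The space \<open>C\<^sub>c\<^sup>\<infinity>(U)\<close>; its members are extended by 0 to the whole space.\<close>

definition test_function :: "'a::euclidean_space set \<Rightarrow> ('a \<Rightarrow> real) \<Rightarrow> bool" where
  "test_function U \<phi> \<longleftrightarrow> (\<forall>n. C_k n \<phi>) \<and>
     compact (closure {z. \<phi> z \<noteq> 0}) \<and> closure {z. \<phi> z \<noteq> 0} \<subseteq> U"

text \<open>
  Quantities that are integrals of nonnegative functions are extended nonnegative reals, so that
  a divergent integral has the value \<open>\<infinity>\<close>.  The argument \<open>g\<close> is a phase space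
  density at a fixed time.
\<close>

definition spatial_density :: "(real^3 \<Rightarrow> real^3 \<Rightarrow> real) \<Rightarrow> real^3 \<Rightarrow> ennreal" where
  "spatial_density g x = (\<integral>\<^sup>+ \<xi>. ennreal (g x \<xi> / (2 * pi) ^ 3) \<partial>lebesgue)"

definition force :: "real \<Rightarrow> (real^3 \<Rightarrow> real^3 \<Rightarrow> real) \<Rightarrow> real^3 \<Rightarrow> real^3" where
  "force Z g x = - (Z / norm x ^ 3) *\<^sub>R x +
     (LINT y|lebesgue. (enn2real (spatial_density g y) / norm (x - y) ^ 3) *\<^sub>R (x - y))"

definition kinetic_energy :: "(real^3 \<Rightarrow> real^3 \<Rightarrow> real) \<Rightarrow> ennreal" where
  "kinetic_energy g =
     (\<integral>\<^sup>+ x. (\<integral>\<^sup>+ \<xi>. ennreal (1 / 2 * (norm \<xi>)\<^sup>2 * g x \<xi> / (2 * pi) ^ 3) \<partial>lebesgue) \<partial>lebesgue)"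

definition attraction_energy :: "real \<Rightarrow> (real^3 \<Rightarrow> real^3 \<Rightarrow> real) \<Rightarrow> ennreal" where
  "attraction_energy Z g = (\<integral>\<^sup>+ x. ennreal (Z / norm x) * spatial_density g x \<partial>lebesgue)"

definition repulsion_energy :: "(real^3 \<Rightarrow> real^3 \<Rightarrow> real) \<Rightarrow> ennreal" where
  "repulsion_energy g = 1 / 2 * (\<integral>\<^sup>+ x. (\<integral>\<^sup>+ y.
     spatial_density g x * spatial_density g y * ennreal (1 / norm (x - y)) \<partial>lebesgue) \<partial>lebesgue)"

text \<open>
  Since \<open>\<infinity> - \<infinity> = \<infinity>\<close> and \<open>-\<infinity> + \<infinity> = \<infinity>\<close> in \<^typ>\<open>ereal\<close>,
  this is finite exactly if each of the three terms is.
\<close>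

definition vlasov_energy :: "real \<Rightarrow> (real^3 \<Rightarrow> real^3 \<Rightarrow> real) \<Rightarrow> ereal" where
  "vlasov_energy Z g = enn2ereal (kinetic_energy g) - enn2ereal (attraction_energy Z g)
     + enn2ereal (repulsion_energy g)"

text \<open>
  The three summands of the second factor are \<open>\<partial>\<^sub>t \<phi>\<close>, \<open>\<xi> \<cdot> \<nabla>\<^sub>x \<phi>\<close> and
  \<open>K\<^sub>t(x) \<cdot> \<nabla>\<^sub>\<xi> \<phi>\<close>.  No further terms arise when the derivatives are moved onto
  \<open>\<phi>\<close>, because \<open>\<xi>\<close> does not depend on \<open>x\<close> and \<open>K\<^sub>t(x)\<close> does not depend on \<open>\<xi>\<close>.
  The equation is understood in the sense of distributions on the open set \<open>t > 0\<close>.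
\<close>

definition vlasov_weak_solution ::
  "real \<Rightarrow> (real \<Rightarrow> real^3 \<Rightarrow> real^3 \<Rightarrow> real) \<Rightarrow> bool" where
  "vlasov_weak_solution Z f \<longleftrightarrow>
     (\<forall>\<phi> :: real \<times> (real^3) \<times> (real^3) \<Rightarrow> real. test_function ({0<..} \<times> UNIV) \<phi> \<longrightarrow>
        (let F = (\<lambda>(t, x, \<xi>). f t x \<xi> *
               (frechet_derivative \<phi> (at (t, x, \<xi>)) (1, 0, 0)
              + frechet_derivative \<phi> (at (t, x, \<xi>)) (0, \<xi>, 0)
              + frechet_derivative \<phi> (at (t, x, \<xi>)) (0, 0, force Z (f t) x)))
         in set_integrable lebesgue ({0<..} \<times> UNIV) F \<and>
            (LINT z:{0<..} \<times> UNIV|lebesgue. F z) = 0))"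

definition particle_number ::
  "(real \<Rightarrow> real^3 \<Rightarrow> real^3 \<Rightarrow> real) \<Rightarrow> real \<Rightarrow> (real^3) set \<Rightarrow> ennreal" where
  "particle_number f t B =
     (\<integral>\<^sup>+ x\<in>B. (\<integral>\<^sup>+ \<xi>. ennreal (f t x \<xi> / (2 * pi) ^ 3) \<partial>lebesgue) \<partial>lebesgue)"

end

theory Submission
  imports Defs
begin

text \<open>
  The proof tests the equation with \<open>\<theta>(t) \<xi> \<bullet> F(x)\<close>, where \<open>F\<close> is a truncation of the gradient
  \<open>\<bar>x\<bar> x\<close> of the cubic weight, essentially \<open>F(x) = w(x) \<bar>x\<bar> x\<close> with \<open>w(x) = 1 / (1 + \<epsilon> \<bar>x\<bar>\<^sup>2)\<close>.
  The transport term is nonnegative because \<open>F\<close> is monotone.  The nucleus contributes \<open>- Z M\<close>,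
  where \<open>M\<close> is the integral of \<open>\<rho> w\<close>.  After symmetrization in \<open>x\<close> and \<open>y\<close>, the inequality
  \<open>(F(x) - F(y)) \<bullet> (x - y) \<ge> w(x) w(y) \<bar>x - y\<bar>\<^sup>3 / 2\<close> shows that the repulsion contributes at least
  \<open>M\<^sup>2 / 4\<close>.  Since the integral of \<open>f \<xi> \<bullet> F\<close> is bounded uniformly in time, the time average of
  \<open>M\<^sup>2 / 4 - Z M \<ge> Z (M - 4 Z)\<close> is asymptotically nonpositive, and \<open>M\<close> dominates the number of
  particles in a fixed ball as \<open>\<epsilon> \<rightarrow> 0\<close>.

  The particle number may be infinite, so \<open>F\<close> has to be cut off at a large radius.  The cutoff spoils
  monotonicity only by an arbitrarily small multiple of \<open>\<bar>x - y\<bar>\<^sup>2\<close>, which costs at most that multiple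
  of the kinetic, attraction and repulsion energies, and these are bounded uniformly in time.
\<close>

section \<open>Smooth functions\<close>

text \<open>The field \<open>|x| x\<close> is chosen because
  \<open>F \<bullet> x / |x|^3 = 1\<close>: the attraction of the nucleus then counts particles. The
  1/4 in front of \<open>M^2\<close> is 1/2 from symmetrization times 1/2 from the two-point
  inequality, so attraction and repulsion balance at \<open>M = 4 Z\<close>. The obstacle is that
  only the energy is controlled. The Pauli principle turns kinetic energy into an
  \<open>L^(5/3)\<close> bound on the density. This lets the attraction be absorbed, so that each
  part of the energy is bounded separately, and it controls the kernel \<open>1 / |x - y|^2\<close>,
  so that the density of force times a bounded \<open>F\<close> is integrable. The repulsion bounds
  the integral of \<open>\<rho> / (1 + |x|)\<close>, the substitute for the particle number; this is
  why \<open>w\<close> has to decay at least like \<open>1 / |x|\<close>. The parameters are fixed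
  in the order \<open>\<epsilon>\<close>, the defect \<open>\<kappa>\<close> of monotonicity, the
  cutoff radius, the time profile; then \<open>T\<close> tends to infinity, and
  \<open>\<epsilon>\<close> to 0 at the very end. Constants that grow with the radius multiply
  either the derivative of the profile, whose integral is bounded in \<open>T\<close> and disappears
  after division by \<open>T\<close>, or a loss that is made small after the radius is
  known.\<close>

text \<open>
  A class of functions that contains the directional derivatives of its members, so that membership
  implies \<^const>\<open>C_k\<close> for every order.  In the rule for compositions, \<open>G n\<close> is the \<open>n\<close>-th derivative
  of \<open>G 0\<close> at the points of the range of \<open>\<phi>\<close>.
\<close>

inductive smooth :: "('a::euclidean_space \<Rightarrow> real) \<Rightarrow> bool" where
  const: "smooth (\<lambda>_. c)"
| inner: "smooth (\<lambda>z. z \<bullet> b)"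
| add: "smooth \<phi> \<Longrightarrow> smooth \<psi> \<Longrightarrow> smooth (\<lambda>z. \<phi> z + \<psi> z)"
| mult: "smooth \<phi> \<Longrightarrow> smooth \<psi> \<Longrightarrow> smooth (\<lambda>z. \<phi> z * \<psi> z)"
| compose: "smooth \<phi> \<Longrightarrow> (\<And>n z. (G n has_real_derivative G (Suc n) (\<phi> z)) (at (\<phi> z)))
    \<Longrightarrow> smooth (\<lambda>z. G (0::nat) (\<phi> z))"

text \<open>The induction carries a derivative \<open>\<phi>'\<close> explicitly and keeps its
  directional values in the class; it is identified with \<open>frechet_derivative\<close> only at
  the end, by uniqueness.\<close>

lemma smooth_derivative:
  assumes "smooth \<phi>"
  shows "\<phi> differentiable (at z)" "smooth (\<lambda>z. frechet_derivative \<phi> (at z) v)"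
proof -
  have "\<exists>\<phi>'. (\<forall>z. (\<phi> has_derivative \<phi>' z) (at z)) \<and> (\<forall>v. smooth (\<lambda>z. \<phi>' z v))"
    using assms
  proof induction
    case (const c)
    show ?case by (rule exI[of _ "\<lambda>_ _. 0"]) (auto intro: smooth.const)
  next
    case (inner b)
    show ?case by (rule exI[of _ "\<lambda>_ v. v \<bullet> b"]) (auto intro!: smooth.const derivative_eq_intros)
  next
    case (add \<phi> \<psi>)
    then obtain \<phi>' \<psi>' where
      "\<And>z. (\<phi> has_derivative \<phi>' z) (at z)" "\<And>v. smooth (\<lambda>z. \<phi>' z v)"
      "\<And>z. (\<psi> has_derivative \<psi>' z) (at z)" "\<And>v. smooth (\<lambda>z. \<psi>' z v)" by blast
    then show ?case
      by (intro exI[of _ "\<lambda>z v. \<phi>' z v + \<psi>' z v"]) (auto intro!: smooth.add has_derivative_add)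
  next
    case (mult \<phi> \<psi>)
    then obtain \<phi>' \<psi>' where
      "\<And>z. (\<phi> has_derivative \<phi>' z) (at z)" "\<And>v. smooth (\<lambda>z. \<phi>' z v)"
      "\<And>z. (\<psi> has_derivative \<psi>' z) (at z)" "\<And>v. smooth (\<lambda>z. \<psi>' z v)" by blast
    then show ?case using mult.hyps
      by (intro exI[of _ "\<lambda>z v. \<phi> z * \<psi>' z v + \<phi>' z v * \<psi> z"])
        (auto intro!: smooth.add smooth.mult has_derivative_mult)
  next
    case (compose \<phi> G)
    then obtain \<phi>' where
      d: "\<And>z. (\<phi> has_derivative \<phi>' z) (at z)" "\<And>v. smooth (\<lambda>z. \<phi>' z v)" by blast
    have "((\<lambda>z. G 0 (\<phi> z)) has_derivative (\<lambda>v. G 1 (\<phi> z) * \<phi>' z v)) (at z)" for z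
      using has_derivative_compose[OF d(1) compose.hyps(2)[of 0, unfolded has_field_derivative_def]]
      by simp
    \<comment> \<open>The shifted sequence \<open>\<lambda>n. G (Suc n)\<close> is again a chain of
      derivatives along the range of \<open>\<phi>\<close>, so the same rule applies to it.\<close>
    moreover have "smooth (\<lambda>z. G (Suc 0) (\<phi> z))"
      using smooth.compose[of \<phi> "\<lambda>n. G (Suc n)"] compose.hyps by blast
    ultimately show ?case using d(2)
      by (intro exI[of _ "\<lambda>z v. G 1 (\<phi> z) * \<phi>' z v"]) (auto intro!: smooth.mult)
  qed
  then obtain \<phi>' where d: "\<And>z. (\<phi> has_derivative \<phi>' z) (at z)" "\<And>v. smooth (\<lambda>z. \<phi>' z v)" by blast
  show "\<phi> differentiable (at z)" using d(1) unfolding differentiable_def by blast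
  show "smooth (\<lambda>z. frechet_derivative \<phi> (at z) v)"
    using d(2)[of v] frechet_derivative_at[OF d(1)] by simp
qed

lemma smooth_C_k: "smooth \<phi> \<Longrightarrow> C_k n \<phi>"
proof (induction n arbitrary: \<phi>)
  case 0
  then show ?case
    by (simp add: continuous_on_eq_continuous_within smooth_derivative(1) differentiable_imp_continuous_within)
next
  case (Suc n)
  then show ?case by (simp add: smooth_derivative differentiable_on_def)
qed

lemma smooth_compose_linear:
  fixes A :: "'a::euclidean_space \<Rightarrow> 'b::euclidean_space"
  assumes "smooth \<phi>" "linear A"
  shows "smooth (\<lambda>z. \<phi> (A z))"
  using assms(1)
proof induction
  case (inner b)
  have "(\<lambda>z. A z \<bullet> b) = (\<lambda>z. z \<bullet> adjoint A b)"
    by (simp add: adjoint_works[OF assms(2)] inner_commute[of _ b] inner_commute[of _ "adjoint A b"])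
  then show ?case by (simp add: smooth.inner)
qed (auto intro: smooth.intros)

lemma smooth_sum: "finite I \<Longrightarrow> (\<And>i. i \<in> I \<Longrightarrow> smooth (\<phi> i)) \<Longrightarrow> smooth (\<lambda>z. \<Sum>i\<in>I. \<phi> i z)"
  by (induction I rule: finite_induct) (auto intro: smooth.intros)

lemma smooth_scale: "smooth \<phi> \<Longrightarrow> smooth (\<lambda>z. \<phi> z * c)"
  by (intro smooth.mult smooth.const)

lemma smooth_norm_square: "smooth (\<lambda>x::'a::euclidean_space. (norm x)\<^sup>2)"
proof -
  have "(\<lambda>x::'a. (norm x)\<^sup>2) = (\<lambda>x. \<Sum>b\<in>Basis. (x \<bullet> b) * (x \<bullet> b))"
    unfolding power2_norm_eq_inner by (rule ext) (rule euclidean_inner)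
  then show ?thesis by (auto intro!: smooth_sum smooth.mult smooth.inner)
qed

lemma smooth_powr:
  assumes "smooth \<phi>" "\<And>z. \<phi> z > 0"
  shows "smooth (\<lambda>z. \<phi> z powr a)"
proof -
  \<comment> \<open>The \<open>n\<close>-th derivative of \<open>y powr a\<close> for
    \<open>y > 0\<close>: the product is the falling factorial of \<open>a\<close>.\<close>
  define G where "G n y = (\<Prod>i<n. a - real i) * y powr (a - real n)" for n y
  have "(G n has_real_derivative G (Suc n) (\<phi> z)) (at (\<phi> z))" for n z
    using DERIV_cmult[OF has_real_derivative_powr[OF assms(2)[of z]], of "\<Prod>i<n. a - real i" "a - real n"]
    by (simp add: G_def[abs_def] mult.assoc diff_diff_eq add.commute)
  then have "smooth (\<lambda>z. G 0 (\<phi> z))"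
    using assms(1) by (intro smooth.compose[of \<phi> G]) auto
  then show ?thesis by (simp add: G_def)
qed

text \<open>The classical flat function \<open>exp (- 1/x)\<close> with a polynomial in
  \<open>1/x\<close> in front. The polynomial is a parameter because differentiation then stays in
  the family and changes only \<open>P\<close>.\<close>

definition flat_exp :: "real poly \<Rightarrow> real \<Rightarrow> real" where
  "flat_exp P x = (if x > 0 then poly P (1/x) * exp (- 1/x) else 0)"

text \<open>From the right, \<open>u = 1/x\<close> turns this into polynomial against exponential at
  infinity; on the left the function is constantly 0.\<close>

lemma flat_exp_tendsto_0: "((\<lambda>x. flat_exp P x) \<longlongrightarrow> 0) (at 0)"
proof -
  have "((\<lambda>u. poly P u * exp (-u)) \<longlongrightarrow> 0) at_top"
  proof -
    have "(\<lambda>u. poly P u * exp (-u)) = (\<lambda>u. \<Sum>i\<le>degree P. coeff P i * (u ^ i / exp u))"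
      by (simp add: poly_altdef sum_distrib_right exp_minus divide_inverse mult.assoc)
    moreover have "((\<lambda>u. \<Sum>i\<le>degree P. coeff P i * (u ^ i / exp u)) \<longlongrightarrow> (\<Sum>i\<le>degree P. coeff P i * 0)) at_top"
      by (intro tendsto_sum tendsto_mult tendsto_const tendsto_power_div_exp_0)
    ultimately show ?thesis by simp
  qed
  from filterlim_compose[OF this filterlim_inverse_at_top_right]
  have "((\<lambda>x. poly P (inverse x) * exp (- inverse x)) \<longlongrightarrow> 0) (at_right 0)" .
  then have r: "((\<lambda>x. flat_exp P x) \<longlongrightarrow> 0) (at_right 0)"
  proof (rule Lim_transform_eventually)
    show "\<forall>\<^sub>F x in at_right 0. poly P (inverse x) * exp (- inverse x) = flat_exp P x"
      using eventually_at_right_less[of "0::real"]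
      by eventually_elim (simp add: flat_exp_def divide_inverse)
  qed
  have "((\<lambda>x. flat_exp P x) \<longlongrightarrow> 0) (at_left 0)"
    by (rule Lim_transform_eventually[OF tendsto_const])
      (auto simp: flat_exp_def eventually_at_filter)
  with r show ?thesis by (simp add: filterlim_split_at)
qed

text \<open>With \<open>u = 1/x\<close> and \<open>du/dx = - u^2\<close>, the derivative of
  \<open>P(u) exp(-u)\<close> is \<open>u^2 (P(u) - P'(u)) exp(-u)\<close>; the two nested
  \<open>pCons 0\<close> multiply by \<open>u^2\<close>.\<close>

lemma flat_exp_has_derivative:
  "(flat_exp P has_real_derivative flat_exp (pCons 0 (pCons 0 (P - pderiv P))) x) (at x)"
proof -
  consider "x > 0" | "x < 0" | "x = 0" by linarith
  then show ?thesis
  proof cases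
    case 1
    have u: "((\<lambda>x. 1/x) has_real_derivative - (1/x * (1/x))) (at x)"
      using 1 by (auto intro!: derivative_eq_intros)
    have e: "((\<lambda>x. exp (- (1/x))) has_real_derivative exp (- (1/x)) * (1/x * (1/x))) (at x)"
      using DERIV_chain2[OF DERIV_exp DERIV_minus[OF u]] by simp
    have "((\<lambda>x. poly P (1/x) * exp (- (1/x))) has_real_derivative
        flat_exp (pCons 0 (pCons 0 (P - pderiv P))) x) (at x)"
      using DERIV_mult[OF DERIV_chain2[OF poly_DERIV u] e] 1
      by (simp add: flat_exp_def algebra_simps)
    moreover have "\<forall>\<^sub>F y in nhds x. poly P (1/y) * exp (- (1/y)) = flat_exp P y"
      using eventually_nhds_in_open[of "{0<..}" x] 1 
      by (auto elim!: eventually_mono simp: flat_exp_def)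
    ultimately show ?thesis
      using DERIV_cong_ev[OF refl _ refl, of "\<lambda>x. poly P (1/x) * exp (- (1/x))" "flat_exp P" x] by simp
  next
    case 2
    have "\<forall>\<^sub>F y in nhds x. 0 = flat_exp P y"
      using eventually_nhds_in_open[of "{..<0}" x] 2 
      by (auto elim!: eventually_mono simp: flat_exp_def)
    from DERIV_cong_ev[OF refl this refl, of 0] 2 show ?thesis by (simp add: flat_exp_def[of _ x])
  next
    case 3
    \<comment> \<open>Division by \<open>y\<close> multiplies the polynomial by its variable, so the
      difference quotient at 0 again belongs to the family.\<close>
    have "((\<lambda>y. (flat_exp P y - flat_exp P 0) / (y - 0)) \<longlongrightarrow> 0) (at 0)"
    proof (rule Lim_transform_eventually[OF flat_exp_tendsto_0[of "pCons 0 P"]])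
      show "\<forall>\<^sub>F y in at 0. flat_exp (pCons 0 P) y = (flat_exp P y - flat_exp P 0) / (y - 0)"
        by (auto simp: flat_exp_def eventually_at_filter field_simps)
    qed
    then show ?thesis using 3 by (simp add: has_field_derivative_iff flat_exp_def[of _ 0])
  qed
qed

lemma continuous_flat_exp: "continuous_on S (flat_exp P)"
  using flat_exp_has_derivative DERIV_isCont continuous_at_imp_continuous_on by blast

lemma smooth_flat_exp:
  assumes "smooth \<phi>"
  shows "smooth (\<lambda>z. flat_exp P (\<phi> z))"
proof -
  define D where "D n = ((\<lambda>P. pCons 0 (pCons 0 (P - pderiv P))) ^^ n) P" for n
  have "(flat_exp (D n) has_real_derivative flat_exp (D (Suc n)) (\<phi> z)) (at (\<phi> z))" for n z
    unfolding D_def using flat_exp_has_derivative by simp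
  then have "smooth (\<lambda>z. flat_exp (D 0) (\<phi> z))"
    using assms by (intro smooth.compose[of \<phi> "\<lambda>n. flat_exp (D n)"]) auto
  then show ?thesis by (simp add: D_def)
qed

section \<open>Cutoffs and the radial weight\<close>

text \<open>For \<open>u < 1\<close> this is \<open>exp (1 - 1 / (1 - u))\<close>. The argument will
  be a rescaled squared length, hence nonnegative; squaring keeps the cutoffs smooth at the
  origin.\<close>

definition bump :: "real \<Rightarrow> real" where
  "bump u = exp 1 * flat_exp 1 (1 - u)"

definition bump' :: "real \<Rightarrow> real" where
  "bump' u = - exp 1 * flat_exp (pCons 0 (pCons 0 1)) (1 - u)"

lemma bump_0 [simp]: "bump 0 = 1"
  by (simp add: bump_def flat_exp_def exp_minus)

lemma bump_nonneg: "0 \<le> bump u"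
  by (simp add: bump_def flat_exp_def)

lemma bump_le_1: "0 \<le> u \<Longrightarrow> bump u \<le> 1"
  by (simp add: bump_def flat_exp_def flip: exp_add)

lemma bump_eq_0: "1 \<le> u \<Longrightarrow> bump u = 0" and bump'_eq_0: "1 \<le> u \<Longrightarrow> bump' u = 0"
  by (simp_all add: bump_def bump'_def flat_exp_def)

lemma bump_has_derivative: "(bump has_real_derivative bump' u) (at u)"
proof -
  have "((\<lambda>u. flat_exp 1 (1 - u)) has_real_derivative
      flat_exp (pCons 0 (pCons 0 (1 - pderiv 1))) (1 - u) * -1) (at u)"
    by (rule DERIV_chain2[OF flat_exp_has_derivative]) (auto intro!: derivative_eq_intros)
  from DERIV_cmult[OF this, of "exp 1"] show ?thesis by (simp add: bump_def[abs_def] bump'_def)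
qed

lemma continuous_bump: "continuous_on S bump" and continuous_bump': "continuous_on S bump'"
proof -
  show "continuous_on S bump"
    using bump_has_derivative DERIV_isCont continuous_at_imp_continuous_on by blast
  show "continuous_on S bump'"
    unfolding bump'_def[abs_def]
    by (intro continuous_intros continuous_on_compose2[OF continuous_flat_exp[of UNIV]]) auto
qed

text \<open>For \<open>u < 1\<close> and \<open>v = 1 / (1 - u)\<close> the modulus equals
  \<open>exp 1 * v^2 * exp (- v)\<close>, and \<open>v^2 \<le> 2 * exp v\<close> by Taylor
  expansion.\<close>

lemma abs_bump'_le: "\<bar>bump' u\<bar> \<le> 2 * exp 1"
proof (cases "u < 1")
  case True
  define v where "v = 1 / (1 - u)"
  have "v \<ge> 0" using True by (simp add: v_def)
  then have "v\<^sup>2 \<le> 2 * exp v" using exp_lower_Taylor_quadratic[of v] by simp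
  then have "v\<^sup>2 * exp (- v) \<le> 2" by (simp add: exp_minus field_simps)
  from mult_left_mono[OF this, of "exp 1"] show ?thesis using True
    by (simp add: bump'_def flat_exp_def abs_mult v_def power2_eq_square mult_ac)
qed (simp add: bump'_eq_0)

text \<open>Interpolation between a linear bound near 0 and the trivial bound 1. The square root is
  the rate that fits: at \<open>u = s / L^2\<close> it gives \<open>sqrt s / L\<close>, and
  \<open>sqrt s\<close> is what the decay of the weight can compensate.\<close>

lemma one_minus_bump_le:
  assumes "0 \<le> u"
  shows "\<bar>1 - bump u\<bar> \<le> 2 * exp 1 * sqrt u"
proof -
  have e: "1 \<le> 2 * exp (1::real)" using exp_ge_add_one_self[of 1] by linarith
  have "\<bar>bump u - bump 0\<bar> \<le> 2 * exp 1 * \<bar>u - 0\<bar>"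
    using field_differentiable_bound[of UNIV bump bump' "2 * exp 1" u 0] bump_has_derivative abs_bump'_le
    by (simp add: has_field_derivative_at_within)
  then have 1: "\<bar>1 - bump u\<bar> \<le> 2 * exp 1 * u" using assms by simp
  show ?thesis
  proof (cases "u \<le> 1")
    case True
    then have "u \<le> sqrt u" using assms by (simp add: real_le_rsqrt power2_eq_square mult_left_le)
    then have "2 * exp 1 * u \<le> 2 * exp 1 * sqrt u" by simp
    with 1 show ?thesis by linarith
  next
    case False
    then have "1 \<le> sqrt u" by simp
    then have "1 * 1 \<le> 2 * exp 1 * sqrt u" using e by (intro mult_mono) auto
    moreover have "\<bar>1 - bump u\<bar> \<le> 1" using bump_nonneg[of u] bump_le_1[OF assms] by simp
    ultimately show ?thesis by simp
  qed
qed

lemma smooth_bump: "smooth \<phi> \<Longrightarrow> smooth (\<lambda>z. bump (\<phi> z))"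
  unfolding bump_def
  using smooth.mult[OF smooth.const smooth_flat_exp[OF smooth.add[OF smooth.const smooth_scale[of _ "-1"]]], of \<phi> "exp 1" 1 1]
  by simp

text \<open>
  With \<open>\<delta> = 0\<close> and \<open>\<epsilon> = 0\<close> this is
  \<open>(\<bar>x\<bar> x - \<bar>y\<bar> y) \<bullet> (x - y) \<ge> \<bar>x - y\<bar>\<^sup>3 / 2\<close>.  The regularization \<open>\<delta>\<close> costs nothing, as it
  only replaces \<open>x\<close> and \<open>y\<close> by \<open>(x, \<surd>\<delta>)\<close> and \<open>(y, \<surd>\<delta>)\<close>, which have the same difference.
\<close>

lemma cubic_weight_two_point:
  fixes x y :: "'a::real_inner"
  assumes "\<delta> \<ge> 0" "\<epsilon> \<ge> 0"
  defines "m \<equiv> \<lambda>x::'a. sqrt (\<delta> + (norm x)\<^sup>2)"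
  defines "w \<equiv> \<lambda>x::'a. 1 / (1 + \<epsilon> * (\<delta> + (norm x)\<^sup>2))"
  shows "1/2 * (w x * w y * norm (x - y) ^ 3)
    \<le> ((m x * w x) *\<^sub>R x - (m y * w y) *\<^sub>R y) \<bullet> (x - y)"
proof -
  \<comment> \<open>Lengths and inner product of the lifted vectors
    \<open>(x, sqrt \<delta>)\<close> and \<open>(y, sqrt \<delta>)\<close>; Cauchy-Schwarz for them
    is \<open>\<bar>P\<bar> \<le> a * b\<close>.\<close>
  define a b P where "a = m x" "b = m y" "P = \<delta> + x \<bullet> y"
  note defs = this
  have ab: "a \<ge> 0" "b \<ge> 0" using assms by (auto simp: defs m_def)
  have a2: "a\<^sup>2 = \<delta> + x \<bullet> x" and b2: "b\<^sup>2 = \<delta> + y \<bullet> y"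
    using assms by (auto simp: defs m_def power2_norm_eq_inner)
  have "\<bar>x \<bullet> y\<bar> \<le> norm x * norm y" by (rule Cauchy_Schwarz_ineq2)
  moreover have "\<delta> + norm x * norm y \<le> a * b"
  proof (rule power2_le_imp_le)
    have "2 * (norm x * norm y) \<le> (norm x)\<^sup>2 + (norm y)\<^sup>2"
      using sum_squares_bound[of "norm x" "norm y"] by (simp add: mult.assoc)
    from mult_left_mono[OF this assms(1)]
    show "(\<delta> + norm x * norm y)\<^sup>2 \<le> (a * b)\<^sup>2"
      unfolding power_mult_distrib a2 b2 power2_norm_eq_inner[symmetric]
      by (simp add: algebra_simps power2_eq_square)
  qed (use ab in auto)
  ultimately have P: "\<bar>P\<bar> \<le> a * b" using assms(1) by (auto simp: defs)
  define d where "d = norm (x - y)"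
  have d2: "d\<^sup>2 = a\<^sup>2 + b\<^sup>2 - 2 * P"
    by (simp add: d_def a2 b2 defs(3) power2_norm_eq_inner inner_diff inner_commute)
  have "d \<le> a + b"
    by (rule power2_le_imp_le) (use P ab in \<open>auto simp: d2 power2_sum\<close>)
  then have "d * d\<^sup>2 \<le> (a + b) * d\<^sup>2" by (intro mult_right_mono) auto
  \<comment> \<open>The bracket on the right exceeds \<open>d^2\<close> by exactly
    \<open>(a - b)^2\<close>.\<close>
  also have "\<dots> \<le> (a + b) * (2 * (a\<^sup>2 + b\<^sup>2 - a * b - P))"
    using zero_le_power2[of "a - b"] ab
    by (intro mult_left_mono) (auto simp: d2 power2_diff)
  finally have d3: "1/2 * d ^ 3 \<le> (a + b) * (a\<^sup>2 + b\<^sup>2 - a * b - P)"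
    by (simp add: power3_eq_cube power2_eq_square algebra_simps)
  have w: "w x = 1 / (1 + \<epsilon> * a\<^sup>2)" "w y = 1 / (1 + \<epsilon> * b\<^sup>2)"
    by (simp_all add: w_def a2 b2 power2_norm_eq_inner)
  have pos: "1 + \<epsilon> * a\<^sup>2 > 0" "1 + \<epsilon> * b\<^sup>2 > 0" using assms(2) by (simp_all add: add_pos_nonneg)
  have "((m x * w x) *\<^sub>R x - (m y * w y) *\<^sub>R y) \<bullet> (x - y) = a * w x * (a\<^sup>2 - P) + b * w y * (b\<^sup>2 - P)"
    by (simp add: defs(1,2)[symmetric] a2 b2 defs(3) inner_commute algebra_simps)
  also have "\<dots> = w x * w y * (a * (a\<^sup>2 - P) * (1 + \<epsilon> * b\<^sup>2) + b * (b\<^sup>2 - P) * (1 + \<epsilon> * a\<^sup>2))"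
    using pos unfolding w by (simp add: field_simps)
  \<comment> \<open>Over the common denominator, the part without \<open>\<epsilon>\<close> is the
    unweighted inequality, and the part with \<open>\<epsilon>\<close> has the sign of
    \<open>a * b - P\<close>, so the weight \<open>w\<close> does no harm.\<close>
  also have "a * (a\<^sup>2 - P) * (1 + \<epsilon> * b\<^sup>2) + b * (b\<^sup>2 - P) * (1 + \<epsilon> * a\<^sup>2)
     = (a + b) * (a\<^sup>2 + b\<^sup>2 - a * b - P) + \<epsilon> * (a * b * (a + b) * (a * b - P))"
    by algebra
  finally have eq: "((m x * w x) *\<^sub>R x - (m y * w y) *\<^sub>R y) \<bullet> (x - y)
     = w x * w y * ((a + b) * (a\<^sup>2 + b\<^sup>2 - a * b - P) + \<epsilon> * (a * b * (a + b) * (a * b - P)))" .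
  have "0 \<le> \<epsilon> * (a * b * (a + b) * (a * b - P))" using ab P assms(2) by auto
  with d3 have "w x * w y * (1/2 * d ^ 3) \<le> w x * w y * ((a + b) * (a\<^sup>2 + b\<^sup>2 - a * b - P)
      + \<epsilon> * (a * b * (a + b) * (a * b - P)))"
    using pos by (intro mult_left_mono) (auto simp: w)
  then show ?thesis unfolding eq d_def by (simp add: mult.assoc mult.left_commute)
qed

text \<open>The derivative of \<open>e(|x|^2) x\<close> is \<open>e\<close> times the identity plus
  the rank-one map \<open>2 e' x (x \<bullet> v)\<close>; its operator norm at
  \<open>s = |x|^2\<close> is at most \<open>\<bar>e s\<bar> + 2 * \<bar>s * e' s\<bar>\<close>, and
  the mean value inequality applies.\<close>

lemma radial_lipschitz:
  fixes x y :: "'a::euclidean_space"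
  assumes e: "\<And>s. s \<ge> 0 \<Longrightarrow> (e has_real_derivative e' s) (at s)"
    and bound: "\<And>s. s \<ge> 0 \<Longrightarrow> \<bar>e s\<bar> + 2 * \<bar>s * e' s\<bar> \<le> \<kappa>"
  shows "norm (e ((norm x)\<^sup>2) *\<^sub>R x - e ((norm y)\<^sup>2) *\<^sub>R y) \<le> \<kappa> * norm (x - y)"
proof (rule differentiable_bound[of UNIV])
  fix x :: 'a
  let ?D = "\<lambda>v. e ((norm x)\<^sup>2) *\<^sub>R v + (2 * e' ((norm x)\<^sup>2) * (x \<bullet> v)) *\<^sub>R x"
  have "((\<lambda>x. e (x \<bullet> x)) has_derivative (\<lambda>v. e' (x \<bullet> x) * (2 * (x \<bullet> v)))) (at x)"
  proof (rule has_derivative_compose[OF _ e[unfolded has_field_derivative_def]])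
    show "((\<lambda>x. x \<bullet> x) has_derivative (\<lambda>v. 2 * (x \<bullet> v))) (at x)"
      by (auto intro!: derivative_eq_intros simp: inner_commute)
  qed simp
  then show "((\<lambda>x. e ((norm x)\<^sup>2) *\<^sub>R x) has_derivative ?D) (at x within UNIV)"
    by (auto intro!: derivative_eq_intros simp: power2_norm_eq_inner mult_ac)
  have "norm (?D v) \<le> \<kappa> * norm v" for v
  proof -
    have "norm (?D v) \<le> \<bar>e ((norm x)\<^sup>2)\<bar> * norm v + 2 * \<bar>e' ((norm x)\<^sup>2)\<bar> * \<bar>x \<bullet> v\<bar> * norm x"
      by (rule order_trans[OF norm_triangle_ineq]) (simp add: abs_mult)
    also have "\<bar>x \<bullet> v\<bar> \<le> norm x * norm v" by (rule Cauchy_Schwarz_ineq2)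
    finally have "norm (?D v) \<le> (\<bar>e ((norm x)\<^sup>2)\<bar> + 2 * \<bar>(norm x)\<^sup>2 * e' ((norm x)\<^sup>2)\<bar>) * norm v"
      by (simp add: algebra_simps abs_mult power2_eq_square mult_left_mono mult_right_mono)
    also have "\<dots> \<le> \<kappa> * norm v" by (intro mult_right_mono bound) auto
    finally show ?thesis .
  qed
  moreover have "0 \<le> \<kappa>" using bound[of 0] by simp
  ultimately show "onorm ?D \<le> \<kappa>" by (intro onorm_bound) auto
qed auto

text \<open>\<open>p'\<close> is \<open>p\<close> times its logarithmic derivative, which
  \<open>s\<close> times keeps within modulus 1. Hence every term reduces to \<open>p s\<close>
  times a factor of order \<open>sqrt s / L\<close>, where
  \<open>sqrt s * p s \<le> 1 / \<epsilon>\<close>. Each of the contributions is at most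
  \<open>A = 2 * exp 1 / (\<epsilon> * L)\<close>, and \<open>A + 2 * (A + A)\<close> gives the
  10.\<close>

lemma cutoff_error:
  fixes \<epsilon> \<delta> L :: real
  assumes "\<epsilon> > 0" "\<delta> > 0" "L > 0"
  defines "p \<equiv> \<lambda>s. sqrt (\<delta> + s) / (1 + \<epsilon> * (\<delta> + s))"
  defines "p' \<equiv> \<lambda>s. p s * (1 / (2 * (\<delta> + s)) - \<epsilon> / (1 + \<epsilon> * (\<delta> + s)))"
  assumes "s \<ge> 0"
  shows "(p has_real_derivative p' s) (at s)"
    and "\<bar>p s * (1 - bump (s / L\<^sup>2))\<bar>
      + 2 * \<bar>s * (p' s * (1 - bump (s / L\<^sup>2)) - p s * bump' (s / L\<^sup>2) / L\<^sup>2)\<bar> \<le> 10 * exp 1 / (\<epsilon> * L)"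
proof -
  define y where "y = \<delta> + s"
  have y: "y > 0" "s \<le> y" using assms by (auto simp: y_def)
  have y1: "1 + \<epsilon> * y > 0" using y assms by (simp add: add_pos_pos)
  have "((\<lambda>s. sqrt (\<delta> + s)) has_real_derivative inverse (sqrt y) / 2) (at s)"
    using y unfolding y_def by (auto intro!: derivative_eq_intros)
  moreover have "((\<lambda>s. 1 + \<epsilon> * (\<delta> + s)) has_real_derivative \<epsilon>) (at s)"
    by (auto intro!: derivative_eq_intros)
  moreover have "1 + \<epsilon> * (\<delta> + s) \<noteq> 0" using y1 by (simp add: y_def)
  ultimately have "(p has_real_derivative
      (inverse (sqrt y) / 2 * (1 + \<epsilon> * y) - sqrt y * \<epsilon>) / ((1 + \<epsilon> * y) * (1 + \<epsilon> * y))) (at s)"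
    unfolding p_def y_def by (rule DERIV_divide)
  moreover have "(inverse (sqrt y) / 2 * (1 + \<epsilon> * y) - sqrt y * \<epsilon>) / ((1 + \<epsilon> * y) * (1 + \<epsilon> * y)) = p' s"
  proof -
    define r where "r = sqrt y"
    have r: "r > 0" "y = r * r" using y by (auto simp: r_def)
    have p1: "1 + \<epsilon> * (r * r) > 0" using y1 r by simp
    show ?thesis
      unfolding p'_def p_def y_def[symmetric] r_def[symmetric] r(2)
      using r(1) p1 by (simp add: divide_simps)
  qed
  ultimately show "(p has_real_derivative p' s) (at s)" by simp
  have p0: "p s \<ge> 0" unfolding p_def y_def[symmetric] using y y1 by simp
  have "sqrt s * p s \<le> sqrt y * p s" using y p0 by (intro mult_right_mono) auto
  also have "\<dots> = y / (1 + \<epsilon> * y)" unfolding p_def y_def[symmetric] using y by simp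
  also have "\<dots> \<le> 1 / \<epsilon>" using y1 assms by (simp add: field_simps)
  finally have sp: "sqrt s * p s \<le> 1 / \<epsilon>" .
  define A where "A = 2 * exp (1::real) / (\<epsilon> * L)"
  have sL: "sqrt (s / L\<^sup>2) = sqrt s / L" using assms by (simp add: real_sqrt_divide)
  have "p s * \<bar>1 - bump (s / L\<^sup>2)\<bar> \<le> p s * (2 * exp 1 * (sqrt s / L))"
    using one_minus_bump_le[of "s / L\<^sup>2"] assms p0 unfolding sL by (intro mult_left_mono) auto
  also have "\<dots> = (2 * exp 1 / L) * (sqrt s * p s)" by simp
  also have "\<dots> \<le> (2 * exp 1 / L) * (1 / \<epsilon>)" using sp assms by (intro mult_left_mono) auto
  finally have 1: "p s * \<bar>1 - bump (s / L\<^sup>2)\<bar> \<le> A" by (simp add: A_def mult.commute)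
  have "\<bar>s * p' s\<bar> \<le> p s"
  proof -
    have "\<bar>s * (1 / (2 * y) - \<epsilon> / (1 + \<epsilon> * y))\<bar> \<le> 1"
    proof -
      have "0 \<le> s / (2 * y)" "s / (2 * y) \<le> 1" "0 \<le> s * \<epsilon> / (1 + \<epsilon> * y)" "s * \<epsilon> / (1 + \<epsilon> * y) \<le> 1"
        using y y1 assms by (auto simp: field_simps intro: add_increasing)
      then show ?thesis by (simp add: algebra_simps abs_le_iff)
    qed
    from mult_left_mono[OF this p0] show ?thesis
      unfolding p'_def y_def[symmetric] using p0 by (simp add: abs_mult mult.left_commute)
  qed
  then have "\<bar>s * p' s\<bar> * \<bar>1 - bump (s / L\<^sup>2)\<bar> \<le> p s * \<bar>1 - bump (s / L\<^sup>2)\<bar>"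
    by (intro mult_right_mono) auto
  with 1 have 2: "\<bar>s * p' s * (1 - bump (s / L\<^sup>2))\<bar> \<le> A" by (simp add: abs_mult)
  have 3: "\<bar>s * (p s * bump' (s / L\<^sup>2) / L\<^sup>2)\<bar> \<le> A"
  proof (cases "s / L\<^sup>2 \<le> 1")
    case True
    have "0 \<le> s / L\<^sup>2" using assms by simp
    with True have "s / L\<^sup>2 \<le> sqrt (s / L\<^sup>2)"
      by (intro real_le_rsqrt) (simp only: power2_eq_square mult_left_le)
    then have "s / L\<^sup>2 * \<bar>bump' (s / L\<^sup>2)\<bar> \<le> (sqrt s / L) * (2 * exp 1)"
      using abs_bump'_le assms by (intro mult_mono) (auto simp: sL)
    from mult_left_mono[OF this p0]
    have "\<bar>s * (p s * bump' (s / L\<^sup>2) / L\<^sup>2)\<bar> \<le> (2 * exp 1 / L) * (sqrt s * p s)"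
      using assms p0 by (simp add: abs_mult mult_ac)
    also have "\<dots> \<le> (2 * exp 1 / L) * (1 / \<epsilon>)" using sp assms by (intro mult_left_mono) auto
    finally show ?thesis by (simp add: A_def mult.commute)
  next
    case False
    then show ?thesis using assms by (simp add: bump'_eq_0 A_def)
  qed
  have "\<bar>s * (p' s * (1 - bump (s / L\<^sup>2)) - p s * bump' (s / L\<^sup>2) / L\<^sup>2)\<bar> \<le> A + A"
    using 2 3 abs_triangle_ineq4[of "s * p' s * (1 - bump (s / L\<^sup>2))" "s * (p s * bump' (s / L\<^sup>2) / L\<^sup>2)"]
    by (simp add: algebra_simps)
  moreover have "\<bar>p s * (1 - bump (s / L\<^sup>2))\<bar> \<le> A" using 1 p0 by (simp add: abs_mult)
  moreover have "A + 2 * (A + A) = 10 * exp 1 / (\<epsilon> * L)" by (simp add: A_def)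
  ultimately show "\<bar>p s * (1 - bump (s / L\<^sup>2))\<bar>
      + 2 * \<bar>s * (p' s * (1 - bump (s / L\<^sup>2)) - p s * bump' (s / L\<^sup>2) / L\<^sup>2)\<bar> \<le> 10 * exp 1 / (\<epsilon> * L)"
    by (metis add_mono mult_left_mono zero_le_numeral)
qed

text \<open>
  The weight \<open>sqrt (\<delta> + s) / (1 + \<epsilon> * (\<delta> + s))\<close> is of order \<open>1 / sqrt s\<close> at infinity, so cutting it off
  at the scale \<open>L\<close> perturbs the vector field by one with Lipschitz constant of order \<open>1 / (\<epsilon> * L)\<close>.
\<close>

lemma radial_weight_exists:
  fixes \<epsilon> \<kappa> :: real
  assumes "\<epsilon> > 0" "\<kappa> > 0"
  obtains p p' :: "real \<Rightarrow> real" and w :: "'a::euclidean_space \<Rightarrow> real" and r :: real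
  where "smooth (\<lambda>x::'a. p ((norm x)\<^sup>2))"
    and "\<And>s. s \<ge> 0 \<Longrightarrow> (p has_real_derivative p' s) (at s)"
    and "continuous_on {0..} p'"
    and "r > 0" "\<And>s. s \<ge> r\<^sup>2 \<Longrightarrow> p s = 0 \<and> p' s = 0"
    and "\<And>x y. 1/2 * (w x * w y * norm (x - y) ^ 3) - \<kappa> * (norm (x - y))\<^sup>2
      \<le> (p ((norm x)\<^sup>2) *\<^sub>R x - p ((norm y)\<^sup>2) *\<^sub>R y) \<bullet> (x - y)"
    and "\<And>x. p ((norm x)\<^sup>2) \<le> w x * (norm x + \<kappa>)"
    and "\<And>x. 1 / (1 + \<epsilon> * (1 + (norm x)\<^sup>2)) \<le> w x" "\<And>x. w x \<le> 1 / (1 + \<epsilon> * (norm x)\<^sup>2)"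
    and "continuous_on UNIV w"
proof -
  \<comment> \<open>Positive, so that the square root is smooth at the origin; at most 1, so that
    the lower bound on \<open>w\<close> contains no \<open>\<delta>\<close>; and
    \<open>sqrt \<delta> \<le> \<kappa>\<close>, which is the error in the radial bound.\<close>
  define \<delta> where "\<delta> = min 1 (\<kappa>\<^sup>2)"
  have \<delta>: "\<delta> > 0" "\<delta> \<le> 1" "sqrt \<delta> \<le> \<kappa>" using assms by (auto simp: \<delta>_def real_le_lsqrt)
  \<comment> \<open>Solves \<open>10 * exp 1 / (\<epsilon> * L) = \<kappa>\<close>.\<close>
  define L where "L = 10 * exp (1::real) / (\<epsilon> * \<kappa>)"
  have L: "L > 0" "10 * exp 1 / (\<epsilon> * L) = \<kappa>" using assms by (auto simp: L_def)
  define p where "p s = sqrt (\<delta> + s) / (1 + \<epsilon> * (\<delta> + s))" for s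
  define p' where "p' s = p s * (1 / (2 * (\<delta> + s)) - \<epsilon> / (1 + \<epsilon> * (\<delta> + s)))" for s
  define w where "w x = 1 / (1 + \<epsilon> * (\<delta> + (norm x)\<^sup>2))" for x :: 'a
  define P where "P s = p s * bump (s / L\<^sup>2)" for s
  define P' where "P' s = p' s * bump (s / L\<^sup>2) + p s * bump' (s / L\<^sup>2) / L\<^sup>2" for s
  note dp = cutoff_error(1)[OF assms(1) \<delta>(1) L(1), folded p_def, folded p'_def]
  note ep = cutoff_error(2)[OF assms(1) \<delta>(1) L(1), folded p_def, folded p'_def, unfolded L(2)]
  have db: "((\<lambda>s. bump (s / L\<^sup>2)) has_real_derivative bump' (s / L\<^sup>2) * (1 / L\<^sup>2)) (at s)" for s
    by (rule DERIV_chain2[OF bump_has_derivative]) (rule DERIV_cdivide[OF DERIV_ident])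
  have pos: "1 + \<epsilon> * (\<delta> + s) > 0" if "s \<ge> 0" for s
    using that assms \<delta> by (simp add: add_pos_nonneg)
  have w0: "w x > 0" for x using pos by (simp add: w_def)
  show thesis
  proof
    have a: "smooth (\<lambda>x::'a. \<delta> + (norm x)\<^sup>2)"
      by (intro smooth.add smooth.const smooth_norm_square)
    have "smooth (\<lambda>x::'a. (\<delta> + (norm x)\<^sup>2) powr (1/2) * (1 + \<epsilon> * (\<delta> + (norm x)\<^sup>2)) powr (-1)
        * bump ((norm x)\<^sup>2 * (1 / L\<^sup>2)))"
      using pos \<delta> a by (intro smooth.mult smooth_powr smooth.add[OF smooth.const smooth.mult[OF smooth.const a]]
          smooth_bump smooth_scale smooth_norm_square) (auto intro: add_pos_nonneg)
    moreover have "(\<lambda>x::'a. (\<delta> + (norm x)\<^sup>2) powr (1/2) * (1 + \<epsilon> * (\<delta> + (norm x)\<^sup>2)) powr (-1)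
        * bump ((norm x)\<^sup>2 * (1 / L\<^sup>2))) = (\<lambda>x. P ((norm x)\<^sup>2))"
      using pos \<delta> less_imp_le[OF pos] by (auto simp: P_def p_def powr_half_sqrt powr_minus_divide)
    ultimately show "smooth (\<lambda>x::'a. P ((norm x)\<^sup>2))" by simp
    show "(P has_real_derivative P' s) (at s)" if "s \<ge> 0" for s
      unfolding P_def[abs_def] P'_def using DERIV_mult[OF dp[OF that] db] by (simp add: mult_ac)
    have nz: "\<delta> + s \<noteq> 0" "1 + \<epsilon> * (\<delta> + s) \<noteq> 0" if "s \<in> {0..}" for s using pos[of s] that \<delta> by auto
    have "continuous_on {0..} p" unfolding p_def[abs_def] using nz by (intro continuous_intros) auto
    moreover from this have "continuous_on {0..} p'"
      unfolding p'_def[abs_def] using nz \<delta> by (intro continuous_intros) (auto simp: add_pos_nonneg less_imp_neq)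
    ultimately show "continuous_on {0..} P'" unfolding P'_def[abs_def]
      using L by (intro continuous_intros continuous_on_compose2[OF continuous_bump[of UNIV]]
         continuous_on_compose2[OF continuous_bump'[of UNIV]]) auto
    show "L > 0" by (rule L(1))
    show "P s = 0 \<and> P' s = 0" if "s \<ge> L\<^sup>2" for s
      using that L by (simp add: P_def P'_def bump_eq_0 bump'_eq_0)
    show "1/2 * (w x * w y * norm (x - y) ^ 3) - \<kappa> * (norm (x - y))\<^sup>2
      \<le> (P ((norm x)\<^sup>2) *\<^sub>R x - P ((norm y)\<^sup>2) *\<^sub>R y) \<bullet> (x - y)" for x y
    proof -
      \<comment> \<open>\<open>?E\<close> is the difference of the field that the cutoff removes.
        The field without cutoff satisfies the inequality with no defect, so the defect is the
        Lipschitz constant of the removed part.\<close>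
      let ?e = "\<lambda>s. p s * (1 - bump (s / L\<^sup>2))"
      let ?E = "?e ((norm x)\<^sup>2) *\<^sub>R x - ?e ((norm y)\<^sup>2) *\<^sub>R y"
      have "(?e has_real_derivative (p' s * (1 - bump (s / L\<^sup>2)) - p s * bump' (s / L\<^sup>2) / L\<^sup>2)) (at s)"
        if "s \<ge> 0" for s
        using DERIV_mult[OF dp[OF that] DERIV_diff[OF DERIV_const db]] by (simp add: mult_ac)
      from radial_lipschitz[OF this ep] have "norm ?E \<le> \<kappa> * norm (x - y)" by simp
      then have "?E \<bullet> (x - y) \<le> \<kappa> * norm (x - y) * norm (x - y)"
        using norm_cauchy_schwarz[of ?E "x - y"] mult_right_mono[of "norm ?E" "\<kappa> * norm (x - y)" "norm (x - y)"]
        by (meson norm_ge_zero order_trans)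
      moreover have "P ((norm x)\<^sup>2) *\<^sub>R x - P ((norm y)\<^sup>2) *\<^sub>R y
          = (p ((norm x)\<^sup>2) *\<^sub>R x - p ((norm y)\<^sup>2) *\<^sub>R y) - ?E"
        by (simp add: P_def algebra_simps)
      moreover have "1/2 * (w x * w y * norm (x - y) ^ 3)
          \<le> (p ((norm x)\<^sup>2) *\<^sub>R x - p ((norm y)\<^sup>2) *\<^sub>R y) \<bullet> (x - y)"
        using cubic_weight_two_point[of \<delta> \<epsilon> x y] assms \<delta> by (simp add: p_def w_def)
      ultimately show ?thesis by (simp add: inner_diff_left power2_eq_square)
    qed
    show "P ((norm x)\<^sup>2) \<le> w x * (norm x + \<kappa>)" for x
    proof -
      have "P ((norm x)\<^sup>2) \<le> p ((norm x)\<^sup>2) * 1"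
        unfolding P_def using pos[of "(norm x)\<^sup>2"] \<delta> 
        by (intro mult_left_mono bump_le_1) (auto simp: p_def)
      also have "\<dots> = w x * sqrt (\<delta> + (norm x)\<^sup>2)" by (simp add: p_def w_def)
      also have "sqrt (\<delta> + (norm x)\<^sup>2) \<le> sqrt \<delta> + sqrt ((norm x)\<^sup>2)" using \<delta> by (intro sqrt_add_le_add_sqrt) auto
      also have "\<dots> \<le> norm x + \<kappa>" using \<delta> by simp
      finally show ?thesis using w0[of x] by (simp add: less_imp_le)
    qed
    show "1 / (1 + \<epsilon> * (1 + (norm x)\<^sup>2)) \<le> w x" "w x \<le> 1 / (1 + \<epsilon> * (norm x)\<^sup>2)" for x
      unfolding w_def using pos[of "(norm x)\<^sup>2"] assms \<delta>
      by (intro divide_left_mono mult_pos_pos; (simp add: add_pos_nonneg mult_left_mono)?)+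
    show "continuous_on UNIV w" unfolding w_def[abs_def]
      using pos less_imp_neq[OF pos] by (intro continuous_intros) (metis zero_le_power2)
  qed
qed

section \<open>The profile of the time cutoff\<close>

lemma flat_exp_tendsto_1: "(flat_exp 1 \<longlongrightarrow> 1) at_top"
proof (rule Lim_transform_eventually)
  have "((\<lambda>x::real. - inverse x) \<longlongrightarrow> - 0) at_top"
    by (intro tendsto_intros tendsto_inverse_0_at_top filterlim_ident)
  from tendsto_exp[OF this] show "((\<lambda>x::real. exp (- inverse x)) \<longlongrightarrow> 1) at_top" by simp
  show "\<forall>\<^sub>F x in at_top. exp (- inverse x) = flat_exp 1 x"
    using eventually_gt_at_top[of "0::real"] by eventually_elim (simp add: flat_exp_def divide_inverse)
qed

lemma flat_exp_1_bounds: "0 \<le> flat_exp 1 x" "flat_exp 1 x \<le> 1"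
  by (auto simp: flat_exp_def)

text \<open>The profile will be stretched by \<open>T\<close>: the integral of the modulus of its
  derivative stays bounded, and the loss against the indicator becomes at most
  \<open>\<eta> * T\<close>. Its support starts at \<open>a > 0\<close> because test functions live
  on positive times.\<close>

lemma time_profile:
  assumes "\<eta> > 0"
  obtains \<beta> \<beta>' :: "real \<Rightarrow> real" and a B :: real
  where "0 < a" "smooth \<beta>" "\<And>u. (\<beta> has_real_derivative \<beta>' u) (at u)" "continuous_on UNIV \<beta>'"
    "\<And>u. 0 \<le> \<beta> u" "\<And>u. \<beta> u \<le> 1" "\<And>u. u \<notin> {a..1} \<Longrightarrow> \<beta> u = 0" "\<And>u. u \<notin> {a..1} \<Longrightarrow> \<beta>' u = 0"
    "\<And>u. \<bar>\<beta>' u\<bar> \<le> B" "(LINT u|lborel. indicator {0..1} u * (1 - \<beta> u)) \<le> \<eta>"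
proof -
  \<comment> \<open>The first factor vanishes up to \<open>1 / Suc n\<close>, the second from 1 on,
    and both tend to 1 inside the interval as \<open>n\<close> grows.\<close>
  define b where "b n u = flat_exp 1 (real (Suc n) * u - 1) * flat_exp 1 (real (Suc n) * (1 - u))" for n u
  define D where "D = flat_exp (pCons 0 (pCons 0 1))"
  define b' where "b' n u = real (Suc n) * (D (real (Suc n) * u - 1) * flat_exp 1 (real (Suc n) * (1 - u))
      - flat_exp 1 (real (Suc n) * u - 1) * D (real (Suc n) * (1 - u)))" for n u
  have b01: "0 \<le> b n u" "b n u \<le> 1" for n u
    using flat_exp_1_bounds by (auto simp: b_def intro: mult_le_one)
  have smooth: "smooth (b n)" for n
  proof -
    have id: "smooth (\<lambda>u::real. u)" using smooth.inner[of "1::real"] by simp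
    have "smooth (\<lambda>u. u * real (Suc n) + (-1))" "smooth (\<lambda>u. u * (- real (Suc n)) + real (Suc n))"
      using smooth.add[OF smooth_scale[OF id] smooth.const] by blast+
    then have "smooth (\<lambda>u. flat_exp 1 (u * real (Suc n) + (-1)) * flat_exp 1 (u * (- real (Suc n)) + real (Suc n)))"
      by (intro smooth.mult smooth_flat_exp)
    also have "(\<lambda>u. flat_exp 1 (u * real (Suc n) + (-1)) * flat_exp 1 (u * (- real (Suc n)) + real (Suc n))) = b n"
      by (simp add: b_def[abs_def] algebra_simps)
    finally show ?thesis .
  qed
  have deriv: "(b n has_real_derivative b' n u) (at u)" for n u
  proof -
    have f: "(flat_exp 1 has_real_derivative D x) (at x)" for x
      using flat_exp_has_derivative[of 1 x] by (simp add: D_def)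
    have 1: "((\<lambda>u. flat_exp 1 (real (Suc n) * u - 1)) has_real_derivative D (real (Suc n) * u - 1) * real (Suc n)) (at u)"
      by (rule DERIV_chain2[OF f]) (auto intro!: derivative_eq_intros)
    have 2: "((\<lambda>u. flat_exp 1 (real (Suc n) * (1 - u))) has_real_derivative D (real (Suc n) * (1 - u)) * - real (Suc n)) (at u)"
      by (rule DERIV_chain2[OF f]) (auto intro!: derivative_eq_intros)
    show ?thesis
      unfolding b_def[abs_def] b'_def using DERIV_mult[OF 1 2] by (simp add: algebra_simps)
  qed
  have cont: "continuous_on UNIV (b' n)" for n
    unfolding b'_def[abs_def] D_def
    by (intro continuous_intros continuous_on_compose2[OF continuous_flat_exp[of UNIV]]) auto
  have supp: "b n u = 0" "b' n u = 0" if "u \<notin> {1 / real (Suc n)..1}" for n u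
  proof -
    have "real (Suc n) * u - 1 \<le> 0 \<or> real (Suc n) * (1 - u) \<le> 0"
    proof (cases "u > 1")
      case True
      then show ?thesis by (intro disjI2 mult_nonneg_nonpos) auto
    next
      case False
      then have "u < 1 / real (Suc n)" using that by auto
      then show ?thesis by (intro disjI1) (simp add: field_simps)
    qed
    then show "b n u = 0" "b' n u = 0" by (auto simp: b_def b'_def D_def flat_exp_def)
  qed
  have "(\<lambda>n. LINT u|lborel. indicator {0..1} u * (1 - b n u)) \<longlonglongrightarrow> (LINT (u::real)|lborel. (0::real))"
  proof (rule integral_dominated_convergence[where w="indicator {0..1}"])
    show "(\<lambda>u. indicator {0..1} u * (1 - b n u)) \<in> borel_measurable lborel" for n
      using smooth_C_k[OF smooth, of 0] by (intro borel_measurable_times borel_measurable_diff)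
        (auto intro: borel_measurable_continuous_onI)
    show "AE u in lborel. (\<lambda>n. indicator {0..1} u * (1 - b n u)) \<longlonglongrightarrow> 0"
      using AE_lborel_singleton[of 0] AE_lborel_singleton[of 1]
    proof eventually_elim
      case (elim u)
      show ?case
      proof (cases "u \<in> {0..1}")
        case True
        then have u: "0 < u" "u < 1" using elim by auto
        have r: "filterlim (\<lambda>n. real (Suc n)) at_top sequentially"
          using filterlim_real_sequentially by (simp only: filterlim_sequentially_Suc)
        have "filterlim (\<lambda>n. - 1 + u * real (Suc n)) at_top sequentially"
          by (intro filterlim_tendsto_add_at_top[OF tendsto_const] filterlim_tendsto_pos_mult_at_top[OF tendsto_const u(1) r])
        from filterlim_compose[OF flat_exp_tendsto_1 this]
        have 1: "(\<lambda>n. flat_exp 1 (real (Suc n) * u - 1)) \<longlonglongrightarrow> 1" by (simp add: mult.commute)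
        have "filterlim (\<lambda>n. (1 - u) * real (Suc n)) at_top sequentially"
          using u by (intro filterlim_tendsto_pos_mult_at_top[OF tendsto_const _ r]) auto
        from filterlim_compose[OF flat_exp_tendsto_1 this]
        have 2: "(\<lambda>n. flat_exp 1 (real (Suc n) * (1 - u))) \<longlonglongrightarrow> 1" by (simp only: mult.commute)
        have "(\<lambda>n. 1 * (1 - b n u)) \<longlonglongrightarrow> 1 * (1 - 1 * 1)"
          unfolding b_def by (intro tendsto_intros 1 2)
        then show ?thesis using True by simp
      qed simp
    qed
    show "AE u in lborel. norm (indicator {0..1} u * (1 - b n u)) \<le> indicator {0..1} u" for n
      using b01 by (auto simp: indicator_def)
  qed auto
  then have "(\<lambda>n. LINT u|lborel. indicator {0..1} u * (1 - b n u)) \<longlonglongrightarrow> 0" by simp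
  from eventually_happens'[OF sequentially_bot order_tendstoD(2)[OF this assms]]
  obtain n where n: "(LINT u|lborel. indicator {0..1} u * (1 - b n u)) < \<eta>" by blast
  have "bounded (b' n ` {1 / real (Suc n)..1})"
    using cont by (intro compact_imp_bounded compact_continuous_image) (auto intro: continuous_on_subset)
  then obtain B where B: "\<And>u. u \<in> {1 / real (Suc n)..1} \<Longrightarrow> \<bar>b' n u\<bar> \<le> B"
    unfolding bounded_iff ball_simps real_norm_def by blast
  show thesis
  proof (rule that[of "1 / real (Suc n)" "b n" "b' n" "max B 0"])
    show "\<bar>b' n u\<bar> \<le> max B 0" for u
      using B[of u] supp(2)[of u n] by (cases "u \<in> {1 / real (Suc n)..1}") auto
  qed (use smooth deriv cont b01 supp n in auto)
qed

section \<open>Energy bounds\<close>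

type_synonym v3 = "real^3"

text \<open>Dyadic decomposition: on the shell of radius about \<open>2^(-n)\<close> the integrand
  is of order \<open>2^(5n/2)\<close> and the volume of order \<open>2^(-3n)\<close>, which leaves a
  geometric series of ratio \<open>2^(-1/2)\<close>.\<close>

lemma nn_integral_norm_powr_ball:
  "(\<integral>\<^sup>+ (x::v3). ennreal (norm x powr (-5/2)) * indicator (ball 0 1) x \<partial>lborel) < \<infinity>"
proof -
  let ?h = "1/2::real"
  let ?c = "unit_ball_vol 3"
  have c: "?c \<ge> 0" by simp
  define s where "s n x = ennreal ((?h ^ Suc n) powr (-5/2)) * indicator (ball 0 (?h ^ n)) x" for n and x :: v3
  have [measurable]: "s n \<in> borel_measurable borel" for n
    unfolding s_def by (intro borel_measurable_times_ennreal borel_measurable_const borel_measurable_indicator) simp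
  have "(\<integral>\<^sup>+ (x::v3). ennreal (norm x powr (-5/2)) * indicator (ball 0 1) x \<partial>lborel)
      \<le> (\<integral>\<^sup>+ x. (\<Sum>n. s n x) \<partial>lborel)"
  proof (intro nn_integral_mono)
    fix x :: v3
    show "ennreal (norm x powr (-5/2)) * indicator (ball 0 1) x \<le> (\<Sum>n. s n x)"
    proof (cases "x \<noteq> 0 \<and> norm x < 1")
      case True
      then obtain m where m: "?h ^ m < norm x" using real_arch_pow_inv[of "norm x" ?h] by auto
      \<comment> \<open>Minimality gives \<open>norm x < ?h ^ n\<close>; for \<open>n = 0\<close>
        this bound is the radius of the ball.\<close>
      define n where "n = (LEAST n. ?h ^ Suc n \<le> norm x)"
      have "\<exists>n. ?h ^ Suc n \<le> norm x" using m by (intro exI[of _ m]) (use norm_ge_zero[of x] in \<open>simp only: power_Suc; linarith\<close>)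
      then have n: "?h ^ Suc n \<le> norm x" unfolding n_def by (rule LeastI_ex)
      have "norm x < ?h ^ n"
      proof (cases n)
        case 0 then show ?thesis using True by simp
      next
        case (Suc k)
        then have "\<not> ?h ^ Suc k \<le> norm x" using not_less_Least[of k "\<lambda>n. ?h ^ Suc n \<le> norm x"] unfolding n_def[symmetric] by simp
        then show ?thesis using Suc by simp
      qed
      then have "ennreal (norm x powr (-5/2)) \<le> s n x"
        unfolding s_def using n True by (simp add: powr_mono2' ennreal_leI)
      also have "\<dots> \<le> (\<Sum>n. s n x)"
        using sum_le_suminf[of "\<lambda>n. s n x" "{n}"] by auto
      finally show ?thesis using True by simp
    qed (auto simp: indicator_def)
  qed
  also have "\<dots> = (\<Sum>n. \<integral>\<^sup>+ x. s n x \<partial>lborel)"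
    by (rule nn_integral_suminf) simp
  also have "\<dots> = (\<Sum>n. ennreal (?c * 2 powr (5/2) * (2 powr (-1/2)) ^ n))"
  proof (intro suminf_cong)
    fix n
    have "(\<integral>\<^sup>+ x. s n x \<partial>lborel) = ennreal ((?h ^ Suc n) powr (-5/2)) * emeasure lborel (ball (0::v3) (?h ^ n))"
      unfolding s_def by (simp add: nn_integral_cmult_indicator)
    also have "emeasure lborel (ball (0::v3) (?h ^ n)) = ennreal (?c * (?h ^ n) ^ 3)"
      by (simp add: emeasure_ball)
    also have "ennreal ((?h ^ Suc n) powr (-5/2)) * \<dots> = ennreal ((?h ^ Suc n) powr (-5/2) * (?c * (?h ^ n) ^ 3))"
      using c by (simp add: ennreal_mult)
    also have "(?h ^ Suc n) powr (-5/2) * (?c * (?h ^ n) ^ 3) = ?c * 2 powr (5/2) * (2 powr (-1/2)) ^ n"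
    proof -
      have h: "?h ^ k = 2 powr (- real k)" for k
        by (simp add: powr_minus powr_realpow power_one_over inverse_eq_divide)
      have "(?h ^ Suc n) powr (-5/2) = 2 powr (5/2 + 5/2 * n)"
        unfolding h by (simp add: powr_powr algebra_simps diff_divide_distrib)
      moreover have "(?h ^ n) ^ 3 = 2 powr (- 3 * n)" unfolding h by (simp add: powr_power mult.commute)
      moreover have "(2 powr (-1/2)) ^ n = 2 powr (- 1/2 * real n)" by (simp add: powr_realpow[symmetric] powr_powr)
      moreover have "(2::real) powr (5/2 + 5/2 * n) * 2 powr (- 3 * n) = 2 powr (5/2) * 2 powr (- 1/2 * n)"
        by (simp add: powr_add[symmetric])
      ultimately show ?thesis by (simp only: mult.left_commute mult.assoc)
    qed
    finally show "(\<integral>\<^sup>+ x. s n x \<partial>lborel) = ennreal (?c * 2 powr (5/2) * (2 powr (-1/2)) ^ n)" .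
  qed
  also have "\<dots> < \<infinity>"
  proof -
    have "(2::real) powr (-1/2) < 1" by (simp add: powr_less_one)
    then have "summable (\<lambda>n. ?c * 2 powr (5/2) * (2 powr (-1/2)) ^ n)"
      by (intro summable_mult summable_geometric) simp
    then show ?thesis using c by (subst suminf_ennreal2) auto
  qed
  finally show ?thesis .
qed

text \<open>The exponent arises twice: as \<open>|x|^(-1)\<close> times the cube of a velocity of
  order \<open>|x|^(-1/2)\<close>, and as the force \<open>|x|^(-2)\<close> raised to the power
  5/4.\<close>

definition ball_kernel :: "v3 \<Rightarrow> ennreal" where
  "ball_kernel x = ennreal (norm x powr (-5/2)) * indicator (ball 0 1) x"

lemma ball_kernel_measurable [measurable]: "ball_kernel \<in> borel_measurable borel"
  unfolding ball_kernel_def by (intro borel_measurable_times_ennreal borel_measurable_indicator) auto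

lemma nn_integral_translate:
  assumes [measurable]: "h \<in> borel_measurable borel"
  shows "(\<integral>\<^sup>+ x. h (c + x) \<partial>lborel) = (\<integral>\<^sup>+ x. h x \<partial>(lborel::'a::euclidean_space measure))"
  by (subst (2) lborel_distr_plus[of c, symmetric], subst nn_integral_distr) simp_all

lemma nn_integral_ball_kernel_diff:
  "(\<integral>\<^sup>+ x. ball_kernel (x - y) \<partial>lborel) = (integral\<^sup>N lborel ball_kernel)"
  "(\<integral>\<^sup>+ x. ball_kernel (y - x) \<partial>lborel) = (integral\<^sup>N lborel ball_kernel)"
proof -
  show 1: "(\<integral>\<^sup>+ x. ball_kernel (x - y) \<partial>lborel) = (integral\<^sup>N lborel ball_kernel)"
    using nn_integral_translate[of ball_kernel "- y"] by simp
  have "ball_kernel (y - x) = ball_kernel (x - y)" for x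
    by (simp add: ball_kernel_def norm_minus_commute indicator_def)
  with 1 show "(\<integral>\<^sup>+ x. ball_kernel (y - x) \<partial>lborel) = (integral\<^sup>N lborel ball_kernel)" by simp
qed

section \<open>Densities at a fixed time and the energy bounds that the Pauli principle
  provides\<close>

definition kinetic_density :: "(v3 \<Rightarrow> v3 \<Rightarrow> real) \<Rightarrow> v3 \<Rightarrow> ennreal" where
  "kinetic_density u x = (\<integral>\<^sup>+ \<xi>. ennreal (1 / 2 * (norm \<xi>)\<^sup>2 * u x \<xi> / (2 * pi) ^ 3) \<partial>lborel)"

lemma kinetic_energy_eq: "kinetic_energy u = (\<integral>\<^sup>+ x. kinetic_density u x \<partial>lborel)"
  by (simp add: kinetic_energy_def kinetic_density_def nn_integral_completion)

lemma spatial_density_eq: "spatial_density u x = (\<integral>\<^sup>+ \<xi>. ennreal (u x \<xi> / (2 * pi) ^ 3) \<partial>lborel)"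
  by (simp add: spatial_density_def nn_integral_completion)

lemma attraction_energy_eq:
  "attraction_energy Z u = (\<integral>\<^sup>+ x. ennreal (Z / norm x) * spatial_density u x \<partial>lborel)"
  by (simp add: attraction_energy_def nn_integral_completion)

lemma repulsion_energy_eq: "repulsion_energy u = 1 / 2 * (\<integral>\<^sup>+ x. (\<integral>\<^sup>+ y.
     spatial_density u x * spatial_density u y * ennreal (1 / norm (x - y)) \<partial>lborel) \<partial>lborel)"
  by (simp add: repulsion_energy_def nn_integral_completion)

lemma density_measurable [measurable]:
  assumes [measurable]: "case_prod u \<in> borel_measurable (borel \<Otimes>\<^sub>M borel)"
  shows "spatial_density u \<in> borel_measurable borel" "kinetic_density u \<in> borel_measurable borel"
  unfolding spatial_density_eq[abs_def] kinetic_density_def[abs_def] by measurable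

locale phase_space_density =
  fixes q :: real and u :: "v3 \<Rightarrow> v3 \<Rightarrow> real"
  assumes q_pos: "q > 0"
    and u_measurable [measurable]: "case_prod u \<in> borel_measurable (borel \<Otimes>\<^sub>M borel)"
    and u_bounds: "\<And>x \<xi>. 0 \<le> u x \<xi>" "\<And>x \<xi>. u x \<xi> \<le> q"
begin

abbreviation "\<rho> \<equiv> spatial_density u"
abbreviation "\<tau> \<equiv> kinetic_density u"

text \<open>This is where the Pauli principle enters: velocities shorter than \<open>r\<close> contribute at most \<open>q\<close> times the volume of a ball.\<close>

lemma density_le:
  assumes "r > 0"
  shows "\<rho> x \<le> ennreal (q * unit_ball_vol 3 / (2 * pi) ^ 3 * r ^ 3) + ennreal (2 / r\<^sup>2) * \<tau> x"
proof -
  have [measurable]: "u x \<in> borel_measurable borel" "ball (0::v3) r \<in> sets borel" by measurable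
  have "\<rho> x \<le> (\<integral>\<^sup>+ \<xi>. ennreal (q / (2 * pi) ^ 3) * indicator (ball 0 r) \<xi>
      + ennreal (2 / r\<^sup>2) * ennreal (1 / 2 * (norm \<xi>)\<^sup>2 * u x \<xi> / (2 * pi) ^ 3) \<partial>lborel)"
    unfolding spatial_density_eq
  proof (intro nn_integral_mono)
    fix \<xi> :: v3
    show "ennreal (u x \<xi> / (2 * pi) ^ 3) \<le> ennreal (q / (2 * pi) ^ 3) * indicator (ball 0 r) \<xi>
      + ennreal (2 / r\<^sup>2) * ennreal (1 / 2 * (norm \<xi>)\<^sup>2 * u x \<xi> / (2 * pi) ^ 3)"
    proof (cases "norm \<xi> < r")
      case True
      have "ennreal (u x \<xi> / (2 * pi) ^ 3) \<le> ennreal (q / (2 * pi) ^ 3)"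
        using u_bounds by (intro ennreal_leI divide_right_mono) auto
      then show ?thesis using True by (simp add: add_increasing2)
    next
      case False
      then have "r\<^sup>2 \<le> (norm \<xi>)\<^sup>2" using assms by (intro power_mono) auto
      then have "1 \<le> (norm \<xi>)\<^sup>2 / r\<^sup>2" using assms by simp
      from mult_right_mono[OF this, of "u x \<xi> / (2 * pi) ^ 3"] u_bounds[of x \<xi>]
      have "u x \<xi> / (2 * pi) ^ 3 \<le> 2 / r\<^sup>2 * (1 / 2 * (norm \<xi>)\<^sup>2 * u x \<xi> / (2 * pi) ^ 3)" by (simp add: mult_ac)
      then show ?thesis using False u_bounds assms by (simp add: ennreal_mult[symmetric] ennreal_leI)
    qed
  qed
  also have "\<dots> = ennreal (q / (2 * pi) ^ 3) * emeasure lborel (ball (0::v3) r) + ennreal (2 / r\<^sup>2) * \<tau> x"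
    unfolding kinetic_density_def
    by (subst nn_integral_add) (simp_all add: nn_integral_cmult)
  also have "ennreal (q / (2 * pi) ^ 3) * emeasure lborel (ball (0::v3) r)
      = ennreal (q * unit_ball_vol 3 / (2 * pi) ^ 3 * r ^ 3)"
    using q_pos assms by (simp add: emeasure_ball ennreal_mult[symmetric])
  finally show ?thesis .
qed

text \<open>A pointwise inequality of Lieb-Thirring type: the velocity \<open>r\<close> in
  \<open>density_le\<close> is adapted to the value of the density at \<open>x\<close>.\<close>

lemma density_powr_le:
  assumes "\<tau> x < \<infinity>"
  shows "\<rho> x < \<infinity>"
    "ennreal (enn2real (\<rho> x) powr (5/3)) \<le> ennreal (4 * (2 * (q * unit_ball_vol 3 / (2 * pi) ^ 3)) powr (2/3)) * \<tau> x"
proof -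
  define c where "c = q * unit_ball_vol 3 / (2 * pi) ^ 3"
  have c: "c > 0" using q_pos by (simp add: c_def)
  note le = density_le[folded c_def]
  show fin: "\<rho> x < \<infinity>" using le[of 1 x] assms by (auto simp: ennreal_mult_less_top intro: le_less_trans)
  define a where "a = enn2real (\<rho> x)"
  define b where "b = enn2real (\<tau> x)"
  have ab: "\<rho> x = ennreal a" "\<tau> x = ennreal b" "a \<ge> 0" "b \<ge> 0"
    using fin assms by (simp_all add: a_def b_def)
  have "a powr (5/3) \<le> 4 * (2 * c) powr (2/3) * b"
  proof (cases "a = 0")
    case False
    with ab have a: "a > 0" by simp
    \<comment> \<open>With this choice \<open>c * r ^ 3 = a / 2\<close>, so the contribution of the
      slow particles is absorbed on the left.\<close>
    define r where "r = (a / (2 * c)) powr (1/3)"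
    have r: "r > 0" "r ^ 3 = a / (2 * c)" using a c by (simp_all add: r_def powr_power)
    have r2: "r\<^sup>2 = a powr (2/3) / (2 * c) powr (2/3)"
      using a c by (simp add: r_def powr_power powr_divide[symmetric])
    have "ennreal a \<le> ennreal (c * r ^ 3 + 2 / r\<^sup>2 * b)"
      using le[OF r(1), of x] r c ab by (simp add: ennreal_mult[symmetric] ennreal_plus[symmetric] del: ennreal_plus)
    then have "a \<le> c * r ^ 3 + 2 / r\<^sup>2 * b" using r c ab by (subst (asm) ennreal_le_iff) auto
    then have "a \<le> a / 2 + 2 / r\<^sup>2 * b" using c by (simp add: r(2))
    then have "a * r\<^sup>2 \<le> 4 * b" using r(1) by (simp add: field_simps)
    moreover have "a * r\<^sup>2 = a powr (5/3) / (2 * c) powr (2/3)"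
      using a powr_add[of a 1 "2/3"] by (simp add: r2)
    ultimately show ?thesis using c by (simp add: field_simps)
  qed (use ab c in simp)
  then show "ennreal (enn2real (\<rho> x) powr (5/3)) \<le> ennreal (4 * (2 * (q * unit_ball_vol 3 / (2 * pi) ^ 3)) powr (2/3)) * \<tau> x"
    unfolding c_def[symmetric] a_def[symmetric] using ab c by (simp add: ennreal_mult[symmetric] ennreal_leI)
qed

text \<open>Since \<open>norm (x - y) \<le> (1 + norm x) * (1 + norm y)\<close>, the Coulomb kernel
  dominates a product kernel, whose double integral is a square.\<close>

lemma density_weighted_le:
  "(\<integral>\<^sup>+ x. \<rho> x * ennreal (1 / (1 + norm x)) \<partial>lborel)\<^sup>2 \<le> 2 * repulsion_energy u"
proof -
  have "(\<integral>\<^sup>+ x. \<rho> x * ennreal (1 / (1 + norm x)) \<partial>lborel)\<^sup>2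
     = (\<integral>\<^sup>+ x. (\<integral>\<^sup>+ y. \<rho> x * ennreal (1 / (1 + norm x)) * (\<rho> y * ennreal (1 / (1 + norm y))) \<partial>lborel) \<partial>lborel)"
    by (simp add: nn_integral_cmult nn_integral_multc power2_eq_square)
  also have "\<dots> \<le> (\<integral>\<^sup>+ x. (\<integral>\<^sup>+ y. \<rho> x * \<rho> y * ennreal (1 / norm (x - y)) \<partial>lborel) \<partial>lborel)"
  proof (rule nn_integral_mono, rule nn_integral_mono_AE)
    fix x :: v3
    have "\<rho> x * ennreal (1 / (1 + norm x)) * (\<rho> y * ennreal (1 / (1 + norm y)))
        \<le> \<rho> x * \<rho> y * ennreal (1 / norm (x - y))" if "y \<noteq> x" for y
    proof -
      have "norm (x - y) \<le> norm x + norm y" by (rule norm_triangle_ineq4)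
      also have "\<dots> \<le> (1 + norm x) * (1 + norm y)" by (simp add: algebra_simps)
      finally have "1 / ((1 + norm x) * (1 + norm y)) \<le> 1 / norm (x - y)"
        using that by (intro divide_left_mono mult_pos_pos) (auto simp: add_pos_nonneg)
      then have "ennreal (1 / (1 + norm x)) * ennreal (1 / (1 + norm y)) \<le> ennreal (1 / norm (x - y))"
        by (simp add: ennreal_mult[symmetric] ennreal_leI)
      from mult_left_mono[OF this, of "\<rho> x * \<rho> y"] show ?thesis by (simp add: mult_ac)
    qed
    then show "AE y in lborel. \<rho> x * ennreal (1 / (1 + norm x)) * (\<rho> y * ennreal (1 / (1 + norm y)))
        \<le> \<rho> x * \<rho> y * ennreal (1 / norm (x - y))"
      using AE_lborel_singleton[of x] by (auto elim: eventually_mono)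
  qed
  also have "\<dots> = 2 * repulsion_energy u"
    unfolding repulsion_energy_eq mult.assoc[symmetric]
    by (simp add: ennreal_times_divide)
  finally show ?thesis .
qed

text \<open>Near the nucleus the slow particles are limited by the Pauli principle and the fast ones
  are paid for by half of the kinetic energy. Outside the unit ball \<open>1 / norm x\<close> is at
  most twice the weight that the repulsion controls.\<close>

lemma attraction_energy_le:
  assumes "Z > 0"
  shows "attraction_energy Z u \<le> ennreal (Z * (q * unit_ball_vol 3 / (2 * pi) ^ 3) * (4 * Z) powr (3/2)) * (integral\<^sup>N lborel ball_kernel)
    + 1/2 * kinetic_energy u + ennreal (2 * Z) * (\<integral>\<^sup>+ x. \<rho> x * ennreal (1 / (1 + norm x)) \<partial>lborel)"
proof -
  define c where "c = q * unit_ball_vol 3 / (2 * pi) ^ 3"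
  have c: "c > 0" using q_pos by (simp add: c_def)
  have "attraction_energy Z u \<le> (\<integral>\<^sup>+ x. ennreal (Z * c * (4 * Z) powr (3/2)) * ball_kernel x
    + ennreal (1/2) * \<tau> x + ennreal (2 * Z) * (\<rho> x * ennreal (1 / (1 + norm x))) \<partial>lborel)"
    unfolding attraction_energy_eq
  proof (intro nn_integral_mono_AE eventually_mono[OF AE_lborel_singleton[of 0]])
    fix x :: v3
    assume "x \<noteq> 0"
    show "ennreal (Z / norm x) * \<rho> x \<le> ennreal (Z * c * (4 * Z) powr (3/2)) * ball_kernel x
      + ennreal (1/2) * \<tau> x + ennreal (2 * Z) * (\<rho> x * ennreal (1 / (1 + norm x)))"
    proof (cases "norm x < 1")
      case True
      define n where "n = norm x"
      have n: "n > 0" using \<open>x \<noteq> 0\<close> by (simp add: n_def)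
      \<comment> \<open>Makes the coefficient of the kinetic density
        \<open>Z / n * (2 / r^2) = 1/2\<close>, small enough to be absorbed later.\<close>
      define r where "r = (4 * Z / n) powr (1/2)"
      have r: "r > 0" "r\<^sup>2 = 4 * Z / n" using n assms by (simp_all add: r_def powr_power)
      have "r ^ 3 = (4 * Z / n) powr (3/2)" using n assms by (simp add: r_def powr_power)
      also have "\<dots> = (4 * Z) powr (3/2) * n powr (-3/2)"
        using n assms by (simp add: powr_divide powr_minus_divide)
      finally have r3: "r ^ 3 = (4 * Z) powr (3/2) * n powr (-3/2)" .
      have "Z / n * (c * r ^ 3) = Z * c * (4 * Z) powr (3/2) * n powr (-5/2)"
        using n powr_add[of n "-3/2" "-1"] by (simp add: r3 powr_minus_divide mult_ac)
      moreover have "Z / n * (2 / r\<^sup>2) = 1/2" using n assms by (simp add: r)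
      moreover have "ennreal (Z / n) * \<rho> x \<le> ennreal (Z / n) * (ennreal (c * r ^ 3) + ennreal (2 / r\<^sup>2) * \<tau> x)"
        using density_le[OF r(1), folded c_def] by (intro mult_left_mono) auto
      ultimately have "ennreal (Z / n) * \<rho> x \<le> ennreal (Z * c * (4 * Z) powr (3/2) * n powr (-5/2)) + ennreal (1/2) * \<tau> x"
        using n assms c r(1) by (simp add: distrib_left mult.assoc[symmetric] ennreal_mult[symmetric])
      also have "ennreal (Z * c * (4 * Z) powr (3/2) * n powr (-5/2)) = ennreal (Z * c * (4 * Z) powr (3/2)) * ball_kernel x"
        using True assms c by (simp add: ball_kernel_def n_def ennreal_mult)
      finally show ?thesis by (simp add: n_def add_increasing2)
    next
      case False
      then have "Z / norm x \<le> 2 * Z * (1 / (1 + norm x))"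
        using assms \<open>x \<noteq> 0\<close> by (simp add: field_simps add_pos_nonneg)
      then have "ennreal (Z / norm x) \<le> ennreal (2 * Z) * ennreal (1 / (1 + norm x))"
        using assms by (simp add: ennreal_mult[symmetric] ennreal_leI)
      from mult_right_mono[OF this, of "\<rho> x"] show ?thesis by (simp add: mult_ac add_increasing)
    qed
  qed
  also have "\<dots> = ennreal (Z * c * (4 * Z) powr (3/2)) * (integral\<^sup>N lborel ball_kernel)
    + ennreal (1/2) * kinetic_energy u + ennreal (2 * Z) * (\<integral>\<^sup>+ x. \<rho> x * ennreal (1 / (1 + norm x)) \<partial>lborel)"
    by (simp add: nn_integral_add nn_integral_cmult kinetic_energy_eq)
  also have "ennreal (1/2) = 1/2" using divide_ennreal[of 1 2] by simp
  finally show ?thesis by (simp add: c_def)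
qed

end

text \<open>Attraction costs a constant, half of the kinetic energy and a multiple of the square
  root of the repulsion, which the other two parts absorb. \<open>C\<close> depends on
  \<open>E\<close>, \<open>Z\<close> and \<open>q\<close> alone, so conservation of energy makes the
  bounds uniform in time.\<close>

lemma (in phase_space_density) vlasov_energy_bounds:
  assumes "Z > 0" and energy: "vlasov_energy Z u = ereal E"
  defines "C \<equiv> 2 * (\<bar>E\<bar> + Z * (q * unit_ball_vol 3 / (2 * pi) ^ 3) * (4 * Z) powr (3/2)
      * enn2real (integral\<^sup>N lborel ball_kernel) + 4 * Z\<^sup>2) + \<bar>E\<bar>"
  shows "kinetic_energy u \<le> ennreal C" "attraction_energy Z u \<le> ennreal C" "repulsion_energy u \<le> ennreal C"
    "(\<integral>\<^sup>+ x. \<rho> x * ennreal (1 / (1 + norm x)) \<partial>lborel) \<le> ennreal (sqrt (2 * C))"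
proof -
  define k where "k = enn2real (kinetic_energy u)"
  define a where "a = enn2real (attraction_energy Z u)"
  define d where "d = enn2real (repulsion_energy u)"
  define A where "A = Z * (q * unit_ball_vol 3 / (2 * pi) ^ 3) * (4 * Z) powr (3/2)"
  define B where "B = enn2real (integral\<^sup>N lborel ball_kernel)"
  define J where "J = (\<integral>\<^sup>+ x. \<rho> x * ennreal (1 / (1 + norm x)) \<partial>lborel)"
  have A: "A \<ge> 0" and B: "B \<ge> 0" using assms(1) q_pos by (simp_all add: A_def B_def)
  \<comment> \<open>In \<open>ereal\<close> any infinite part would make the whole expression
    infinite.\<close>
  have fin: "kinetic_energy u \<noteq> \<infinity>" "attraction_energy Z u \<noteq> \<infinity>" "repulsion_energy u \<noteq> \<infinity>"
    using energy unfolding vlasov_energy_def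
    by (cases "kinetic_energy u"; cases "attraction_energy Z u"; cases "repulsion_energy u"; simp)+
  have kad: "kinetic_energy u = ennreal k" "attraction_energy Z u = ennreal a" "repulsion_energy u = ennreal d"
    "k \<ge> 0" "a \<ge> 0" "d \<ge> 0"
    using fin by (simp_all add: k_def a_def d_def less_top)
  have E: "k - a + d = E"
    using energy unfolding vlasov_energy_def kad by (simp add: kad)
  have B': "(integral\<^sup>N lborel ball_kernel) = ennreal B"
    using nn_integral_norm_powr_ball by (simp add: B_def ball_kernel_def[abs_def])
  have "J\<^sup>2 \<le> 2 * ennreal d" using density_weighted_le kad(3) by (simp add: J_def)
  also have "\<dots> = ennreal (2 * d)" using kad by (simp add: ennreal_mult)
  finally have J: "J \<le> ennreal (sqrt (2 * d))"
    using kad by (cases J) (auto simp: power2_eq_square ennreal_top_mult ennreal_mult[symmetric] top_unique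
        intro!: ennreal_leI real_le_rsqrt)
  have half: "1/2 * ennreal k = ennreal (k / 2)"
    using divide_ennreal[of k 2] kad by (simp add: divide_ennreal_def mult.commute)
  have "ennreal a \<le> ennreal A * ennreal B + 1/2 * ennreal k + ennreal (2 * Z) * J"
    using attraction_energy_le[OF assms(1), folded A_def J_def] by (simp add: kad B')
  also have "\<dots> \<le> ennreal A * ennreal B + ennreal (k / 2) + ennreal (2 * Z) * ennreal (sqrt (2 * d))"
    unfolding half using J by (intro add_mono mult_left_mono) auto
  also have "\<dots> = ennreal (A * B + 1/2 * k + 2 * Z * sqrt (2 * d))"
    using A B kad assms(1) by (simp add: ennreal_mult[symmetric] ennreal_plus[symmetric] del: ennreal_plus)
  finally have "a \<le> A * B + 1/2 * k + 2 * Z * sqrt (2 * d)"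
    using A B kad assms(1) by (subst (asm) ennreal_le_iff) auto
  \<comment> \<open>Completing the square with this weight spends half of the repulsion; the other
    half stays on the left, next to half of the kinetic energy.\<close>
  moreover have "2 * Z * sqrt (2 * d) \<le> d / 2 + 4 * Z\<^sup>2"
    using zero_le_power2[of "sqrt (2 * d) / 2 - 2 * Z"] kad
    by (simp add: power2_diff power_divide power_mult_distrib mult_ac)
  ultimately have "a \<le> A * B + 1/2 * k + (d / 2 + 4 * Z\<^sup>2)"
    by (rule order_trans[OF _ add_left_mono])
  then have le: "k + d \<le> 2 * (\<bar>E\<bar> + A * B + 4 * Z\<^sup>2)" using E abs_ge_self[of E] by argo
  have C: "C = 2 * (\<bar>E\<bar> + A * B + 4 * Z\<^sup>2) + \<bar>E\<bar>" by (simp add: C_def A_def B_def)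
  have *: "k \<le> C" "a \<le> C" "d \<le> C" using E le kad unfolding C by linarith+
  then show "kinetic_energy u \<le> ennreal C" "attraction_energy Z u \<le> ennreal C" "repulsion_energy u \<le> ennreal C"
    unfolding kad by (auto intro: ennreal_leI)
  have "J \<le> ennreal (sqrt (2 * C))"
    using J * by (meson ennreal_leI mult_left_mono order_trans real_sqrt_le_mono zero_le_numeral)
  then show "(\<integral>\<^sup>+ x. \<rho> x * ennreal (1 / (1 + norm x)) \<partial>lborel) \<le> ennreal (sqrt (2 * C))"
    by (simp add: J_def)
qed

text \<open>
  A form of Young's inequality for exponents \<open>5/3\<close>, \<open>5/3\<close> and \<open>5/4\<close>: it is applied with
  \<open>a ^ 3 = \<rho> x\<close>, \<open>b ^ 3 = \<rho> y\<close> and \<open>k ^ 4 = 1 / (norm (x - y))\<^sup>2\<close>.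
\<close>

lemma power_product_le:
  fixes a b k :: real
  assumes "a \<ge> 0" "b \<ge> 0" "k \<ge> 0"
  shows "a ^ 3 * b ^ 3 * k ^ 4 \<le> a ^ 5 * b ^ 5 + a ^ 5 * k ^ 5 + b ^ 5 * k ^ 5"
proof -
  define m where "m = max (a * b) (max (a * k) (b * k))"
  have m: "a * b \<le> m" "a * k \<le> m" "b * k \<le> m" by (auto simp: m_def)
  \<comment> \<open>Degree ten splits into five pair products, each at most \<open>m\<close>, and
    \<open>m ^ 5\<close> is one of the three terms on the right.\<close>
  have "a ^ 3 * b ^ 3 * k ^ 4 = (a * b) * ((a * k)\<^sup>2 * (b * k)\<^sup>2)" by algebra
  also have "\<dots> \<le> m * (m\<^sup>2 * m\<^sup>2)"
    using m assms order_trans[OF mult_nonneg_nonneg[OF assms(1,2)] m(1)] by (intro mult_mono power_mono) auto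
  also have "\<dots> = m ^ 5" by algebra
  also have "\<dots> \<le> (a * b) ^ 5 + (a * k) ^ 5 + (b * k) ^ 5"
    using assms by (auto simp: m_def max_def)
  finally show ?thesis by (simp add: power_mult_distrib)
qed

context phase_space_density
begin

definition "r x = enn2real (\<rho> x)"

lemma r_measurable [measurable]: "r \<in> borel_measurable borel"
  unfolding r_def[abs_def] by measurable

lemma r_nonneg: "r x \<ge> 0" by (simp add: r_def)

lemma density_eq_r:
  assumes "kinetic_energy u < \<infinity>"
  shows "AE x in lborel. \<rho> x = ennreal (r x)"
proof -
  have "AE x in lborel. \<tau> x \<noteq> \<infinity>"
    using assms unfolding kinetic_energy_eq by (intro nn_integral_noteq_infinite) auto
  then show ?thesis by eventually_elim (use density_powr_le(1) in \<open>simp add: r_def less_top\<close>)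
qed

text \<open>This controls the total size of the forces between pairs. Pairs at distance at least 1
  are dominated by the repulsion energy. For close pairs the preceding inequality separates the
  densities, in the power 5/3, from the kernel, in the power 5/4, which is integrable over the unit
  ball.\<close>

lemma coulomb_square_le:
  assumes "kinetic_energy u < \<infinity>"
  defines "A \<equiv> ennreal (4 * (2 * (q * unit_ball_vol 3 / (2 * pi) ^ 3)) powr (2/3))"
  shows "(\<integral>\<^sup>+ x. \<integral>\<^sup>+ y. ennreal (r x * r y / (norm (x - y))\<^sup>2) \<partial>lborel \<partial>lborel)
    \<le> 2 * repulsion_energy u + (A * kinetic_energy u)\<^sup>2
      + 2 * (A * kinetic_energy u * (integral\<^sup>N lborel ball_kernel))"
proof -
  define R where "R x = ennreal (r x powr (5/3))" for x
  have [measurable]: "R \<in> borel_measurable borel" unfolding R_def[abs_def] by measurable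
  have "(\<integral>\<^sup>+ x. R x \<partial>lborel) \<le> (\<integral>\<^sup>+ x. A * \<tau> x \<partial>lborel)"
  proof (rule nn_integral_mono_AE)
    have "AE x in lborel. \<tau> x \<noteq> \<infinity>"
      using assms unfolding kinetic_energy_eq by (intro nn_integral_noteq_infinite) auto
    then show "AE x in lborel. R x \<le> A * \<tau> x"
      by eventually_elim (use density_powr_le(2) in \<open>simp add: R_def r_def A_def less_top\<close>)
  qed
  also have "\<dots> = A * kinetic_energy u" by (simp add: nn_integral_cmult kinetic_energy_eq)
  finally have R: "(\<integral>\<^sup>+ x. R x \<partial>lborel) \<le> A * kinetic_energy u" .
  have pw: "ennreal (r x * r y / (norm (x - y))\<^sup>2) \<le> \<rho> x * \<rho> y * ennreal (1 / norm (x - y))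
    + R x * R y + (R x * ball_kernel (x - y) + R y * ball_kernel (x - y))"
    if ae: "\<rho> x = ennreal (r x)" "\<rho> y = ennreal (r y)" for x y
  proof (cases "norm (x - y) < 1")
    case True
    define n where "n = norm (x - y)"
    have "n \<ge> 0" by (simp add: n_def)
    have "r x * r y / n\<^sup>2 \<le> r x powr (5/3) * r y powr (5/3) + (r x powr (5/3) * n powr (-5/2) + r y powr (5/3) * n powr (-5/2))"
    proof (cases "n = 0")
      case False
      then have n: "n > 0" using \<open>n \<ge> 0\<close> by simp
      have "r x * r y / n\<^sup>2 = (r x powr (1/3)) ^ 3 * (r y powr (1/3)) ^ 3 * (n powr (-1/2)) ^ 4"
      proof -
        have "(r z powr (1/3)) ^ 3 = r z" for z
          using r_nonneg[of z] powr_power[of "r z" "1/3" 3] by (cases "r z = 0") auto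
        moreover have "(n powr (-1/2)) ^ 4 = n powr (- 2)" using n by (simp add: powr_power)
        moreover have "\<dots> = 1 / n\<^sup>2" using n by (simp add: powr_minus_divide)
        ultimately show ?thesis by simp
      qed
      moreover have "\<dots> \<le> (r x powr (1/3)) ^ 5 * (r y powr (1/3)) ^ 5 + (r x powr (1/3)) ^ 5 * (n powr (-1/2)) ^ 5
         + (r y powr (1/3)) ^ 5 * (n powr (-1/2)) ^ 5"
        by (rule power_product_le) auto
      moreover have "(r z powr (1/3)) ^ 5 = r z powr (5/3)" for z
        using r_nonneg[of z] powr_power[of "r z" "1/3" 5] by (cases "r z = 0") auto
      ultimately show ?thesis using n by (simp add: powr_power add.assoc)
    qed simp
    moreover have "ball_kernel (x - y) = ennreal (n powr (-5/2))"
      using True by (simp add: ball_kernel_def n_def)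
    ultimately have "ennreal (r x * r y / n\<^sup>2) \<le> R x * R y + (R x * ball_kernel (x - y) + R y * ball_kernel (x - y))"
      by (simp add: R_def ennreal_mult[symmetric] ennreal_plus[symmetric] ennreal_leI del: ennreal_plus)
    then show ?thesis by (simp add: n_def add_increasing add.assoc)
  next
    case False
    define n where "n = norm (x - y)"
    have n: "n \<ge> 1" using False by (simp add: n_def)
    then have "1 / n\<^sup>2 \<le> 1 / n" by (simp add: power2_eq_square field_simps)
    from mult_left_mono[OF this, of "r x * r y"] r_nonneg
    have "r x * r y / n\<^sup>2 \<le> r x * r y * (1 / n)" by simp
    then have "ennreal (r x * r y / n\<^sup>2) \<le> \<rho> x * \<rho> y * ennreal (1 / n)"
      using r_nonneg n by (simp add: ae ennreal_mult[symmetric] ennreal_leI)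
    then show ?thesis by (simp add: n_def add_increasing2 add.assoc)
  qed
  note ae = density_eq_r[OF assms(1)]
  have "(\<integral>\<^sup>+ x. \<integral>\<^sup>+ y. ennreal (r x * r y / (norm (x - y))\<^sup>2) \<partial>lborel \<partial>lborel)
    \<le> (\<integral>\<^sup>+ x. \<integral>\<^sup>+ y. \<rho> x * \<rho> y * ennreal (1 / norm (x - y))
    + R x * R y + (R x * ball_kernel (x - y) + R y * ball_kernel (x - y)) \<partial>lborel \<partial>lborel)"
    using ae
  proof (intro nn_integral_mono_AE, eventually_elim)
    case (elim x)
    show ?case using ae by (intro nn_integral_mono_AE, eventually_elim) (rule pw[OF elim(2)])
  qed
  also have "\<dots> = (\<integral>\<^sup>+ x. \<integral>\<^sup>+ y. \<rho> x * \<rho> y * ennreal (1 / norm (x - y)) \<partial>lborel \<partial>lborel)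
    + (\<integral>\<^sup>+ x. \<integral>\<^sup>+ y. R x * R y \<partial>lborel \<partial>lborel)
    + ((\<integral>\<^sup>+ x. \<integral>\<^sup>+ y. R x * ball_kernel (x - y) \<partial>lborel \<partial>lborel)
      + (\<integral>\<^sup>+ x. \<integral>\<^sup>+ y. R y * ball_kernel (x - y) \<partial>lborel \<partial>lborel))"
    by (simp add: nn_integral_add)
  also have "(\<integral>\<^sup>+ x. \<integral>\<^sup>+ y. R y * ball_kernel (x - y) \<partial>lborel \<partial>lborel)
      = (\<integral>\<^sup>+ y. \<integral>\<^sup>+ x. R y * ball_kernel (x - y) \<partial>lborel \<partial>lborel)"
    by (rule lborel_pair.Fubini') measurable
  also have "\<dots> = (\<integral>\<^sup>+ x. R x \<partial>lborel) * (integral\<^sup>N lborel ball_kernel)"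
    by (simp add: nn_integral_cmult nn_integral_multc nn_integral_ball_kernel_diff)
  also have "(\<integral>\<^sup>+ x. \<integral>\<^sup>+ y. R x * ball_kernel (x - y) \<partial>lborel \<partial>lborel)
      = (\<integral>\<^sup>+ x. R x \<partial>lborel) * (integral\<^sup>N lborel ball_kernel)"
    by (simp add: nn_integral_cmult nn_integral_multc nn_integral_ball_kernel_diff)
  also have "(\<integral>\<^sup>+ x. \<integral>\<^sup>+ y. R x * R y \<partial>lborel \<partial>lborel) = (\<integral>\<^sup>+ x. R x \<partial>lborel)\<^sup>2"
    by (simp add: nn_integral_cmult nn_integral_multc power2_eq_square)
  also have "(\<integral>\<^sup>+ x. \<integral>\<^sup>+ y. \<rho> x * \<rho> y * ennreal (1 / norm (x - y)) \<partial>lborel \<partial>lborel) = 2 * repulsion_energy u"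
    unfolding repulsion_energy_eq mult.assoc[symmetric] by (simp add: ennreal_times_divide)
  also have "2 * repulsion_energy u + (\<integral>\<^sup>+ x. R x \<partial>lborel)\<^sup>2 + ((\<integral>\<^sup>+ x. R x \<partial>lborel) * (integral\<^sup>N lborel ball_kernel)
      + (\<integral>\<^sup>+ x. R x \<partial>lborel) * (integral\<^sup>N lborel ball_kernel))
    \<le> 2 * repulsion_energy u + (A * kinetic_energy u)\<^sup>2 + (A * kinetic_energy u * (integral\<^sup>N lborel ball_kernel)
      + A * kinetic_energy u * (integral\<^sup>N lborel ball_kernel))"
    using R by (intro add_mono power_mono mult_right_mono) auto
  finally show ?thesis by (simp add: mult_2)
qed

end

text \<open>What the argument in position space retains of the energy. The total mass is not among
  these quantities, because it may be infinite.\<close>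

locale bounded_density =
  fixes C :: real and r :: "v3 \<Rightarrow> real"
  assumes C_nonneg: "C \<ge> 0"
    and r_borel [measurable]: "r \<in> borel_measurable borel"
    and r_ge_0: "\<And>x. r x \<ge> 0"
    and nn_attraction: "(\<integral>\<^sup>+ x. ennreal (r x / norm x) \<partial>lborel) \<le> ennreal C"
    and nn_weighted: "(\<integral>\<^sup>+ x. ennreal (r x / (1 + norm x)) \<partial>lborel) \<le> ennreal C"
    and nn_repulsion: "(\<integral>\<^sup>+ x. \<integral>\<^sup>+ y. ennreal (r x * r y / norm (x - y)) \<partial>lborel \<partial>lborel) \<le> ennreal C"
    and nn_repulsion2: "(\<integral>\<^sup>+ x. \<integral>\<^sup>+ y. ennreal (r x * r y / (norm (x - y))\<^sup>2) \<partial>lborel \<partial>lborel) \<le> ennreal C"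

text \<open>\<open>C\<close> is obtained before \<open>u\<close>, so a single constant serves all
  times of a flow of energy \<open>E\<close>.\<close>

lemma uniform_bounds:
  assumes "Z > 0" "q > 0"
  obtains C where "C \<ge> 0"
    "\<And>u. phase_space_density q u \<Longrightarrow> vlasov_energy Z u = ereal E \<Longrightarrow>
      kinetic_energy u \<le> ennreal C \<and> (AE x in lborel. spatial_density u x = ennreal (enn2real (spatial_density u x)))
      \<and> bounded_density C (\<lambda>x. enn2real (spatial_density u x))"
proof -
  define B where "B = enn2real (integral\<^sup>N lborel ball_kernel)"
  have B: "(integral\<^sup>N lborel ball_kernel) = ennreal B"
    using nn_integral_norm_powr_ball by (simp add: B_def ball_kernel_def[abs_def])
  define C where "C = 2 * (\<bar>E\<bar> + Z * (q * unit_ball_vol 3 / (2 * pi) ^ 3) * (4 * Z) powr (3/2) * B + 4 * Z\<^sup>2) + \<bar>E\<bar>"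
  have B0: "B \<ge> 0" by (simp add: B_def)
  then have C0: "C \<ge> 0" using assms by (simp add: C_def)
  define A where "A = 4 * (2 * (q * unit_ball_vol 3 / (2 * pi) ^ 3)) powr (2/3)"
  have A: "A \<ge> 0" by (simp add: A_def)
  \<comment> \<open>A sum of nonnegative terms, so that it dominates each of the separate
    bounds.\<close>
  define D where "D = C + C / Z + sqrt (2 * C) + 2 * C + (2 * C + (A * C)\<^sup>2 + 2 * (A * C * B))"
  have D: "C \<le> D" "C / Z \<le> D" "sqrt (2 * C) \<le> D" "2 * C \<le> D" "2 * C + (A * C)\<^sup>2 + 2 * (A * C * B) \<le> D"
    "D \<ge> 0"
    using C0 A B0 assms by (auto simp: D_def)
  show thesis
  proof
    show "D \<ge> 0" by fact
    fix u assume u: "phase_space_density q u" and E: "vlasov_energy Z u = ereal E"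
    interpret phase_space_density q u by fact
    note b = vlasov_energy_bounds[OF assms(1) E, folded B_def, folded C_def]
    have fin: "kinetic_energy u < \<infinity>" using b(1) by (auto intro: le_less_trans)
    note ae = density_eq_r[OF fin]
    have "bounded_density D r"
    proof
      show "D \<ge> 0" "r \<in> borel_measurable borel" "\<And>x. r x \<ge> 0" using D r_nonneg by auto
      have "ennreal Z * (\<integral>\<^sup>+ x. ennreal (r x / norm x) \<partial>lborel) = (\<integral>\<^sup>+ x. ennreal Z * ennreal (r x / norm x) \<partial>lborel)"
        by (simp add: nn_integral_cmult)
      also have "\<dots> = attraction_energy Z u"
        unfolding attraction_energy_eq using ae
        by (intro nn_integral_cong_AE) (auto elim!: eventually_mono simp: ennreal_mult[symmetric] r_nonneg assms less_imp_le)
      also have "\<dots> \<le> ennreal C" by (rule b)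
      finally have "ennreal (1/Z) * (ennreal Z * (\<integral>\<^sup>+ x. ennreal (r x / norm x) \<partial>lborel)) \<le> ennreal (1/Z) * ennreal C"
        by (rule mult_left_mono) simp
      then have "(\<integral>\<^sup>+ x. ennreal (r x / norm x) \<partial>lborel) \<le> ennreal (C / Z)"
        using assms C0 by (simp add: mult.assoc[symmetric] ennreal_mult[symmetric])
      then show "(\<integral>\<^sup>+ x. ennreal (r x / norm x) \<partial>lborel) \<le> ennreal D"
        using D by (meson ennreal_leI order_trans)
      have "(\<integral>\<^sup>+ x. ennreal (r x / (1 + norm x)) \<partial>lborel) = (\<integral>\<^sup>+ x. \<rho> x * ennreal (1 / (1 + norm x)) \<partial>lborel)"
        using ae by (intro nn_integral_cong_AE) (auto elim!: eventually_mono simp: ennreal_mult[symmetric] r_nonneg)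
      also have "\<dots> \<le> ennreal (sqrt (2 * C))" by (rule b)
      finally show "(\<integral>\<^sup>+ x. ennreal (r x / (1 + norm x)) \<partial>lborel) \<le> ennreal D"
        using D by (meson ennreal_leI order_trans)
      have "(\<integral>\<^sup>+ x. \<integral>\<^sup>+ y. ennreal (r x * r y / norm (x - y)) \<partial>lborel \<partial>lborel)
        = (\<integral>\<^sup>+ x. \<integral>\<^sup>+ y. \<rho> x * \<rho> y * ennreal (1 / norm (x - y)) \<partial>lborel \<partial>lborel)"
        using ae
      proof (intro nn_integral_cong_AE, eventually_elim)
        case (elim x)
        then show ?case
          using ae by (intro nn_integral_cong_AE) (auto elim!: eventually_mono simp: ennreal_mult[symmetric] r_nonneg)
      qed
      also have "\<dots> = 2 * repulsion_energy u"
        unfolding repulsion_energy_eq mult.assoc[symmetric] by (simp add: ennreal_times_divide)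
      also have "\<dots> \<le> 2 * ennreal C" by (intro mult_left_mono b) simp
      also have "\<dots> = ennreal (2 * C)" using C0 by (simp add: ennreal_mult)
      finally show "(\<integral>\<^sup>+ x. \<integral>\<^sup>+ y. ennreal (r x * r y / norm (x - y)) \<partial>lborel \<partial>lborel) \<le> ennreal D"
        using D by (meson ennreal_leI order_trans)
      have "(\<integral>\<^sup>+ x. \<integral>\<^sup>+ y. ennreal (r x * r y / (norm (x - y))\<^sup>2) \<partial>lborel \<partial>lborel)
        \<le> 2 * repulsion_energy u + (ennreal A * kinetic_energy u)\<^sup>2 + 2 * (ennreal A * kinetic_energy u * ennreal B)"
        using coulomb_square_le[OF fin] by (simp add: B A_def)
      also have "\<dots> \<le> 2 * ennreal C + (ennreal A * ennreal C)\<^sup>2 + 2 * (ennreal A * ennreal C * ennreal B)"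
        using b by (intro add_mono mult_left_mono mult_right_mono power_mono) auto
      also have "\<dots> = ennreal (2 * C + (A * C)\<^sup>2 + 2 * (A * C * B))"
        using A B0 C0 by (simp add: ennreal_mult ennreal_power[symmetric])
      finally show "(\<integral>\<^sup>+ x. \<integral>\<^sup>+ y. ennreal (r x * r y / (norm (x - y))\<^sup>2) \<partial>lborel \<partial>lborel) \<le> ennreal D"
        using D by (meson ennreal_leI order_trans)
    qed
    moreover have "kinetic_energy u \<le> ennreal D" using b(1) D by (meson ennreal_leI order_trans)
    ultimately show "kinetic_energy u \<le> ennreal D \<and> (AE x in lborel. \<rho> x = ennreal (enn2real (\<rho> x)))
      \<and> bounded_density D (\<lambda>x. enn2real (\<rho> x))"
      using ae by (simp add: r_def[abs_def])
  qed
qed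

section \<open>The virial inequality at a fixed time\<close>

definition coulomb_field :: "(v3 \<Rightarrow> real) \<Rightarrow> v3 \<Rightarrow> v3" where
  "coulomb_field r x = (LINT y|lborel. (r y / norm (x - y) ^ 3) *\<^sub>R (x - y))"

lemma force_eq:
  assumes [measurable]: "case_prod u \<in> borel_measurable (borel \<Otimes>\<^sub>M borel)"
  shows "force Z u x = - (Z / norm x ^ 3) *\<^sub>R x + coulomb_field (\<lambda>x. enn2real (spatial_density u x)) x"
  unfolding force_def coulomb_field_def by (subst integral_completion) simp_all

text \<open>The two-point inequality will be divided by \<open>norm (x - y) ^ 3\<close>, which has
  to be done off the diagonal.\<close>

lemma AE_lborel_pair_neq: "AE z in lborel \<Otimes>\<^sub>M lborel. fst z \<noteq> (snd z :: v3)"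
proof (rule lborel_pair.AE_pair_measure)
  show "{z \<in> space (lborel \<Otimes>\<^sub>M lborel). fst z \<noteq> (snd z :: v3)} \<in> sets (lborel \<Otimes>\<^sub>M lborel)" by measurable
  show "AE x in lborel. AE y in lborel. fst (x, y) \<noteq> (snd (x, y) :: v3)"
  proof (rule AE_I2)
    fix x :: v3
    show "AE y in lborel. fst (x, y) \<noteq> snd (x, y)"
      using AE_lborel_singleton[of x] by eventually_elim auto
  qed
qed

lemma norm_scaleR_div_cube: "norm ((a / norm z ^ 3) *\<^sub>R z) = \<bar>a\<bar> / (norm (z :: v3))\<^sup>2"
  by (cases "z = 0") (simp_all add: power3_eq_cube power2_eq_square)

context bounded_density
begin

lemma coulomb_field_measurable [measurable]: "coulomb_field r \<in> borel_measurable borel"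
  unfolding coulomb_field_def[abs_def] by measurable

text \<open>Where the Bochner integral does not exist, the field has the default value 0 and the
  bound is trivial.\<close>

lemma norm_coulomb_field_le:
  "ennreal (norm (coulomb_field r x)) \<le> (\<integral>\<^sup>+ y. ennreal (r y / (norm (x - y))\<^sup>2) \<partial>lborel)"
proof (cases "integrable lborel (\<lambda>y. (r y / norm (x - y) ^ 3) *\<^sub>R (x - y))")
  case True
  then show ?thesis
    using integral_norm_bound_ennreal[OF True] r_ge_0 unfolding coulomb_field_def norm_scaleR_div_cube by simp
qed (simp add: coulomb_field_def not_integrable_integral_eq)

lemma kernel_integrable:
  "integrable (lborel \<Otimes>\<^sub>M lborel) (\<lambda>(x, y). r x * r y / norm (x - y))"
  "integrable (lborel \<Otimes>\<^sub>M lborel) (\<lambda>(x, y). r x * r y / (norm (x - y))\<^sup>2)"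
proof -
  have "integrable (lborel \<Otimes>\<^sub>M lborel) (\<lambda>z. case z of (x, y) \<Rightarrow> r x * r y / norm (x - y) ^ k)"
    if "(\<integral>\<^sup>+ x. \<integral>\<^sup>+ y. ennreal (r x * r y / norm (x - y) ^ k) \<partial>lborel \<partial>lborel) \<le> ennreal C" for k
  proof (rule integrableI_bounded)
    have "(\<integral>\<^sup>+ z. ennreal (norm (case z of (x, y) \<Rightarrow> r x * r y / norm (x - y) ^ k)) \<partial>(lborel \<Otimes>\<^sub>M lborel))
      = (\<integral>\<^sup>+ x. \<integral>\<^sup>+ y. ennreal (r x * r y / norm (x - y) ^ k) \<partial>lborel \<partial>lborel)"
      using r_ge_0 by (subst lborel.nn_integral_fst[symmetric]) simp_all
    also have "\<dots> < \<infinity>" using that by (auto intro: le_less_trans)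
    finally show "(\<integral>\<^sup>+ z. ennreal (norm (case z of (x, y) \<Rightarrow> r x * r y / norm (x - y) ^ k)) \<partial>(lborel \<Otimes>\<^sub>M lborel)) < \<infinity>" .
  qed measurable
  from this[of 1] this[of 2] nn_repulsion nn_repulsion2
  show "integrable (lborel \<Otimes>\<^sub>M lborel) (\<lambda>(x, y). r x * r y / norm (x - y))"
    "integrable (lborel \<Otimes>\<^sub>M lborel) (\<lambda>(x, y). r x * r y / (norm (x - y))\<^sup>2)" by simp_all
qed

lemma repulsion_integral_le: "(LINT z|(lborel \<Otimes>\<^sub>M lborel). (case z of (x, y) \<Rightarrow> r x * r y / norm (x - y))) \<le> C"
proof -
  have "ennreal (LINT z|(lborel \<Otimes>\<^sub>M lborel). (case z of (x, y) \<Rightarrow> r x * r y / norm (x - y)))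
      = (\<integral>\<^sup>+ z. ennreal (case z of (x, y) \<Rightarrow> r x * r y / norm (x - y)) \<partial>(lborel \<Otimes>\<^sub>M lborel))"
    using kernel_integrable(1) r_ge_0 by (intro nn_integral_eq_integral[symmetric]) auto
  also have "\<dots> = (\<integral>\<^sup>+ x. \<integral>\<^sup>+ y. ennreal (r x * r y / norm (x - y)) \<partial>lborel \<partial>lborel)"
    by (subst lborel.nn_integral_fst[symmetric]) simp_all
  also have "\<dots> \<le> ennreal C" by (rule nn_repulsion)
  finally show ?thesis using C_nonneg by simp
qed

lemma attraction_integrable: "integrable lborel (\<lambda>x. r x / norm x)"
  and attraction_integral_le: "(LINT x|lborel. r x / norm x) \<le> C"
proof -
  show 1: "integrable lborel (\<lambda>x. r x / norm x)"
    using nn_attraction r_ge_0 by (intro integrableI_bounded) (auto intro: le_less_trans)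
  have "ennreal (LINT x|lborel. r x / norm x) \<le> ennreal C"
    using nn_attraction r_ge_0 by (subst nn_integral_eq_integral[symmetric, OF 1]) auto
  then show "(LINT x|lborel. r x / norm x) \<le> C" using C_nonneg by simp
qed

text \<open>Each bound on \<open>F\<close> tames one force: \<open>c * norm x\<close> reduces the
  nuclear singularity \<open>1 / |x|^2\<close> to that of the attraction energy, and boundedness
  handles the field of the other particles, through the kernel \<open>1 / |x - y|^2\<close>.\<close>

lemma force_moment_integrable:
  fixes F :: "v3 \<Rightarrow> v3"
  assumes "Z \<ge> 0" "c \<ge> 0" and F [measurable]: "F \<in> borel_measurable borel"
    and F_bounds: "\<And>x. norm (F x) \<le> c" "\<And>x. norm (F x) \<le> c * norm x"
  shows "(\<integral>\<^sup>+ x. ennreal (r x * (norm (F x) * norm (- (Z / norm x ^ 3) *\<^sub>R x + coulomb_field r x))) \<partial>lborel)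
    \<le> ennreal (c * (Z + 1) * C)"
proof -
  have "(\<integral>\<^sup>+ x. ennreal (r x * (norm (F x) * norm (- (Z / norm x ^ 3) *\<^sub>R x + coulomb_field r x))) \<partial>lborel)
    \<le> (\<integral>\<^sup>+ x. ennreal (c * Z) * ennreal (r x / norm x)
       + ennreal c * (\<integral>\<^sup>+ y. ennreal (r x * r y / (norm (x - y))\<^sup>2) \<partial>lborel) \<partial>lborel)"
  proof (rule nn_integral_mono)
    fix x :: v3
    let ?N = "norm (coulomb_field r x)"
    have 1: "norm (F x) * (Z / (norm x)\<^sup>2) \<le> c * Z / norm x"
    proof (cases "x = 0")
      case False
      have "norm (F x) * (Z / (norm x)\<^sup>2) \<le> c * norm x * (Z / (norm x)\<^sup>2)"
        using F_bounds(2) assms(1) by (intro mult_right_mono) auto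
      also have "\<dots> = c * Z / norm x" using False by (simp add: power2_eq_square)
      finally show ?thesis .
    qed simp
    have "norm (- (Z / norm x ^ 3) *\<^sub>R x + coulomb_field r x) \<le> Z / (norm x)\<^sup>2 + ?N"
      using norm_triangle_ineq[of "- (Z / norm x ^ 3) *\<^sub>R x" "coulomb_field r x"] norm_scaleR_div_cube[of Z x] assms(1)
      by simp
    then have "norm (F x) * norm (- (Z / norm x ^ 3) *\<^sub>R x + coulomb_field r x)
        \<le> norm (F x) * (Z / (norm x)\<^sup>2) + norm (F x) * ?N"
      by (metis distrib_left mult_left_mono norm_ge_zero)
    also have "\<dots> \<le> c * Z / norm x + c * ?N"
      using 1 F_bounds(1) by (intro add_mono mult_right_mono) auto
    finally have "r x * (norm (F x) * norm (- (Z / norm x ^ 3) *\<^sub>R x + coulomb_field r x))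
      \<le> r x * (c * Z / norm x + c * ?N)"
      by (rule mult_left_mono[OF _ r_ge_0])
    also have "\<dots> = c * Z * (r x / norm x) + c * (r x * ?N)" by (simp add: algebra_simps)
    finally have "ennreal (r x * (norm (F x) * norm (- (Z / norm x ^ 3) *\<^sub>R x + coulomb_field r x)))
      \<le> ennreal (c * Z) * ennreal (r x / norm x) + ennreal c * (ennreal (r x) * ennreal ?N)"
      using r_ge_0[of x] assms(1,2)
      by (simp add: ennreal_mult[symmetric] ennreal_plus[symmetric] ennreal_leI del: ennreal_plus)
    also have "ennreal (r x) * ennreal ?N \<le> ennreal (r x) * (\<integral>\<^sup>+ y. ennreal (r y / (norm (x - y))\<^sup>2) \<partial>lborel)"
      by (rule mult_left_mono[OF norm_coulomb_field_le]) simp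
    also have "\<dots> = (\<integral>\<^sup>+ y. ennreal (r x * r y / (norm (x - y))\<^sup>2) \<partial>lborel)"
      using r_ge_0 by (subst nn_integral_cmult[symmetric]) (simp_all add: ennreal_mult[symmetric])
    finally show "ennreal (r x * (norm (F x) * norm (- (Z / norm x ^ 3) *\<^sub>R x + coulomb_field r x)))
      \<le> ennreal (c * Z) * ennreal (r x / norm x)
       + ennreal c * (\<integral>\<^sup>+ y. ennreal (r x * r y / (norm (x - y))\<^sup>2) \<partial>lborel)"
      by (simp add: add_left_mono mult_left_mono)
  qed
  also have "\<dots> = ennreal (c * Z) * (\<integral>\<^sup>+ x. ennreal (r x / norm x) \<partial>lborel)
      + ennreal c * (\<integral>\<^sup>+ x. \<integral>\<^sup>+ y. ennreal (r x * r y / (norm (x - y))\<^sup>2) \<partial>lborel \<partial>lborel)"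
    by (simp add: nn_integral_add nn_integral_cmult)
  also have "\<dots> \<le> ennreal (c * Z) * ennreal C + ennreal c * ennreal C"
    by (intro add_mono mult_left_mono nn_attraction nn_repulsion2) auto
  also have "\<dots> = ennreal (c * (Z + 1) * C)"
    using assms C_nonneg by (simp add: ennreal_mult[symmetric] ennreal_plus[symmetric] algebra_simps del: ennreal_plus)
  finally show ?thesis .
qed

lemma weighted_integral_le:
  assumes [measurable]: "w \<in> borel_measurable borel"
    and w: "\<And>x. 0 \<le> w x" "\<And>x. w x \<le> c / (1 + norm x)" and "c \<ge> 0"
  shows "integrable lborel (\<lambda>x. r x * w x)" "(LINT x|lborel. r x * w x) \<le> c * C"
proof -
  have "(\<integral>\<^sup>+ x. ennreal (r x * w x) \<partial>lborel) \<le> (\<integral>\<^sup>+ x. ennreal c * ennreal (r x / (1 + norm x)) \<partial>lborel)"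
  proof (rule nn_integral_mono)
    fix x
    show "ennreal (r x * w x) \<le> ennreal c * ennreal (r x / (1 + norm x))"
      using mult_left_mono[OF w(2)[of x] r_ge_0[of x]] r_ge_0[of x] assms(4)
      by (simp add: ennreal_mult[symmetric] ennreal_leI mult.commute)
  qed
  also have "\<dots> \<le> ennreal c * ennreal C" by (simp add: nn_integral_cmult nn_weighted mult_left_mono)
  also have "\<dots> = ennreal (c * C)" using assms(4) C_nonneg by (simp add: ennreal_mult)
  finally have le: "(\<integral>\<^sup>+ x. ennreal (r x * w x) \<partial>lborel) \<le> ennreal (c * C)" .
  show i: "integrable lborel (\<lambda>x. r x * w x)"
    using le r_ge_0 w(1) by (intro integrableI_nonneg) (auto intro: le_less_trans)
  have "ennreal (LINT x|lborel. r x * w x) \<le> ennreal (c * C)"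
    using le r_ge_0 w(1) by (subst nn_integral_eq_integral[symmetric, OF i]) auto
  then show "(LINT x|lborel. r x * w x) \<le> c * C"
    using assms(4) C_nonneg by (subst (asm) ennreal_le_iff) auto
qed

text \<open>The defect \<open>\<kappa>\<close> enters twice: through the nucleus, where it costs
  \<open>Z * \<kappa>\<close> times the attraction integral, and through the pairs, where it costs
  half of \<open>\<kappa>\<close> times the Coulomb integral, rounded up to
  \<open>\<kappa> * C\<close>.\<close>

lemma virial_lower_bound:
  fixes F :: "v3 \<Rightarrow> v3" and w :: "v3 \<Rightarrow> real"
  assumes "Z > 0" "c \<ge> 0" "\<kappa> \<ge> 0" and F [measurable]: "F \<in> borel_measurable borel"
    and F_bounds: "\<And>x. norm (F x) \<le> c" "\<And>x. norm (F x) \<le> c * norm x"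
    and w [measurable]: "w \<in> borel_measurable borel"
    and w_bounds: "\<And>x. 0 \<le> w x" "\<And>x. w x \<le> c / (1 + norm x)"
    and two_point: "\<And>x y. 1/2 * (w x * w y * norm (x - y) ^ 3) - \<kappa> * (norm (x - y))\<^sup>2
      \<le> (F x - F y) \<bullet> (x - y)"
    and radial: "\<And>x. F x \<bullet> x \<le> w x * (norm x + \<kappa>) * (norm x)\<^sup>2"
    and w_le: "\<And>x. w x \<le> 1"
  shows "Z * (LINT x|lborel. r x * w x) - 4 * Z\<^sup>2 - \<kappa> * (Z + 1) * C
      \<le> (LINT x|lborel. r x * (F x \<bullet> (- (Z / norm x ^ 3) *\<^sub>R x + coulomb_field r x)))"
proof -
  let ?K = "\<lambda>x. - (Z / norm x ^ 3) *\<^sub>R x + coulomb_field r x"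
  have wi: "integrable lborel (\<lambda>x. r x * w x)" by (rule weighted_integral_le[OF w w_bounds assms(2)])
  define M where "M = (LINT x|lborel. r x * w x)"
  define I1 where "I1 = (LINT x|lborel. r x * (F x \<bullet> x) / norm x ^ 3)"
  have "integrable lborel (\<lambda>x. c * (r x / norm x))"
    by (intro integrable_mult_right attraction_integrable)
  then have i1: "integrable lborel (\<lambda>x. r x * (F x \<bullet> x) / norm x ^ 3)"
  proof (rule Bochner_Integration.integrable_bound, goal_cases)
    case 2
    show ?case
    proof (intro AE_I2)
      fix x :: v3
      have "\<bar>F x \<bullet> x\<bar> \<le> norm (F x) * norm x" by (rule Cauchy_Schwarz_ineq2)
      also have "\<dots> \<le> c * norm x * norm x" using F_bounds(2) by (intro mult_right_mono) auto
      finally have "r x * \<bar>F x \<bullet> x\<bar> / norm x ^ 3 \<le> r x * (c * norm x * norm x) / norm x ^ 3"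
        using r_ge_0 by (intro divide_right_mono mult_left_mono) auto
      then show "norm (r x * (F x \<bullet> x) / norm x ^ 3) \<le> norm (c * (r x / norm x))"
        using r_ge_0[of x] assms(2) by (cases "x = 0") (auto simp: abs_mult power3_eq_cube mult_ac)
    qed
  qed measurable
  \<comment> \<open>The term \<open>\<bar>x\<bar> x\<close> of the field pays off here: after
    division by \<open>norm x ^ 3\<close> the nuclear term is \<open>w x\<close>, up to an excess
    \<open>\<kappa> / norm x\<close> that is charged to the attraction.\<close>
  have "I1 \<le> (LINT x|lborel. r x * w x + \<kappa> * (r x / norm x))"
    unfolding I1_def
  proof (rule integral_mono[OF i1])
    show "integrable lborel (\<lambda>x. r x * w x + \<kappa> * (r x / norm x))"
      by (intro Bochner_Integration.integrable_add integrable_mult_right wi attraction_integrable)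
    fix x :: v3
    show "r x * (F x \<bullet> x) / norm x ^ 3 \<le> r x * w x + \<kappa> * (r x / norm x)"
    proof (cases "x = 0")
      case False
      have "r x * (F x \<bullet> x) / norm x ^ 3 \<le> r x * (w x * (norm x + \<kappa>) * (norm x)\<^sup>2) / norm x ^ 3"
        using r_ge_0 radial by (intro divide_right_mono mult_left_mono) auto
      also have "\<dots> = r x * w x + \<kappa> * (r x / norm x) * w x"
        using False by (simp add: field_simps power3_eq_cube power2_eq_square)
      also have "\<dots> \<le> r x * w x + \<kappa> * (r x / norm x) * 1"
        using r_ge_0 assms w_le by (intro add_left_mono mult_left_mono) auto
      finally show ?thesis by simp
    qed (use r_ge_0 w_bounds in simp)
  qed
  also have "\<dots> = M + \<kappa> * (LINT x|lborel. r x / norm x)"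
    unfolding M_def using wi attraction_integrable
    by (subst Bochner_Integration.integral_add) (auto simp del: times_divide_eq_right)
  also have "\<dots> \<le> M + \<kappa> * C"
    using attraction_integral_le assms by (intro add_left_mono mult_left_mono) auto
  finally have I1: "I1 \<le> M + \<kappa> * C" .
  define H where "H z = (case z of (x, y) \<Rightarrow> r x * r y * (F x \<bullet> (x - y)) / norm (x - y) ^ 3)" for z
  have H_le: "norm (H (x, y)) \<le> norm (c * (r x * r y / (norm (x - y))\<^sup>2))" for x y
  proof -
    have "\<bar>F x \<bullet> (x - y)\<bar> \<le> norm (F x) * norm (x - y)" by (rule Cauchy_Schwarz_ineq2)
    also have "\<dots> \<le> c * norm (x - y)" using F_bounds(1) by (intro mult_right_mono) auto
    finally have "r x * r y * \<bar>F x \<bullet> (x - y)\<bar> / norm (x - y) ^ 3 \<le> r x * r y * (c * norm (x - y)) / norm (x - y) ^ 3"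
      using r_ge_0 by (intro divide_right_mono mult_left_mono) auto
    then show ?thesis
      using r_ge_0[of x] r_ge_0[of y] assms(2)
      by (cases "x = y") (auto simp: H_def abs_mult power3_eq_cube power2_eq_square mult_ac)
  qed
  have Hm [measurable]: "H \<in> borel_measurable (lborel \<Otimes>\<^sub>M lborel)"
    unfolding H_def[abs_def] by measurable
  have iH: "integrable (lborel \<Otimes>\<^sub>M lborel) H"
    by (rule Bochner_Integration.integrable_bound[OF integrable_mult_right[OF kernel_integrable(2), of c] Hm])
      (use H_le in \<open>auto split: prod.splits\<close>)
  have iH': "integrable (lborel \<Otimes>\<^sub>M lborel) (\<lambda>(x, y). H (y, x))"
    by (rule lborel_pair.integrable_product_swap[OF iH])
  \<comment> \<open>Finiteness is known for \<open>r x\<close> times the kernel, at almost every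
    \<open>x\<close>. Where \<open>r x > 0\<close> it makes the field a genuine integral, so that
    \<open>F x\<close> may be moved inside; where \<open>r x = 0\<close> both sides vanish.\<close>
  have field: "AE x in lborel. r x * (F x \<bullet> coulomb_field r x) = (LINT y|lborel. H (x, y))"
  proof -
    have "AE x in lborel. (\<integral>\<^sup>+ y. ennreal (r x * r y / (norm (x - y))\<^sup>2) \<partial>lborel) \<noteq> \<infinity>"
      using nn_repulsion2 by (intro nn_integral_noteq_infinite) (auto simp: top_unique)
    then show ?thesis
    proof eventually_elim
      case (elim x)
      show ?case
      proof (cases "r x = 0")
        case False
        then have rx: "r x > 0" using r_ge_0[of x] by simp
        have nm: "norm (r x *\<^sub>R ((r y / norm (x - y) ^ 3) *\<^sub>R (x - y))) = r x * r y / (norm (x - y))\<^sup>2" for y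
          unfolding norm_scaleR[of "r x"] norm_scaleR_div_cube using r_ge_0 by simp
        have *: "integrable lborel (\<lambda>y. r x *\<^sub>R ((r y / norm (x - y) ^ 3) *\<^sub>R (x - y)))"
        proof (rule integrableI_bounded)
          show "(\<integral>\<^sup>+ y. ennreal (norm (r x *\<^sub>R ((r y / norm (x - y) ^ 3) *\<^sub>R (x - y)))) \<partial>lborel) < \<infinity>"
            unfolding nm using elim by (simp add: less_top)
        qed measurable
        have i: "integrable lborel (\<lambda>y. (r y / norm (x - y) ^ 3) *\<^sub>R (x - y))"
          using integrable_scaleR_right[of "1 / r x", OF *] rx by simp
        have "r x * (F x \<bullet> coulomb_field r x) = r x * (LINT y|lborel. F x \<bullet> ((r y / norm (x - y) ^ 3) *\<^sub>R (x - y)))"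
          unfolding coulomb_field_def by (subst integral_inner_right) (use i in auto)
        also have "\<dots> = (LINT y|lborel. H (x, y))"
          by (subst integral_mult_right_zero[symmetric]) (simp add: H_def mult_ac)
        finally show ?thesis .
      qed (simp add: H_def)
    qed
  qed
  have i2: "integrable lborel (\<lambda>x. r x * (F x \<bullet> coulomb_field r x))"
    using lborel_pair.integrable_fst'[OF iH] field
    by (subst integrable_cong_AE[OF _ _ field]) auto
  have I2: "(LINT x|lborel. r x * (F x \<bullet> coulomb_field r x)) = (LINT z|(lborel \<Otimes>\<^sub>M lborel). H z)"
    by (subst integral_cong_AE[OF _ _ field]) (auto simp: lborel_pair.integral_fst'[OF iH])
  have eq: "r x * (F x \<bullet> ?K x) = - Z * (r x * (F x \<bullet> x) / norm x ^ 3) + r x * (F x \<bullet> coulomb_field r x)" for x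
    by (simp add: inner_diff_right right_diff_distrib mult_ac)
  have tot: "(LINT x|lborel. r x * (F x \<bullet> ?K x)) = - Z * I1 + (LINT z|(lborel \<Otimes>\<^sub>M lborel). H z)"
    unfolding eq I1_def I2[symmetric] using i1 i2
    by (subst Bochner_Integration.integral_add) (auto simp del: times_divide_eq_right)
  define W where "W z = (case z of (x, y) \<Rightarrow> r x * w x * (r y * w y))" for z
  have iW: "integrable (lborel \<Otimes>\<^sub>M lborel) W" and W: "(LINT z|(lborel \<Otimes>\<^sub>M lborel). W z) = M\<^sup>2"
  proof -
    have [measurable]: "W \<in> borel_measurable (lborel \<Otimes>\<^sub>M lborel)" unfolding W_def[abs_def] by measurable
    show *: "integrable (lborel \<Otimes>\<^sub>M lborel) W"
    proof (rule lborel_pair.Fubini_integrable)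
      show "integrable lborel (\<lambda>x. LINT y|lborel. norm (W (x, y)))"
        using r_ge_0 w_bounds wi by (simp add: W_def abs_mult)
      show "AE x in lborel. integrable lborel (\<lambda>y. W (x, y))"
        using wi by (simp add: W_def)
    qed measurable
    show "(LINT z|(lborel \<Otimes>\<^sub>M lborel). W z) = M\<^sup>2"
      by (simp add: lborel_pair.integral_fst'[OF *, symmetric]) (simp add: W_def M_def power2_eq_square)
  qed
  have "2 * (LINT z|(lborel \<Otimes>\<^sub>M lborel). H z) = (LINT z|(lborel \<Otimes>\<^sub>M lborel). H z) + (LINT z|(lborel \<Otimes>\<^sub>M lborel). (case z of (x, y) \<Rightarrow> H (y, x)))"
    by (simp add: lborel_pair.integral_product_swap)
  also have "\<dots> = (LINT z|(lborel \<Otimes>\<^sub>M lborel). H z + (case z of (x, y) \<Rightarrow> H (y, x)))"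
    using iH iH' by (rule Bochner_Integration.integral_add[symmetric])
  also have "\<dots> \<ge> (LINT z|(lborel \<Otimes>\<^sub>M lborel). 1/2 * W z - \<kappa> * (case z of (x, y) \<Rightarrow> r x * r y / norm (x - y)))"
  proof (rule integral_mono_AE)
    show "integrable (lborel \<Otimes>\<^sub>M lborel) (\<lambda>z. 1/2 * W z - \<kappa> * (case z of (x, y) \<Rightarrow> r x * r y / norm (x - y)))"
      using iW kernel_integrable(1) by (intro Bochner_Integration.integrable_diff integrable_mult_right)
    show "integrable (lborel \<Otimes>\<^sub>M lborel) (\<lambda>z. H z + (case z of (x, y) \<Rightarrow> H (y, x)))"
      using iH iH' by (rule Bochner_Integration.integrable_add)
    show "AE z in lborel \<Otimes>\<^sub>M lborel. 1/2 * W z - \<kappa> * (case z of (x, y) \<Rightarrow> r x * r y / norm (x - y))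
        \<le> H z + (case z of (x, y) \<Rightarrow> H (y, x))"
      using AE_lborel_pair_neq
    proof eventually_elim
      case (elim z)
      obtain x y where z: "z = (x, y)" by (cases z)
      define n where "n = norm (x - y)"
      have n: "n > 0" using elim z by (simp add: n_def)
      \<comment> \<open>Division by \<open>n ^ 3\<close> leaves the product
        \<open>w x * w y / 2\<close>, whose integral is a square, and turns the defect
        \<open>\<kappa> * n^2\<close> into the Coulomb kernel \<open>\<kappa> / n\<close>.\<close>
      have "r x * r y * ((1/2 * (w x * w y * n ^ 3) - \<kappa> * n\<^sup>2) / n ^ 3)
         \<le> r x * r y * (((F x - F y) \<bullet> (x - y)) / n ^ 3)"
        using two_point[of x y] r_ge_0 n unfolding n_def
        by (intro mult_left_mono divide_right_mono) auto
      moreover have "r x * r y * ((1/2 * (w x * w y * n ^ 3) - \<kappa> * n\<^sup>2) / n ^ 3)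
          = 1/2 * W z - \<kappa> * (r x * r y / n)"
        using n by (simp add: z W_def field_simps power3_eq_cube power2_eq_square)
      moreover have "r x * r y * (((F x - F y) \<bullet> (x - y)) / n ^ 3) = H (x, y) + H (y, x)"
      proof -
        have "F y \<bullet> (y - x) = - (F y \<bullet> (x - y))" by (simp add: inner_diff_right)
        then show ?thesis
          by (simp add: H_def n_def norm_minus_commute[of y x] diff_divide_distrib add_divide_distrib algebra_simps)
      qed
      ultimately show ?case by (simp add: z n_def)
    qed
  qed
  also have "(LINT z|(lborel \<Otimes>\<^sub>M lborel). 1/2 * W z - \<kappa> * (case z of (x, y) \<Rightarrow> r x * r y / norm (x - y)))
     = 1/2 * M\<^sup>2 - \<kappa> * (LINT z|(lborel \<Otimes>\<^sub>M lborel). (case z of (x, y) \<Rightarrow> r x * r y / norm (x - y)))"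
    using iW kernel_integrable(1) by (subst Bochner_Integration.integral_diff) (auto simp: W)
  finally have "1/2 * M\<^sup>2 - \<kappa> * (LINT z|(lborel \<Otimes>\<^sub>M lborel). (case z of (x, y) \<Rightarrow> r x * r y / norm (x - y)))
     \<le> 2 * (LINT z|(lborel \<Otimes>\<^sub>M lborel). H z)" .
  moreover have "\<kappa> * (LINT z|(lborel \<Otimes>\<^sub>M lborel). (case z of (x, y) \<Rightarrow> r x * r y / norm (x - y))) \<le> \<kappa> * C"
    using repulsion_integral_le assms by (intro mult_left_mono) auto
  moreover have "Z * I1 \<le> Z * (M + \<kappa> * C)" using I1 assms by (intro mult_left_mono) auto
  moreover have "0 \<le> \<kappa> * C" using assms C_nonneg by simp
  \<comment> \<open>the tangent of the convex right-hand side at its zero \<open>M = 4 * Z\<close>: a linear bound can be averaged in time\<close>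
  moreover have "Z * M - 4 * Z\<^sup>2 \<le> M\<^sup>2 / 4 - Z * M"
    using zero_le_power2[of "M / 2 - 2 * Z"] by (simp add: power2_diff power_divide power_mult_distrib mult_ac)
  ultimately show "Z * (LINT x|lborel. r x * w x) - 4 * Z\<^sup>2 - \<kappa> * (Z + 1) * C
      \<le> (LINT x|lborel. r x * (F x \<bullet> ?K x))"
    unfolding tot M_def[symmetric] by (simp add: algebra_simps)
qed

end

section \<open>The time-integrated virial inequality\<close>

abbreviation "lborel3 \<equiv> lborel :: (real \<times> v3 \<times> v3) measure"
abbreviation "borel3 \<equiv> (borel :: real measure) \<Otimes>\<^sub>M (borel :: v3 measure) \<Otimes>\<^sub>M (borel :: v3 measure)"

text \<open>\<open>g\<close> will be a Borel representative of the solution on the whole time axis.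
  Measurability and the Pauli bounds hold at every point, so every time slice is a
  \<open>phase_space_density\<close>.\<close>

locale vlasov_flow =
  fixes Z q C :: real and g :: "real \<times> v3 \<times> v3 \<Rightarrow> real"
  assumes Z_pos: "Z > 0" and q_pos: "q > 0" and C_nonneg: "C \<ge> 0"
    and g_measurable [measurable]: "g \<in> borel_measurable borel3"
    and g_bounds: "\<And>z. 0 \<le> g z" "\<And>z. g z \<le> q"
begin

definition "rho t x = enn2real (spatial_density (\<lambda>x \<xi>. g (t, x, \<xi>)) x)"

definition "K t x = - (Z / norm x ^ 3) *\<^sub>R x + coulomb_field (rho t) x"

text \<open>The times at which the energy bounds hold. Changing the solution on a null set of phase
  space and time may spoil a null set of times.\<close>

definition "good t \<longleftrightarrow> kinetic_energy (\<lambda>x \<xi>. g (t, x, \<xi>)) \<le> ennreal C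
  \<and> (AE x in lborel. spatial_density (\<lambda>x \<xi>. g (t, x, \<xi>)) x = ennreal (rho t x))
  \<and> bounded_density C (rho t)"

sublocale slice: phase_space_density q "\<lambda>x \<xi>. g (t, x, \<xi>)" for t
  using q_pos g_bounds by unfold_locales (auto simp: case_prod_unfold)

lemma rho_measurable2 [measurable]:
  "(\<lambda>z. rho (fst z) (snd z)) \<in> borel_measurable (borel \<Otimes>\<^sub>M borel)"
  unfolding rho_def[abs_def] spatial_density_eq by measurable

lemma K_measurable2 [measurable]: "(\<lambda>z. K (fst z) (snd z)) \<in> borel_measurable (borel \<Otimes>\<^sub>M borel)"
proof -
  have [measurable]: "(\<lambda>z. rho (fst (fst z)) (snd z)) \<in> borel_measurable ((borel \<Otimes>\<^sub>M borel) \<Otimes>\<^sub>M lborel)"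
  proof -
    have "(\<lambda>z. (fst (fst z), snd z)) \<in> (borel \<Otimes>\<^sub>M borel) \<Otimes>\<^sub>M lborel \<rightarrow>\<^sub>M borel \<Otimes>\<^sub>M (borel :: v3 measure)"
      by measurable
    from measurable_compose[OF this rho_measurable2] show ?thesis by simp
  qed
  show ?thesis unfolding K_def[abs_def] coulomb_field_def by measurable
qed

lemma force_eq_K: "force Z (\<lambda>x \<xi>. g (t, x, \<xi>)) x = K t x"
  unfolding K_def rho_def[abs_def] by (rule force_eq) (simp add: case_prod_unfold)

text \<open>When the density is infinite, both sides are 0: the Bochner integral by its default
  value, \<open>rho\<close> by that of \<open>enn2real\<close>.\<close>

lemma integral_velocity: "(LINT \<xi>|lborel. g (t, x, \<xi>)) = (2 * pi) ^ 3 * rho t x"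
proof -
  have "(LINT \<xi>|lborel. g (t, x, \<xi>) / (2 * pi) ^ 3) = rho t x"
    unfolding rho_def spatial_density_eq
    using g_bounds by (intro integral_eq_nn_integral) auto
  then show ?thesis by (simp add: field_simps)
qed

lemma nn_integral_velocity:
  assumes "good t" and [measurable]: "h \<in> borel_measurable borel"
  shows "(\<integral>\<^sup>+ x. \<integral>\<^sup>+ \<xi>. ennreal (g (t, x, \<xi>)) * h x \<partial>lborel \<partial>lborel)
    = ennreal ((2 * pi) ^ 3) * (\<integral>\<^sup>+ x. ennreal (rho t x) * h x \<partial>lborel)"
proof -
  have "(\<integral>\<^sup>+ \<xi>. ennreal (g (t, x, \<xi>)) * h x \<partial>lborel)
      = ennreal ((2 * pi) ^ 3) * (spatial_density (\<lambda>x \<xi>. g (t, x, \<xi>)) x * h x)" for x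
  proof -
    have "ennreal (g (t, x, \<xi>)) = ennreal ((2 * pi) ^ 3) * ennreal (g (t, x, \<xi>) / (2 * pi) ^ 3)" for \<xi>
      using g_bounds by (subst ennreal_mult[symmetric]) auto
    then show ?thesis
      by (simp add: nn_integral_multc nn_integral_cmult spatial_density_eq mult.assoc)
  qed
  then have "(\<integral>\<^sup>+ x. \<integral>\<^sup>+ \<xi>. ennreal (g (t, x, \<xi>)) * h x \<partial>lborel \<partial>lborel)
    = (\<integral>\<^sup>+ x. ennreal ((2 * pi) ^ 3) * (spatial_density (\<lambda>x \<xi>. g (t, x, \<xi>)) x * h x) \<partial>lborel)"
    by simp
  also have "\<dots> = (\<integral>\<^sup>+ x. ennreal ((2 * pi) ^ 3) * (ennreal (rho t x) * h x) \<partial>lborel)"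
  proof (rule nn_integral_cong_AE)
    have "AE x in lborel. spatial_density (\<lambda>x \<xi>. g (t, x, \<xi>)) x = ennreal (rho t x)"
      using assms by (simp add: good_def)
    then show "AE x in lborel. ennreal ((2 * pi) ^ 3) * (spatial_density (\<lambda>x \<xi>. g (t, x, \<xi>)) x * h x)
      = ennreal ((2 * pi) ^ 3) * (ennreal (rho t x) * h x)" by eventually_elim simp
  qed
  also have "\<dots> = ennreal ((2 * pi) ^ 3) * (\<integral>\<^sup>+ x. ennreal (rho t x) * h x \<partial>lborel)"
  proof (rule nn_integral_cmult)
    have "rho t \<in> borel_measurable borel"
      using assms(1) unfolding good_def bounded_density_def by blast
    then show "(\<lambda>x. ennreal (rho t x) * h x) \<in> borel_measurable lborel" by measurable
  qed
  finally show ?thesis .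
qed

lemma kinetic_moment:
  assumes "good t"
  shows "(\<integral>\<^sup>+ x. \<integral>\<^sup>+ \<xi>. ennreal (g (t, x, \<xi>) * (norm \<xi>)\<^sup>2) \<partial>lborel \<partial>lborel) \<le> ennreal (2 * (2 * pi) ^ 3 * C)"
proof -
  have "g (t, x, \<xi>) * (norm \<xi>)\<^sup>2 = 2 * (2 * pi) ^ 3 * (1 / 2 * (norm \<xi>)\<^sup>2 * g (t, x, \<xi>) / (2 * pi) ^ 3)" for x \<xi>
    by simp
  then have "(\<integral>\<^sup>+ x. \<integral>\<^sup>+ \<xi>. ennreal (g (t, x, \<xi>) * (norm \<xi>)\<^sup>2) \<partial>lborel \<partial>lborel)
    = (\<integral>\<^sup>+ x. \<integral>\<^sup>+ \<xi>. ennreal (2 * (2 * pi) ^ 3) * ennreal (1 / 2 * (norm \<xi>)\<^sup>2 * g (t, x, \<xi>) / (2 * pi) ^ 3) \<partial>lborel \<partial>lborel)"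
    using g_bounds by (subst ennreal_mult[symmetric]) (auto simp: mult.commute)
  also have "\<dots> = ennreal (2 * (2 * pi) ^ 3) * kinetic_energy (\<lambda>x \<xi>. g (t, x, \<xi>))"
    unfolding kinetic_energy_eq kinetic_density_def by (subst nn_integral_cmult, measurable)+
  also have "\<dots> \<le> ennreal (2 * (2 * pi) ^ 3) * ennreal C"
    using assms by (intro mult_left_mono) (auto simp: good_def)
  also have "\<dots> = ennreal (2 * (2 * pi) ^ 3 * C)" using C_nonneg by (simp add: ennreal_mult)
  finally show ?thesis .
qed

text \<open>The mass in a ball is bounded through \<open>1 \<le> (1 + r) / (1 + norm x)\<close> and
  the weighted integral; the remaining 2 in \<open>3 + r\<close> comes from the second velocity
  moment, which is twice the kinetic energy.\<close>

lemma local_moment: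
  assumes "good t" "r \<ge> 0"
  shows "(\<integral>\<^sup>+ x. \<integral>\<^sup>+ \<xi>. ennreal (g (t, x, \<xi>) * (indicator (cball 0 r) x * (1 + (norm \<xi>)\<^sup>2))) \<partial>lborel \<partial>lborel)
    \<le> ennreal ((2 * pi) ^ 3 * ((3 + r) * C))"
proof -
  interpret bounded_density C "rho t" using assms by (simp add: good_def)
  let ?h = "\<lambda>x::v3. ennreal ((1 + r) * (1 / (1 + norm x)))"
  have "(\<integral>\<^sup>+ x. \<integral>\<^sup>+ \<xi>. ennreal (g (t, x, \<xi>) * (indicator (cball 0 r) x * (1 + (norm \<xi>)\<^sup>2))) \<partial>lborel \<partial>lborel)
    \<le> (\<integral>\<^sup>+ x. \<integral>\<^sup>+ \<xi>. ennreal (g (t, x, \<xi>)) * ?h x + ennreal (g (t, x, \<xi>) * (norm \<xi>)\<^sup>2) \<partial>lborel \<partial>lborel)"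
  proof (intro nn_integral_mono)
    fix x \<xi> :: v3
    have "indicator (cball 0 r) x * (1 + (norm \<xi>)\<^sup>2) \<le> (1 + r) * (1 / (1 + norm x)) + (norm \<xi>)\<^sup>2"
      using assms(2) by (auto simp: indicator_def add_pos_nonneg field_simps)
    from mult_left_mono[OF this g_bounds(1)[of "(t, x, \<xi>)"]]
    show "ennreal (g (t, x, \<xi>) * (indicator (cball 0 r) x * (1 + (norm \<xi>)\<^sup>2)))
      \<le> ennreal (g (t, x, \<xi>)) * ?h x + ennreal (g (t, x, \<xi>) * (norm \<xi>)\<^sup>2)"
      using g_bounds(1)[of "(t, x, \<xi>)"] assms(2)
      by (simp add: ennreal_mult[symmetric] ennreal_plus[symmetric] ennreal_leI distrib_left del: ennreal_plus times_divide_eq_right)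
  qed
  also have "\<dots> = (\<integral>\<^sup>+ x. \<integral>\<^sup>+ \<xi>. ennreal (g (t, x, \<xi>)) * ?h x \<partial>lborel \<partial>lborel)
      + (\<integral>\<^sup>+ x. \<integral>\<^sup>+ \<xi>. ennreal (g (t, x, \<xi>) * (norm \<xi>)\<^sup>2) \<partial>lborel \<partial>lborel)"
    by (simp add: nn_integral_add)
  also have "(\<integral>\<^sup>+ x. \<integral>\<^sup>+ \<xi>. ennreal (g (t, x, \<xi>)) * ?h x \<partial>lborel \<partial>lborel)
      = ennreal ((2 * pi) ^ 3) * (\<integral>\<^sup>+ x. ennreal (1 + r) * ennreal (rho t x / (1 + norm x)) \<partial>lborel)"
    using assms(2) r_ge_0
    by (subst nn_integral_velocity[OF assms(1)]) (simp_all add: ennreal_mult[symmetric] mult_ac del: ennreal_plus)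
  also have "\<dots> \<le> ennreal ((2 * pi) ^ 3) * (ennreal (1 + r) * ennreal C)"
    using nn_weighted by (subst nn_integral_cmult) (auto intro!: mult_left_mono)
  also have "(ennreal ((2 * pi) ^ 3) * (ennreal (1 + r) * ennreal C)) +
     (\<integral>\<^sup>+ x. \<integral>\<^sup>+ \<xi>. ennreal (g (t, x, \<xi>) * (norm \<xi>)\<^sup>2) \<partial>lborel \<partial>lborel)
     \<le> ennreal ((2 * pi) ^ 3) * (ennreal (1 + r) * ennreal C) + ennreal (2 * (2 * pi) ^ 3 * C)"
    by (intro add_left_mono kinetic_moment assms)
  also have "\<dots> = ennreal ((2 * pi) ^ 3 * ((1 + r) * C) + 2 * (2 * pi) ^ 3 * C)"
    using C_nonneg assms(2) by (simp add: ennreal_mult[symmetric] ennreal_plus[symmetric] del: ennreal_plus)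
  also have "(2 * pi) ^ 3 * ((1 + r) * C) + 2 * (2 * pi) ^ 3 * C = (2 * pi) ^ 3 * ((3 + r) * C)"
    by (simp add: algebra_simps)
  finally show ?thesis by (simp add: add_right_mono)
qed

lemma force_moment:
  assumes "good t" "c \<ge> 0" and [measurable]: "F \<in> borel_measurable borel"
    and F_bounds: "\<And>x. norm (F x) \<le> c" "\<And>x. norm (F x) \<le> c * norm x"
  shows "(\<integral>\<^sup>+ x. \<integral>\<^sup>+ \<xi>. ennreal (g (t, x, \<xi>) * (norm (F x :: v3) * norm (K t x))) \<partial>lborel \<partial>lborel)
    \<le> ennreal ((2 * pi) ^ 3 * (c * (Z + 1) * C))"
proof -
  interpret bounded_density C "rho t" using assms by (simp add: good_def)
  have [measurable]: "K t \<in> borel_measurable borel" unfolding K_def[abs_def] by measurable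
  have "(\<integral>\<^sup>+ x. \<integral>\<^sup>+ \<xi>. ennreal (g (t, x, \<xi>) * (norm (F x) * norm (K t x))) \<partial>lborel \<partial>lborel)
    = ennreal ((2 * pi) ^ 3) * (\<integral>\<^sup>+ x. ennreal (rho t x) * ennreal (norm (F x) * norm (K t x)) \<partial>lborel)"
    using g_bounds by (subst nn_integral_velocity[OF assms(1), symmetric]) (simp_all add: ennreal_mult[symmetric])
  also have "\<dots> = ennreal ((2 * pi) ^ 3) * (\<integral>\<^sup>+ x. ennreal (rho t x * (norm (F x) * norm (K t x))) \<partial>lborel)"
    using r_ge_0 by (simp add: ennreal_mult)
  also have "\<dots> \<le> ennreal ((2 * pi) ^ 3) * ennreal (c * (Z + 1) * C)"
    unfolding K_def using Z_pos assms by (intro mult_left_mono force_moment_integrable) auto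
  also have "\<dots> = ennreal ((2 * pi) ^ 3 * (c * (Z + 1) * C))"
    using C_nonneg Z_pos assms(2) by (simp add: ennreal_mult)
  finally show ?thesis .
qed

lemma nn_integral_lborel3:
  assumes [measurable]: "h \<in> borel_measurable borel3"
  shows "(\<integral>\<^sup>+ z. h z \<partial>lborel3)
    = (\<integral>\<^sup>+ t. \<integral>\<^sup>+ x. \<integral>\<^sup>+ \<xi>. h (t, x, \<xi>) \<partial>lborel \<partial>lborel \<partial>lborel)"
proof -
  have "(\<integral>\<^sup>+ z. h z \<partial>lborel3) = (\<integral>\<^sup>+ z. h z \<partial>(lborel \<Otimes>\<^sub>M lborel))"
    by (simp only: lborel_prod)
  also have "\<dots> = (\<integral>\<^sup>+ t. \<integral>\<^sup>+ y. h (t, y) \<partial>lborel \<partial>lborel)"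
    by (rule lborel.nn_integral_fst[symmetric]) (simp add: lborel_prod[symmetric] cong: measurable_cong_sets)
  also have "\<dots> = (\<integral>\<^sup>+ t. \<integral>\<^sup>+ y. h (t, y) \<partial>(lborel \<Otimes>\<^sub>M lborel) \<partial>lborel)"
    by (simp only: lborel_prod)
  also have "\<dots> = (\<integral>\<^sup>+ t. \<integral>\<^sup>+ x. \<integral>\<^sup>+ \<xi>. h (t, x, \<xi>) \<partial>lborel \<partial>lborel \<partial>lborel)"
    by (intro nn_integral_cong, rule lborel.nn_integral_fst[symmetric]) measurable
  finally show ?thesis .
qed

text \<open>Tonelli's theorem: bounds that are uniform over time slices become bounds in space-time
  once an integrable time weight is put in front.\<close>

lemma slices_integrable:
  assumes h [measurable]: "h \<in> borel_measurable borel3" and "\<And>z. h z \<ge> 0"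
    and slices: "AE t in lborel. (\<integral>\<^sup>+ x. \<integral>\<^sup>+ \<xi>. ennreal (h (t, x, \<xi>)) \<partial>lborel \<partial>lborel) \<le> ennreal B"
    and "B \<ge> 0" and \<alpha>: "integrable lborel \<alpha>" "\<And>t. \<alpha> t \<ge> 0"
  shows "integrable lborel (\<lambda>z :: real \<times> v3 \<times> v3. \<alpha> (fst z) * h z)"
    and "(LINT z|lborel3. \<alpha> (fst z) * h z) \<le> B * (LINT t|lborel. \<alpha> t)"
proof -
  have [measurable]: "\<alpha> \<in> borel_measurable borel" using \<alpha>(1) by (auto dest: borel_measurable_integrable)
  have m: "(\<lambda>z. \<alpha> (fst z) * h z) \<in> borel_measurable borel3" by measurable
  have "(\<integral>\<^sup>+ z. ennreal (\<alpha> (fst z) * h z) \<partial>lborel3)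
    = (\<integral>\<^sup>+ t. \<integral>\<^sup>+ x. \<integral>\<^sup>+ \<xi>. ennreal (\<alpha> t) * ennreal (h (t, x, \<xi>)) \<partial>lborel \<partial>lborel \<partial>lborel)"
    using assms by (subst nn_integral_lborel3) (simp_all add: ennreal_mult)
  also have "\<dots> = (\<integral>\<^sup>+ t. ennreal (\<alpha> t) * (\<integral>\<^sup>+ x. \<integral>\<^sup>+ \<xi>. ennreal (h (t, x, \<xi>)) \<partial>lborel \<partial>lborel) \<partial>lborel)"
    by (subst nn_integral_cmult, measurable)+
  also have "\<dots> \<le> (\<integral>\<^sup>+ t. ennreal (\<alpha> t) * ennreal B \<partial>lborel)"
    using slices by (intro nn_integral_mono_AE) (auto elim!: eventually_mono intro!: mult_left_mono)
  also have "\<dots> = ennreal (LINT t|lborel. \<alpha> t) * ennreal B"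
    using \<alpha> by (simp add: nn_integral_multc nn_integral_eq_integral)
  also have "\<dots> = ennreal (B * (LINT t|lborel. \<alpha> t))"
    using assms(4) \<alpha> by (simp add: ennreal_mult[symmetric] mult.commute)
  finally have le: "(\<integral>\<^sup>+ z. ennreal (\<alpha> (fst z) * h z) \<partial>lborel3)
    \<le> ennreal (B * (LINT t|lborel. \<alpha> t))" .
  show i: "integrable lborel (\<lambda>z :: real \<times> v3 \<times> v3. \<alpha> (fst z) * h z)"
  proof (rule integrableI_bounded)
    show "(\<lambda>z :: real \<times> v3 \<times> v3. \<alpha> (fst z) * h z) \<in> borel_measurable lborel"
      using m by (simp add: borel_prod)
    show "(\<integral>\<^sup>+ z. ennreal (norm (\<alpha> (fst z) * h z)) \<partial>lborel3) < \<infinity>"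
      using le assms by (auto intro: le_less_trans)
  qed
  have "ennreal (LINT z|lborel3. \<alpha> (fst z) * h z) \<le> ennreal (B * (LINT t|lborel. \<alpha> t))"
    using le assms by (subst nn_integral_eq_integral[symmetric, OF i]) auto
  then show "(LINT z|lborel3. \<alpha> (fst z) * h z) \<le> B * (LINT t|lborel. \<alpha> t)"
    using assms by (subst (asm) ennreal_le_iff) (auto intro!: mult_nonneg_nonneg integral_nonneg_AE)
qed

end

text \<open>The cutoff in velocity, at the scale \<open>1 / sqrt h\<close>, is removed in the limit \<open>h \<rightarrow> 0\<close>.\<close>

definition virial_test ::
  "(real \<Rightarrow> real) \<Rightarrow> (real \<Rightarrow> real) \<Rightarrow> real \<Rightarrow> real \<times> v3 \<times> v3 \<Rightarrow> real" where
  "virial_test \<theta> p h = (\<lambda>z. \<theta> (fst z) * (p ((norm (fst (snd z)))\<^sup>2) * (fst (snd z) \<bullet> snd (snd z)))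
     * bump (h * (norm (snd (snd z)))\<^sup>2))"

lemma virial_test_has_derivative:
  assumes "(\<theta> has_real_derivative \<theta>') (at t)"
    and "(p has_real_derivative p') (at ((norm x)\<^sup>2))"
  shows "(virial_test \<theta> p h has_derivative (\<lambda>(dt, dx, d\<xi>).
      \<theta>' * dt * (p ((norm x)\<^sup>2) * (x \<bullet> \<xi>)) * bump (h * (norm \<xi>)\<^sup>2)
    + \<theta> t * (2 * p' * (x \<bullet> dx) * (x \<bullet> \<xi>) + p ((norm x)\<^sup>2) * (dx \<bullet> \<xi> + x \<bullet> d\<xi>)) * bump (h * (norm \<xi>)\<^sup>2)
    + \<theta> t * (p ((norm x)\<^sup>2) * (x \<bullet> \<xi>)) * (bump' (h * (norm \<xi>)\<^sup>2) * (2 * h * (\<xi> \<bullet> d\<xi>)))))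
    (at (t, x, \<xi>))"
proof -
  let ?z = "(t, x, \<xi>)"
  have comp: "((\<lambda>z. G (f z)) has_derivative (\<lambda>v. D * f' v)) (at z)"
    if "(f has_derivative f') (at z)" "(G has_real_derivative D) (at (f z))"
    for f f' :: "real \<times> v3 \<times> v3 \<Rightarrow> real" and G D z
    by (rule has_derivative_compose[OF that(1) that(2)[unfolded has_field_derivative_def]])
  have sq: "((\<lambda>z. (norm (f z))\<^sup>2) has_derivative (\<lambda>v. 2 * (f z \<bullet> f' v))) (at z)"
    if "(f has_derivative f') (at z)" for f f' :: "real \<times> v3 \<times> v3 \<Rightarrow> v3" and z
    unfolding power2_norm_eq_inner
    by (rule has_derivative_eq_rhs[OF has_derivative_inner[OF that that]]) (simp add: fun_eq_iff inner_commute)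
  have t: "((\<lambda>z :: real \<times> v3 \<times> v3. fst z) has_derivative (\<lambda>v. fst v)) (at ?z)"
   and x: "((\<lambda>z :: real \<times> v3 \<times> v3. fst (snd z)) has_derivative (\<lambda>v. fst (snd v))) (at ?z)"
   and \<xi>: "((\<lambda>z :: real \<times> v3 \<times> v3. snd (snd z)) has_derivative (\<lambda>v. snd (snd v))) (at ?z)"
    by (intro has_derivative_fst has_derivative_snd has_derivative_ident)+
  have 1: "((\<lambda>z. \<theta> (fst z)) has_derivative (\<lambda>v. \<theta>' * fst v)) (at ?z)"
    by (rule comp[OF t]) (use assms(1) in simp)
  have 2: "((\<lambda>z :: real \<times> v3 \<times> v3. p ((norm (fst (snd z)))\<^sup>2)) has_derivative (\<lambda>v. p' * (2 * (fst (snd ?z) \<bullet> fst (snd v))))) (at ?z)"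
    by (rule comp[OF sq[OF x]]) (use assms(2) in simp)
  have 3: "((\<lambda>z :: real \<times> v3 \<times> v3. fst (snd z) \<bullet> snd (snd z)) has_derivative
      (\<lambda>v. fst (snd ?z) \<bullet> snd (snd v) + fst (snd v) \<bullet> snd (snd ?z))) (at ?z)"
    by (rule has_derivative_inner[OF x \<xi>])
  have 4: "((\<lambda>z :: real \<times> v3 \<times> v3. bump (h * (norm (snd (snd z)))\<^sup>2)) has_derivative
      (\<lambda>v. bump' (h * (norm (snd (snd ?z)))\<^sup>2) * (h * (2 * (snd (snd ?z) \<bullet> snd (snd v)))))) (at ?z)"
    by (rule comp[OF has_derivative_mult_right[OF sq[OF \<xi>]] bump_has_derivative])
  show ?thesis
    unfolding virial_test_def
    by (rule has_derivative_eq_rhs[OF has_derivative_mult[OF has_derivative_mult[OF 1 has_derivative_mult[OF 2 3]] 4]])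
      (auto simp: fun_eq_iff algebra_simps)
qed

lemma virial_test_test_function:
  assumes "smooth \<theta>" "smooth (\<lambda>x::v3. p ((norm x)\<^sup>2))" "h > 0"
    and \<theta>: "0 < a" "\<And>t. t \<notin> {a..b} \<Longrightarrow> \<theta> t = 0" and p: "r \<ge> 0" "\<And>s. s \<ge> r\<^sup>2 \<Longrightarrow> p s = 0"
  shows "test_function ({0<..} \<times> UNIV) (virial_test \<theta> p h)"
  unfolding test_function_def
proof (intro conjI allI smooth_C_k)
  have lin: "linear (fst :: real \<times> v3 \<times> v3 \<Rightarrow> real)" "linear (\<lambda>z :: real \<times> v3 \<times> v3. fst (snd z))"
    "linear (\<lambda>z :: real \<times> v3 \<times> v3. snd (snd z))"
    by (auto intro!: linearI)
  have "smooth (\<lambda>z :: real \<times> v3 \<times> v3. fst (snd z) \<bullet> snd (snd z))"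
    using lin by (subst euclidean_inner) (intro smooth_sum smooth.mult smooth_compose_linear[OF smooth.inner]; simp)
  then show "smooth (virial_test \<theta> p h)"
    unfolding virial_test_def using lin
    by (intro smooth.mult smooth_compose_linear[OF assms(1)] smooth_compose_linear[OF assms(2)] smooth_bump
        smooth.const smooth_compose_linear[OF smooth_norm_square])
  let ?S = "{a..b} \<times> cball (0::v3) r \<times> cball (0::v3) (1 / sqrt h)"
  have "{z. virial_test \<theta> p h z \<noteq> 0} \<subseteq> ?S"
  proof (clarsimp simp del: atLeastAtMost_iff)
    fix t and x \<xi> :: v3
    assume nz: "virial_test \<theta> p h (t, x, \<xi>) \<noteq> 0"
    have "t \<in> {a..b}" using nz \<theta>(2)[of t] by (auto simp: virial_test_def)
    moreover have "norm x \<le> r"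
      using nz p(2)[of "(norm x)\<^sup>2"] p(1) power_mono[of r "norm x" 2] by (force simp: virial_test_def)
    moreover have "norm \<xi> \<le> 1 / sqrt h"
    proof -
      have "h * (norm \<xi>)\<^sup>2 < 1" using nz bump_eq_0[of "h * (norm \<xi>)\<^sup>2"] by (force simp: virial_test_def)
      then have "(sqrt h * norm \<xi>)\<^sup>2 \<le> 1\<^sup>2" using assms(3) by (simp add: power_mult_distrib)
      then have "sqrt h * norm \<xi> \<le> 1" by (rule power2_le_imp_le) simp
      then show ?thesis using assms(3) by (simp add: field_simps)
    qed
    ultimately show "t \<in> {a..b} \<and> norm x \<le> r \<and> norm \<xi> \<le> 1 / sqrt h" by blast
  qed
  moreover have S: "compact ?S" by (intro compact_Times compact_cball compact_Icc)
  ultimately have cl: "closure {z. virial_test \<theta> p h z \<noteq> 0} \<subseteq> ?S"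
    using compact_imp_closed closure_minimal by blast
  then show "compact (closure {z. virial_test \<theta> p h z \<noteq> 0})"
    using S by (metis closed_closure compact_Int_closed inf.absorb_iff2)
  show "closure {z. virial_test \<theta> p h z \<noteq> 0} \<subseteq> {0<..} \<times> UNIV"
    using cl \<theta>(1) by auto
qed

section \<open>The weak equation tested with the virial test function\<close>

definition (in vlasov_flow) integrand :: "(real \<times> v3 \<times> v3 \<Rightarrow> real) \<Rightarrow> real \<times> v3 \<times> v3 \<Rightarrow> real" where
  "integrand \<phi> = (\<lambda>(t, x, \<xi>). g (t, x, \<xi>) *
               (frechet_derivative \<phi> (at (t, x, \<xi>)) (1, 0, 0)
              + frechet_derivative \<phi> (at (t, x, \<xi>)) (0, \<xi>, 0)
              + frechet_derivative \<phi> (at (t, x, \<xi>)) (0, 0, K t x)))"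

locale vlasov_solution = vlasov_flow +
  assumes good_AE: "AE t in lborel. good t"
    and weak: "\<And>\<phi>. test_function ({0<..} \<times> UNIV) \<phi> \<Longrightarrow>
      (LINT z|lebesgue. integrand \<phi> z) = 0"

text \<open>The constant \<open>c\<close> bounds the field, its derivative (in the radial form
  \<open>\<bar>p s\<bar> + 2 * s * \<bar>p' s\<bar>\<close>) and the decay of \<open>w\<close>. It
  may be large: it multiplies no term that has to be small before the time profile is
  chosen.\<close>

locale virial_multiplier = vlasov_solution +
  fixes \<theta> \<theta>' p p' :: "real \<Rightarrow> real" and a b r c \<kappa> :: real and w :: "v3 \<Rightarrow> real"
    and F :: "v3 \<Rightarrow> v3"
  assumes F_def: "F = (\<lambda>x. p ((norm x)\<^sup>2) *\<^sub>R x)"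
    and \<theta>: "smooth \<theta>" "\<And>t. (\<theta> has_real_derivative \<theta>' t) (at t)" "continuous_on UNIV \<theta>'"
      "\<And>t. \<theta> t \<ge> 0" "0 < a" "\<And>t. t \<notin> {a..b} \<Longrightarrow> \<theta> t = 0" "\<And>t. t \<notin> {a..b} \<Longrightarrow> \<theta>' t = 0"
    and p: "smooth (\<lambda>x::v3. p ((norm x)\<^sup>2))" "\<And>s. s \<ge> 0 \<Longrightarrow> (p has_real_derivative p' s) (at s)"
      "continuous_on {0..} p'" "r > 0" "\<And>s. s \<ge> r\<^sup>2 \<Longrightarrow> p s = 0 \<and> p' s = 0"
    and c: "\<And>s. s \<ge> 0 \<Longrightarrow> \<bar>p s\<bar> + 2 * s * \<bar>p' s\<bar> \<le> c" "\<And>x. norm (F x) \<le> c"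
    and \<kappa>: "\<kappa> \<ge> 0"
    and two_point: "\<And>x y. 1/2 * (w x * w y * norm (x - y) ^ 3) - \<kappa> * (norm (x - y))\<^sup>2
      \<le> (F x - F y) \<bullet> (x - y)"
    and radial: "\<And>x. F x \<bullet> x \<le> w x * (norm x + \<kappa>) * (norm x)\<^sup>2"
    and w: "w \<in> borel_measurable borel" "\<And>x. 0 \<le> w x" "\<And>x. w x \<le> 1" "\<And>x. w x \<le> c / (1 + norm x)"
begin

lemma c_nonneg: "c \<ge> 0" using c(2)[of 0] by (rule order_trans[OF norm_ge_zero])

lemma F_le: "norm (F x) \<le> c * norm x"
proof -
  have "\<bar>p ((norm x)\<^sup>2)\<bar> \<le> c"
    using c(1)[of "(norm x)\<^sup>2"] by (smt (verit) mult_nonneg_nonneg zero_le_power2 abs_ge_zero)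
  then show ?thesis unfolding F_def by (simp add: mult_right_mono)
qed

lemma data_measurable [measurable]:
  "\<theta> \<in> borel_measurable borel" "\<theta>' \<in> borel_measurable borel"
  "(\<lambda>x::v3. p ((norm x)\<^sup>2)) \<in> borel_measurable borel" "(\<lambda>x::v3. p' ((norm x)\<^sup>2)) \<in> borel_measurable borel"
  "F \<in> borel_measurable borel" "w \<in> borel_measurable borel"
proof -
  show "\<theta> \<in> borel_measurable borel"
    using smooth_C_k[OF \<theta>(1), of 0] by (auto intro: borel_measurable_continuous_onI)
  show "\<theta>' \<in> borel_measurable borel" using \<theta>(3) by (rule borel_measurable_continuous_onI)
  show *: "(\<lambda>x::v3. p ((norm x)\<^sup>2)) \<in> borel_measurable borel"
    using smooth_C_k[OF p(1), of 0] by (auto intro: borel_measurable_continuous_onI)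
  show "(\<lambda>x::v3. p' ((norm x)\<^sup>2)) \<in> borel_measurable borel"
    by (intro borel_measurable_continuous_onI continuous_on_compose2[OF p(3)] continuous_intros) auto
  show "F \<in> borel_measurable borel" unfolding F_def using * by measurable
  show "w \<in> borel_measurable borel" by (rule w)
qed

lemma \<theta>_integrable: "integrable lborel \<theta>" "integrable lborel (\<lambda>t. \<bar>\<theta>' t\<bar>)"
proof -
  have i: "integrable lborel h" if h: "continuous_on UNIV h" "\<And>t. t \<notin> {a..b} \<Longrightarrow> h t = 0" for h :: "real \<Rightarrow> real"
  proof -
    have "integrable lborel (\<lambda>t. indicator {a..b} t *\<^sub>R h t)"
      using h(1) by (intro borel_integrable_compact) (auto intro: continuous_on_subset)
    also have "(\<lambda>t. indicator {a..b} t *\<^sub>R h t) = h" using h(2) by (auto simp: indicator_def fun_eq_iff)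
    finally show ?thesis .
  qed
  show "integrable lborel \<theta>" using smooth_C_k[OF \<theta>(1), of 0] \<theta>(6) by (intro i) auto
  show "integrable lborel (\<lambda>t. \<bar>\<theta>' t\<bar>)" using \<theta>(7) by (intro i continuous_intros \<theta>(3)) auto
qed

text \<open>The two-point inequality at infinitesimal distance.\<close>

lemma positivity:
  fixes x \<xi> :: v3
  shows "- \<kappa> * (norm \<xi>)\<^sup>2 \<le> 2 * p' ((norm x)\<^sup>2) * (x \<bullet> \<xi>) * (x \<bullet> \<xi>) + p ((norm x)\<^sup>2) * (\<xi> \<bullet> \<xi>)"
proof -
  let ?\<psi> = "\<lambda>s. F (x + s *\<^sub>R \<xi>) \<bullet> \<xi>"
  let ?D = "2 * p' ((norm x)\<^sup>2) * (x \<bullet> \<xi>) * (x \<bullet> \<xi>) + p ((norm x)\<^sup>2) * (\<xi> \<bullet> \<xi>)"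
  have n: "((\<lambda>s. (norm (x + s *\<^sub>R \<xi>))\<^sup>2) has_real_derivative 2 * (x \<bullet> \<xi>)) (at 0)"
  proof -
    have "(\<lambda>s. (norm (x + s *\<^sub>R \<xi>))\<^sup>2) = (\<lambda>s. x \<bullet> x + 2 * s * (x \<bullet> \<xi>) + s\<^sup>2 * (\<xi> \<bullet> \<xi>))"
      unfolding power2_norm_eq_inner by (simp add: inner_add_left inner_add_right inner_commute power2_eq_square fun_eq_iff)
    then show ?thesis by (auto intro!: derivative_eq_intros)
  qed
  have 1: "((\<lambda>s. p ((norm (x + s *\<^sub>R \<xi>))\<^sup>2)) has_real_derivative p' ((norm x)\<^sup>2) * (2 * (x \<bullet> \<xi>))) (at 0)"
    using DERIV_chain2[OF _ n, of p "p' ((norm x)\<^sup>2)"] p(2)[of "(norm x)\<^sup>2"] by simp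
  have 2: "((\<lambda>s. (x + s *\<^sub>R \<xi>) \<bullet> \<xi>) has_real_derivative (\<xi> \<bullet> \<xi>)) (at 0)"
    by (auto intro!: derivative_eq_intros simp: inner_add_left)
  have "(?\<psi> has_real_derivative ?D) (at 0)"
    unfolding F_def inner_scaleR_left using DERIV_mult[OF 1 2] by (simp add: algebra_simps)
  then have "((\<lambda>s. (?\<psi> s - ?\<psi> 0) / (s - 0)) \<longlongrightarrow> ?D) (at_right 0)"
    unfolding has_field_derivative_iff by (rule filterlim_mono) (auto simp: at_le)
  then show ?thesis
  proof (rule tendsto_lowerbound)
    show "\<forall>\<^sub>F s in at_right 0. - \<kappa> * (norm \<xi>)\<^sup>2 \<le> (?\<psi> s - ?\<psi> 0) / (s - 0)"
      using eventually_at_right_less[of "0::real"]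
    proof eventually_elim
      case (elim s)
      have "0 \<le> 1/2 * (w (x + s *\<^sub>R \<xi>) * w x * norm (x + s *\<^sub>R \<xi> - x) ^ 3)" using w(2) by simp
      then have "- \<kappa> * (norm (s *\<^sub>R \<xi>))\<^sup>2 \<le> (F (x + s *\<^sub>R \<xi>) - F x) \<bullet> (s *\<^sub>R \<xi>)"
        using two_point[of "x + s *\<^sub>R \<xi>" x] by simp
      then have "s * (s * (- \<kappa> * (norm \<xi>)\<^sup>2)) \<le> s * (?\<psi> s - ?\<psi> 0)"
        by (simp add: inner_diff_left power_mult_distrib power2_eq_square mult_ac)
      then have "s * (- \<kappa> * (norm \<xi>)\<^sup>2) \<le> ?\<psi> s - ?\<psi> 0" using elim by (simp only: mult_le_cancel_left_pos)
      then show ?case using elim by (simp only: diff_zero pos_le_divide_eq mult.commute)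
    qed
  qed simp
qed

definition "limit_integrand = (\<lambda>z. g z *
   (\<theta>' (fst z) * (p ((norm (fst (snd z)))\<^sup>2) * (fst (snd z) \<bullet> snd (snd z)))
  + \<theta> (fst z) * (2 * p' ((norm (fst (snd z)))\<^sup>2) * (fst (snd z) \<bullet> snd (snd z)) * (fst (snd z) \<bullet> snd (snd z))
      + p ((norm (fst (snd z)))\<^sup>2) * (snd (snd z) \<bullet> snd (snd z)))
  + \<theta> (fst z) * (F (fst (snd z)) \<bullet> K (fst z) (fst (snd z)))))"

text \<open>The three nonnegative moments with bounds at good times. The local part dominates the
  terms with \<open>\<theta>'\<close> and the transport term, the force part the force terms, and
  the kinetic part pays for the defect \<open>\<kappa>\<close> of positivity.\<close>

definition "local_part = (\<lambda>z. g z * (indicator (cball 0 r) (fst (snd z)) * (1 + (norm (snd (snd z)))\<^sup>2)))"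
definition "force_part = (\<lambda>z. g z * (norm (F (fst (snd z))) * norm (K (fst z) (fst (snd z)))))"
definition "kinetic_part = (\<lambda>z. g z * (norm (snd (snd z)))\<^sup>2)"

lemma K_compose_measurable [measurable]:
  "(\<lambda>z. K (fst z) (fst (snd z))) \<in> borel_measurable borel3"
proof -
  have "(\<lambda>z. (fst z, fst (snd z))) \<in> borel3 \<rightarrow>\<^sub>M borel \<Otimes>\<^sub>M (borel :: v3 measure)"
    by measurable
  from measurable_compose[OF this K_measurable2] show ?thesis by simp
qed

lemma weight_measurable [measurable]:
  "(\<lambda>z :: real \<times> v3 \<times> v3. p ((norm (fst (snd z)))\<^sup>2)) \<in> borel_measurable borel3"
  "(\<lambda>z :: real \<times> v3 \<times> v3. p' ((norm (fst (snd z)))\<^sup>2)) \<in> borel_measurable borel3"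
  using data_measurable(3,4) by (auto intro: measurable_compose[rotated])

lemma parts_measurable [measurable]:
  "limit_integrand \<in> borel_measurable borel3"
  "local_part \<in> borel_measurable borel3"
  "force_part \<in> borel_measurable borel3"
  "kinetic_part \<in> borel_measurable borel3"
proof -
  show "limit_integrand \<in> borel_measurable borel3"
    "force_part \<in> borel_measurable borel3"
    "kinetic_part \<in> borel_measurable borel3"
    unfolding limit_integrand_def force_part_def kinetic_part_def by measurable
  have [measurable]: "cball (0::v3) r \<in> sets borel" by simp
  show "local_part \<in> borel_measurable borel3"
    unfolding local_part_def by measurable
qed

lemma parts_integrable:
  assumes "integrable lborel \<alpha>" "\<And>t. \<alpha> t \<ge> 0"
  shows "integrable lborel (\<lambda>z. \<alpha> (fst z) * local_part z)"
    "(LINT z|lborel. \<alpha> (fst z) * local_part z) \<le> (2 * pi) ^ 3 * ((3 + r) * C) * (LINT t|lborel. \<alpha> t)"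
    "integrable lborel (\<lambda>z. \<alpha> (fst z) * kinetic_part z)"
    "(LINT z|lborel. \<alpha> (fst z) * kinetic_part z) \<le> 2 * (2 * pi) ^ 3 * C * (LINT t|lborel. \<alpha> t)"
    "integrable lborel (\<lambda>z. \<alpha> (fst z) * force_part z)"
proof -
  have m: "local_part \<in> borel_measurable borel3"
    "force_part \<in> borel_measurable borel3"
    "kinetic_part \<in> borel_measurable borel3" by measurable
  have nn: "local_part z \<ge> 0" "force_part z \<ge> 0" "kinetic_part z \<ge> 0" for z
    using g_bounds by (auto simp: local_part_def force_part_def kinetic_part_def)
  have "AE t in lborel. (\<integral>\<^sup>+ x. \<integral>\<^sup>+ \<xi>. ennreal (local_part (t, x, \<xi>)) \<partial>lborel \<partial>lborel) \<le> ennreal ((2 * pi) ^ 3 * ((3 + r) * C))"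
    using good_AE by eventually_elim (use local_moment p(4) in \<open>simp add: local_part_def\<close>)
  from slices_integrable[OF m(1) nn(1) this _ assms] C_nonneg p(4)
  show "integrable lborel (\<lambda>z. \<alpha> (fst z) * local_part z)"
    "(LINT z|lborel. \<alpha> (fst z) * local_part z) \<le> (2 * pi) ^ 3 * ((3 + r) * C) * (LINT t|lborel. \<alpha> t)" by auto
  have "AE t in lborel. (\<integral>\<^sup>+ x. \<integral>\<^sup>+ \<xi>. ennreal (kinetic_part (t, x, \<xi>)) \<partial>lborel \<partial>lborel) \<le> ennreal (2 * (2 * pi) ^ 3 * C)"
    using good_AE by eventually_elim (use kinetic_moment in \<open>simp add: kinetic_part_def\<close>)
  from slices_integrable[OF m(3) nn(3) this _ assms] C_nonneg
  show "integrable lborel (\<lambda>z. \<alpha> (fst z) * kinetic_part z)"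
    "(LINT z|lborel. \<alpha> (fst z) * kinetic_part z) \<le> 2 * (2 * pi) ^ 3 * C * (LINT t|lborel. \<alpha> t)" by auto
  have "AE t in lborel. (\<integral>\<^sup>+ x. \<integral>\<^sup>+ \<xi>. ennreal (force_part (t, x, \<xi>)) \<partial>lborel \<partial>lborel) \<le> ennreal ((2 * pi) ^ 3 * (c * (Z + 1) * C))"
    using good_AE
    by eventually_elim (use force_moment[OF _ c_nonneg data_measurable(5) c(2) F_le] in \<open>simp add: force_part_def\<close>)
  from slices_integrable(1)[OF m(2) nn(2) this _ assms] C_nonneg c_nonneg Z_pos
  show "integrable lborel (\<lambda>z. \<alpha> (fst z) * force_part z)" by auto
qed

text \<open>The first three summands converge to those of \<open>limit_integrand\<close>; the last
  one is the derivative that falls on the velocity cutoff.\<close>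

lemma integrand_eq:
  "integrand (virial_test \<theta> p h) (t, x, \<xi>) = g (t, x, \<xi>) *
     (\<theta>' t * (p ((norm x)\<^sup>2) * (x \<bullet> \<xi>)) * bump (h * (norm \<xi>)\<^sup>2)
    + \<theta> t * (2 * p' ((norm x)\<^sup>2) * (x \<bullet> \<xi>) * (x \<bullet> \<xi>) + p ((norm x)\<^sup>2) * (\<xi> \<bullet> \<xi>)) * bump (h * (norm \<xi>)\<^sup>2)
    + \<theta> t * (F x \<bullet> K t x) * bump (h * (norm \<xi>)\<^sup>2)
    + \<theta> t * (p ((norm x)\<^sup>2) * (x \<bullet> \<xi>)) * (bump' (h * (norm \<xi>)\<^sup>2) * (2 * h * (\<xi> \<bullet> K t x))))"
  unfolding integrand_def
  by (simp add: frechet_derivative_at[OF virial_test_has_derivative[OF \<theta>(2) p(2)[OF zero_le_power2]], symmetric] F_def algebra_simps)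

lemma integrand_measurable:
  "integrand (virial_test \<theta> p h) \<in> borel_measurable borel3"
proof -
  have [measurable]: "bump \<in> borel_measurable borel" "bump' \<in> borel_measurable borel"
    by (intro borel_measurable_continuous_onI continuous_bump continuous_bump')+
  have "integrand (virial_test \<theta> p h) = (\<lambda>(t, x, \<xi>). integrand (virial_test \<theta> p h) (t, x, \<xi>))" by auto
  then show ?thesis unfolding integrand_eq case_prod_unfold by simp
qed

lemma weight_bounds:
  fixes x \<xi> :: v3
  defines "I \<equiv> indicator (cball 0 r) x * (1 + (norm \<xi>)\<^sup>2)"
  shows "\<bar>p ((norm x)\<^sup>2) * (x \<bullet> \<xi>)\<bar> \<le> c * I"
    and "\<bar>2 * p' ((norm x)\<^sup>2) * (x \<bullet> \<xi>) * (x \<bullet> \<xi>) + p ((norm x)\<^sup>2) * (\<xi> \<bullet> \<xi>)\<bar> \<le> c * I"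
proof -
  define P where "P = p ((norm x)\<^sup>2) * (x \<bullet> \<xi>)"
  define Q where "Q = 2 * p' ((norm x)\<^sup>2) * (x \<bullet> \<xi>) * (x \<bullet> \<xi>) + p ((norm x)\<^sup>2) * (\<xi> \<bullet> \<xi>)"
  have PF: "\<bar>P\<bar> \<le> norm (F x) * norm \<xi>"
    using Cauchy_Schwarz_ineq2[of "F x" \<xi>] by (simp add: P_def F_def)
  have "\<bar>P\<bar> \<le> c * I \<and> \<bar>Q\<bar> \<le> c * I"
  proof (cases "norm x \<le> r")
    case True
    then have I: "I = 1 + (norm \<xi>)\<^sup>2" by (simp add: I_def)
    have "norm \<xi> \<le> 1 + (norm \<xi>)\<^sup>2" using zero_le_power2[of "norm \<xi> - 1/2"] by (simp add: power2_diff power_divide)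
    then have "norm (F x) * norm \<xi> \<le> c * I" using c(2) c_nonneg unfolding I by (intro mult_mono) auto
    moreover have "\<bar>Q\<bar> \<le> c * I"
    proof -
      have "(x \<bullet> \<xi>) * (x \<bullet> \<xi>) \<le> (norm x)\<^sup>2 * (norm \<xi>)\<^sup>2"
        using Cauchy_Schwarz_ineq[of x \<xi>] unfolding power2_norm_eq_inner by (simp add: power2_eq_square)
      then have "2 * \<bar>p' ((norm x)\<^sup>2)\<bar> * ((x \<bullet> \<xi>) * (x \<bullet> \<xi>)) \<le> 2 * \<bar>p' ((norm x)\<^sup>2)\<bar> * ((norm x)\<^sup>2 * (norm \<xi>)\<^sup>2)"
        by (intro mult_left_mono) auto
      moreover have "\<bar>Q\<bar> \<le> 2 * \<bar>p' ((norm x)\<^sup>2)\<bar> * ((x \<bullet> \<xi>) * (x \<bullet> \<xi>)) + \<bar>p ((norm x)\<^sup>2)\<bar> * (norm \<xi>)\<^sup>2"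
        unfolding Q_def by (rule order_trans[OF abs_triangle_ineq]) (simp add: abs_mult power2_norm_eq_inner)
      ultimately have "\<bar>Q\<bar> \<le> (\<bar>p ((norm x)\<^sup>2)\<bar> + 2 * (norm x)\<^sup>2 * \<bar>p' ((norm x)\<^sup>2)\<bar>) * (norm \<xi>)\<^sup>2"
        by (simp add: algebra_simps)
      also have "\<dots> \<le> c * (1 + (norm \<xi>)\<^sup>2)" using c(1)[of "(norm x)\<^sup>2"] c_nonneg by (intro mult_mono) auto
      finally show ?thesis by (simp add: I)
    qed
    ultimately show ?thesis using PF by linarith
  next
    case False
    then have "r\<^sup>2 \<le> (norm x)\<^sup>2" using p(4) by (intro power_mono) auto
    then show ?thesis using p(5)[of "(norm x)\<^sup>2"] c_nonneg by (simp add: P_def Q_def I_def)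
  qed
  then show "\<bar>p ((norm x)\<^sup>2) * (x \<bullet> \<xi>)\<bar> \<le> c * I"
    "\<bar>2 * p' ((norm x)\<^sup>2) * (x \<bullet> \<xi>) * (x \<bullet> \<xi>) + p ((norm x)\<^sup>2) * (\<xi> \<bullet> \<xi>)\<bar> \<le> c * I"
    by (auto simp: P_def Q_def)
qed

text \<open>A majorant free of \<open>h\<close>. In the cutoff term, the two factors
  \<open>norm \<xi>\<close>, one from the test function and one from
  \<open>\<xi> \<bullet> K t x\<close>, are compensated by \<open>h\<close>: \<open>bump'\<close>
  vanishes from 1 on, so \<open>h * (norm \<xi>)^2\<close> may be taken at most 1 there.\<close>

lemma integrand_bound:
  assumes "h > 0"
  shows "norm (integrand (virial_test \<theta> p h) z) \<le> (c * (\<bar>\<theta>' (fst z)\<bar> + \<theta> (fst z))) * local_part z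
    + ((1 + 4 * exp 1) * \<theta> (fst z)) * force_part z"
proof -
  obtain t x \<xi> where z: "z = (t, x, \<xi>)" by (cases z)
  define P where "P = p ((norm x)\<^sup>2) * (x \<bullet> \<xi>)"
  define Q where "Q = 2 * p' ((norm x)\<^sup>2) * (x \<bullet> \<xi>) * (x \<bullet> \<xi>) + p ((norm x)\<^sup>2) * (\<xi> \<bullet> \<xi>)"
  define R where "R = P * (bump' (h * (norm \<xi>)\<^sup>2) * (2 * h * (\<xi> \<bullet> K t x)))"
  define \<beta> where "\<beta> = bump (h * (norm \<xi>)\<^sup>2)"
  define N where "N = norm (F x) * norm (K t x)"
  define I where "I = indicator (cball 0 r) x * (1 + (norm \<xi>)\<^sup>2)"
  have \<beta>: "0 \<le> \<beta>" "\<beta> \<le> 1" using assms by (auto simp: \<beta>_def bump_nonneg bump_le_1)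
  have N: "N \<ge> 0" by (simp add: N_def)
  have PF: "\<bar>P\<bar> \<le> norm (F x) * norm \<xi>"
    using Cauchy_Schwarz_ineq2[of "F x" \<xi>] by (simp add: P_def F_def)
  have Pc: "\<bar>P\<bar> \<le> c * I" and Qc: "\<bar>Q\<bar> \<le> c * I"
    unfolding P_def Q_def I_def by (rule weight_bounds)+
  have Rc: "\<bar>R\<bar> \<le> 4 * exp 1 * N"
  proof -
    have b': "\<bar>bump' (h * (norm \<xi>)\<^sup>2)\<bar> * (h * (norm \<xi>)\<^sup>2) \<le> 2 * exp 1 * 1"
    proof (cases "h * (norm \<xi>)\<^sup>2 \<ge> 1")
      case False
      then show ?thesis using assms by (intro mult_mono abs_bump'_le) auto
    qed (simp add: bump'_eq_0)
    have "\<bar>R\<bar> = \<bar>P\<bar> * (\<bar>bump' (h * (norm \<xi>)\<^sup>2)\<bar> * (2 * h * \<bar>\<xi> \<bullet> K t x\<bar>))"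
      using assms by (simp add: R_def abs_mult)
    also have "\<dots> \<le> (norm (F x) * norm \<xi>) * (\<bar>bump' (h * (norm \<xi>)\<^sup>2)\<bar> * (2 * h * (norm \<xi> * norm (K t x))))"
      using assms by (intro mult_mono PF Cauchy_Schwarz_ineq2 order_refl) auto
    also have "\<dots> = 2 * N * (\<bar>bump' (h * (norm \<xi>)\<^sup>2)\<bar> * (h * (norm \<xi>)\<^sup>2))"
      by (simp add: N_def power2_eq_square)
    also have "\<dots> \<le> 2 * N * (2 * exp 1 * 1)" using b' N by (intro mult_left_mono) auto
    finally show ?thesis by (simp add: mult_ac)
  qed
  have FK: "\<bar>F x \<bullet> K t x\<bar> \<le> N" unfolding N_def by (rule Cauchy_Schwarz_ineq2)
  have \<theta>0: "\<theta> t \<ge> 0" by (rule \<theta>)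
  have cI: "c * I \<ge> 0" using Pc by linarith
  have "\<bar>\<theta>' t * P * \<beta> + \<theta> t * Q * \<beta> + \<theta> t * (F x \<bullet> K t x) * \<beta> + \<theta> t * R\<bar>
    \<le> \<bar>\<theta>' t * P * \<beta>\<bar> + \<bar>\<theta> t * Q * \<beta>\<bar> + \<bar>\<theta> t * (F x \<bullet> K t x) * \<beta>\<bar> + \<bar>\<theta> t * R\<bar>" by linarith
  also have "\<dots> \<le> \<bar>\<theta>' t\<bar> * (c * I) * 1 + \<theta> t * (c * I) * 1 + \<theta> t * N * 1 + \<theta> t * (4 * exp 1 * N)"
    unfolding abs_mult using \<theta>0 \<beta> N cI Pc Qc Rc FK
    by (intro add_mono mult_mono) auto
  also have "\<dots> = c * (\<bar>\<theta>' t\<bar> + \<theta> t) * I + (1 + 4 * exp 1) * \<theta> t * N" by (simp add: algebra_simps)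
  finally have "g (t, x, \<xi>) * \<bar>\<theta>' t * P * \<beta> + \<theta> t * Q * \<beta> + \<theta> t * (F x \<bullet> K t x) * \<beta> + \<theta> t * R\<bar>
     \<le> g (t, x, \<xi>) * (c * (\<bar>\<theta>' t\<bar> + \<theta> t) * I + (1 + 4 * exp 1) * \<theta> t * N)"
    by (rule mult_left_mono) (rule g_bounds)
  moreover have "norm (integrand (virial_test \<theta> p h) z)
     = g (t, x, \<xi>) * \<bar>\<theta>' t * P * \<beta> + \<theta> t * Q * \<beta> + \<theta> t * (F x \<bullet> K t x) * \<beta> + \<theta> t * R\<bar>"
    unfolding z integrand_eq P_def Q_def R_def \<beta>_def using g_bounds(1)[of "(t, x, \<xi>)"]
    by (simp add: abs_mult mult.assoc)
  ultimately show ?thesis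
    by (simp add: z local_part_def force_part_def N_def I_def algebra_simps)
qed

text \<open>At a fixed velocity the cutoff tends to \<open>bump 0 = 1\<close>, while its derivative
  carries an explicit factor \<open>h\<close>.\<close>

lemma integrand_tendsto:
  "(\<lambda>n. integrand (virial_test \<theta> p (inverse (real (Suc n)))) z) \<longlonglongrightarrow> limit_integrand z"
proof -
  obtain t x \<xi> where z: "z = (t, x, \<xi>)" by (cases z)
  have h: "(\<lambda>n. inverse (real (Suc n))) \<longlonglongrightarrow> 0" by (rule LIMSEQ_inverse_real_of_nat)
  then have h2: "(\<lambda>n. inverse (real (Suc n)) * (norm \<xi>)\<^sup>2) \<longlonglongrightarrow> 0" by (rule tendsto_mult_left_zero)
  have b: "(\<lambda>n. bump (inverse (real (Suc n)) * (norm \<xi>)\<^sup>2)) \<longlonglongrightarrow> 1"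
    using isCont_tendsto_compose[OF DERIV_isCont[OF bump_has_derivative] h2] by simp
  have "continuous (at 0) bump'"
    using continuous_bump'[of UNIV] by (simp add: continuous_on_eq_continuous_at)
  then have b': "(\<lambda>n. bump' (inverse (real (Suc n)) * (norm \<xi>)\<^sup>2)) \<longlonglongrightarrow> bump' 0"
    using isCont_tendsto_compose h2 by blast
  have "(\<lambda>n. integrand (virial_test \<theta> p (inverse (real (Suc n)))) z) \<longlonglongrightarrow>
    g (t, x, \<xi>) *
     (\<theta>' t * (p ((norm x)\<^sup>2) * (x \<bullet> \<xi>)) * 1
    + \<theta> t * (2 * p' ((norm x)\<^sup>2) * (x \<bullet> \<xi>) * (x \<bullet> \<xi>) + p ((norm x)\<^sup>2) * (\<xi> \<bullet> \<xi>)) * 1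
    + \<theta> t * (F x \<bullet> K t x) * 1
    + \<theta> t * (p ((norm x)\<^sup>2) * (x \<bullet> \<xi>)) * (bump' 0 * (2 * 0 * (\<xi> \<bullet> K t x))))"
    unfolding z integrand_eq by (intro tendsto_intros b b' h)
  then show ?thesis by (simp add: limit_integrand_def z)
qed

lemma virial_identity:
  "integrable lborel limit_integrand" "(LINT z|lborel. limit_integrand z) = 0"
proof -
  let ?s = "\<lambda>n. integrand (virial_test \<theta> p (inverse (real (Suc n))))"
  have t: "test_function ({0<..} \<times> UNIV) (virial_test \<theta> p (inverse (real (Suc n))))" for n
    using p(4,5) by (intro virial_test_test_function[where a=a and b=b and r=r, OF \<theta>(1) p(1) _ \<theta>(5,6)]) auto
  have m1: "limit_integrand \<in> borel_measurable lborel"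
    using parts_measurable(1) by (simp add: borel_prod)
  have m2: "?s n \<in> borel_measurable lborel" for n
    using integrand_measurable by (simp add: borel_prod)
  have "integrable lborel (\<lambda>t. c * (\<bar>\<theta>' t\<bar> + \<theta> t))" "integrable lborel (\<lambda>t. (1 + 4 * exp 1) * \<theta> t)"
    using \<theta>_integrable by auto
  then have d: "integrable lborel (\<lambda>z. (c * (\<bar>\<theta>' (fst z)\<bar> + \<theta> (fst z))) * local_part z
    + ((1 + 4 * exp 1) * \<theta> (fst z)) * force_part z)"
    using c_nonneg \<theta>(4) by (intro Bochner_Integration.integrable_add parts_integrable) auto
  have bd: "norm (?s n z) \<le> (c * (\<bar>\<theta>' (fst z)\<bar> + \<theta> (fst z))) * local_part z
    + ((1 + 4 * exp 1) * \<theta> (fst z)) * force_part z" for n z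
    by (rule integrand_bound) simp
  show "integrable lborel limit_integrand"
    by (rule integrable_dominated_convergence[OF m1 m2 d AE_I2[OF integrand_tendsto] AE_I2[OF bd]])
  have "(\<lambda>n. LINT z|lborel. ?s n z) \<longlonglongrightarrow> (LINT z|lborel. limit_integrand z)"
    by (rule integral_dominated_convergence[OF m1 m2 d AE_I2[OF integrand_tendsto] AE_I2[OF bd]])
  moreover have "(LINT z|lborel. ?s n z) = 0" for n
    using weak[OF t[of n]] integral_completion[OF m2[of n]] by simp
  ultimately show "(LINT z|lborel. limit_integrand z) = 0"
    by (simp add: LIMSEQ_const_iff)
qed

end

section \<open>The weighted mass and its inequality in time\<close>

context vlasov_flow
begin

definition "mass w t = (LINT x|lborel. rho t x * w x)"

lemma mass_measurable [measurable]:
  assumes [measurable]: "w \<in> borel_measurable borel"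
  shows "mass w \<in> borel_measurable borel"
proof -
  have "(\<lambda>z. rho (fst z) (snd z) * w (snd z)) \<in> borel_measurable (borel \<Otimes>\<^sub>M lborel)"
    using rho_measurable2 by (simp cong: measurable_cong_sets)
  then have "(\<lambda>(t, x). rho t x * w x) \<in> borel_measurable (borel \<Otimes>\<^sub>M lborel)"
    by (simp add: case_prod_unfold)
  from lborel.borel_measurable_lebesgue_integral[OF this] show ?thesis
    by (simp add: mass_def[abs_def])
qed

lemma mass_bounds:
  assumes "good t" and w: "w \<in> borel_measurable borel" "\<And>x. 0 \<le> w x" "\<And>x. w x \<le> c / (1 + norm x)" and "c \<ge> 0"
  shows "0 \<le> mass w t" "mass w t \<le> c * C" "integrable lborel (\<lambda>x. rho t x * w x)"
proof -
  interpret bounded_density C "rho t" using assms by (simp add: good_def)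
  show "mass w t \<le> c * C" "integrable lborel (\<lambda>x. rho t x * w x)"
    unfolding mass_def using weighted_integral_le[OF w assms(5)] by auto
  show "0 \<le> mass w t" unfolding mass_def using r_ge_0 w(2) by (intro integral_nonneg_AE) auto
qed

end

context virial_multiplier
begin

lemma mass_integrable:
  assumes "integrable lborel h"
  shows "integrable lborel (\<lambda>t. h t * mass w t)"
proof (rule Bochner_Integration.integrable_bound[OF integrable_mult_right[OF integrable_abs[OF assms], of "c * C"]])
  show "(\<lambda>t. h t * mass w t) \<in> borel_measurable lborel"
    using mass_measurable[OF w(1)] borel_measurable_integrable[OF assms] by simp
  show "AE t in lborel. norm (h t * mass w t) \<le> norm (c * C * \<bar>h t\<bar>)"
    using good_AE
  proof eventually_elim
    case (elim t)
    note m = mass_bounds[OF elim w(1,2,4) c_nonneg]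
    have "\<bar>h t\<bar> * mass w t \<le> \<bar>h t\<bar> * (c * C)" using m by (intro mult_left_mono) auto
    then show ?case using m c_nonneg C_nonneg by (simp add: abs_mult mult_ac)
  qed
qed

text \<open>In the identity for \<open>limit_integrand\<close> the time derivative is estimated by
  the local moment and transport from below by \<open>- \<kappa> * (norm \<xi>)^2\<close>, whose
  cost is kinetic. The force term is bounded below slice by slice. The factor
  \<open>(2 * pi) ^ 3\<close>, by which the velocity integral of \<open>g\<close> exceeds the
  density, occurs on both sides and cancels.\<close>

lemma time_inequality:
  "(LINT t|lborel. \<theta> t * (Z * mass w t - 4 * Z\<^sup>2 - \<kappa> * (Z + 1) * C))
    \<le> c * ((3 + r) * C) * (LINT t|lborel. \<bar>\<theta>' t\<bar>) + 2 * \<kappa> * C * (LINT t|lborel. \<theta> t)"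
proof -
  define P where "P = (2 * pi) ^ 3"
  have P: "P > 0" by (simp add: P_def)
  define f where "f = (\<lambda>z. \<theta> (fst z) * (g z * (F (fst (snd z)) \<bullet> K (fst z) (fst (snd z)))))"
  have fm: "f \<in> borel_measurable borel3" unfolding f_def by measurable
  have fi: "integrable lborel f"
  proof (rule Bochner_Integration.integrable_bound[OF parts_integrable(5)[OF \<theta>_integrable(1) \<theta>(4)]])
    show "f \<in> borel_measurable lborel" using fm by (simp add: borel_prod)
    have "norm (f z) \<le> norm (\<theta> (fst z) * force_part z)" for z
    proof -
      have "\<theta> (fst z) * (g z * \<bar>F (fst (snd z)) \<bullet> K (fst z) (fst (snd z))\<bar>) \<le> \<theta> (fst z) * force_part z"
        unfolding force_part_def using \<theta>(4) g_bounds(1) by (intro mult_left_mono Cauchy_Schwarz_ineq2) auto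
      then show ?thesis
        using \<theta>(4)[of "fst z"] g_bounds(1)[of z] by (simp add: f_def abs_mult force_part_def)
    qed
    then show "AE z in lborel. norm (f z) \<le> norm (\<theta> (fst z) * force_part z)" by simp
  qed
  have i1: "integrable lborel (\<lambda>t. c * \<bar>\<theta>' t\<bar>)" and i2: "integrable lborel (\<lambda>t. \<kappa> * \<theta> t)"
    using \<theta>_integrable by auto
  have n1: "c * \<bar>\<theta>' t\<bar> \<ge> 0" and n2: "\<kappa> * \<theta> t \<ge> 0" for t using c_nonneg \<kappa> \<theta>(4) by auto
  note L = parts_integrable(1,2)[OF i1 n1, folded P_def] and N = parts_integrable(3,4)[OF i2 n2, folded P_def]
  have "(LINT z|lborel. f z - c * \<bar>\<theta>' (fst z)\<bar> * local_part z - \<kappa> * \<theta> (fst z) * kinetic_part z)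
      \<le> (LINT z|lborel. limit_integrand z)"
  proof (rule integral_mono)
    show "integrable lborel (\<lambda>z. f z - c * \<bar>\<theta>' (fst z)\<bar> * local_part z - \<kappa> * \<theta> (fst z) * kinetic_part z)"
      by (intro Bochner_Integration.integrable_diff fi L N)
    show "integrable lborel limit_integrand" by (rule virial_identity)
    fix z :: "real \<times> v3 \<times> v3"
    obtain t x \<xi> where z: "z = (t, x, \<xi>)" by (cases z)
    let ?P = "p ((norm x)\<^sup>2) * (x \<bullet> \<xi>)"
    let ?Q = "2 * p' ((norm x)\<^sup>2) * (x \<bullet> \<xi>) * (x \<bullet> \<xi>) + p ((norm x)\<^sup>2) * (\<xi> \<bullet> \<xi>)"
    let ?I = "indicator (cball 0 r) x * (1 + (norm \<xi>)\<^sup>2)"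
    have "\<bar>\<theta>' t * ?P\<bar> \<le> \<bar>\<theta>' t\<bar> * (c * ?I)"
      unfolding abs_mult using weight_bounds(1)[of x \<xi>, unfolded abs_mult] by (intro mult_left_mono) auto
    moreover have "\<theta> t * (- \<kappa> * (norm \<xi>)\<^sup>2) \<le> \<theta> t * ?Q" by (intro mult_left_mono positivity \<theta>)
    ultimately have "\<theta> t * (F x \<bullet> K t x) - \<bar>\<theta>' t\<bar> * (c * ?I) - \<theta> t * (\<kappa> * (norm \<xi>)\<^sup>2)
       \<le> \<theta>' t * ?P + \<theta> t * ?Q + \<theta> t * (F x \<bullet> K t x)" by linarith
    from mult_left_mono[OF this g_bounds(1)[of z]]
    show "f z - c * \<bar>\<theta>' (fst z)\<bar> * local_part z - \<kappa> * \<theta> (fst z) * kinetic_part z \<le> limit_integrand z"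
      by (simp add: f_def local_part_def kinetic_part_def limit_integrand_def z algebra_simps)
  qed
  also have "\<dots> = 0" by (rule virial_identity)
  also have "(LINT z|lborel. f z - c * \<bar>\<theta>' (fst z)\<bar> * local_part z - \<kappa> * \<theta> (fst z) * kinetic_part z)
    = (LINT z|lborel. f z) - (LINT z|lborel. c * \<bar>\<theta>' (fst z)\<bar> * local_part z) - (LINT z|lborel. \<kappa> * \<theta> (fst z) * kinetic_part z)"
    using fi L(1) N(1) by (simp only: Bochner_Integration.integral_diff Bochner_Integration.integrable_diff)
  finally have "(LINT z|lborel. f z) \<le> P * ((3 + r) * C) * (c * (LINT t|lborel. \<bar>\<theta>' t\<bar>)) + 2 * P * C * (\<kappa> * (LINT t|lborel. \<theta> t))"
    using L(2) N(2) by simp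
  then have upper: "(LINT z|lborel. f z) \<le> P * (c * ((3 + r) * C) * (LINT t|lborel. \<bar>\<theta>' t\<bar>) + 2 * \<kappa> * C * (LINT t|lborel. \<theta> t))"
    by (simp add: algebra_simps)
  let ?V = "\<lambda>t. LINT x|lborel. rho t x * (F x \<bullet> K t x)"
  have fi': "integrable (lborel \<Otimes>\<^sub>M lborel) f" using fi by (simp only: lborel_prod)
  \<comment> \<open>Holds at almost every time, where the slice of \<open>f\<close> is integrable
    and Fubini's theorem applies in \<open>x\<close> and \<open>\<xi>\<close>.\<close>
  have slice_eq: "AE t in lborel. (LINT y|lborel. f (t, y)) = P * (\<theta> t * ?V t)"
    using lborel_pair.AE_integrable_fst'[OF fi']
  proof eventually_elim
    case (elim t)
    have "(LINT y|lborel. f (t, y)) = (LINT y|(lborel \<Otimes>\<^sub>M lborel). f (t, y))" by (simp only: lborel_prod)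
    also have "\<dots> = (LINT x|lborel. LINT \<xi>|lborel. f (t, x, \<xi>))"
      using elim by (intro lborel_pair.integral_fst'[symmetric]) (simp only: lborel_prod)
    also have "\<dots> = (LINT x|lborel. P * \<theta> t * (rho t x * (F x \<bullet> K t x)))"
    proof (intro Bochner_Integration.integral_cong refl)
      fix x
      have "(LINT \<xi>|lborel. f (t, x, \<xi>)) = (LINT \<xi>|lborel. g (t, x, \<xi>) * (\<theta> t * (F x \<bullet> K t x)))"
        by (simp add: f_def mult_ac)
      also have "\<dots> = P * \<theta> t * (rho t x * (F x \<bullet> K t x))"
        by (simp add: integral_velocity P_def)
      finally show "(LINT \<xi>|lborel. f (t, x, \<xi>)) = P * \<theta> t * (rho t x * (F x \<bullet> K t x))" .
    qed
    also have "\<dots> = P * (\<theta> t * ?V t)" by (simp add: mult.assoc)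
    finally show ?case .
  qed
  let ?m = "\<lambda>t. \<theta> t * (Z * mass w t - 4 * Z\<^sup>2 - \<kappa> * (Z + 1) * C)"
  have mi: "integrable lborel ?m"
  proof -
    have "integrable lborel (\<lambda>t. Z * (\<theta> t * mass w t) - (4 * Z\<^sup>2 + \<kappa> * (Z + 1) * C) * \<theta> t)"
      by (intro Bochner_Integration.integrable_diff integrable_mult_right mass_integrable \<theta>_integrable)
    then show ?thesis by (simp add: algebra_simps)
  qed
  have "P * (LINT t|lborel. ?m t) = (LINT t|lborel. P * ?m t)" by simp
  also have "\<dots> \<le> (LINT t|lborel. LINT y|lborel. f (t, y))"
  proof (rule integral_mono_AE)
    show "integrable lborel (\<lambda>t. P * ?m t)" using mi by (rule integrable_mult_right)
    show "integrable lborel (\<lambda>t. LINT y|lborel. f (t, y))" by (rule lborel_pair.integrable_fst'[OF fi'])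
    show "AE t in lborel. P * ?m t \<le> (LINT y|lborel. f (t, y))"
      using slice_eq good_AE
    proof eventually_elim
      case (elim t)
      interpret bounded_density C "rho t" using elim by (simp add: good_def)
      have "Z * mass w t - 4 * Z\<^sup>2 - \<kappa> * (Z + 1) * C \<le> ?V t"
        unfolding mass_def K_def
        by (rule virial_lower_bound[OF Z_pos c_nonneg \<kappa> data_measurable(5) c(2) F_le w(1,2,4) two_point radial w(3)])
      then show ?case unfolding elim(1) using P \<theta>(4) by (intro mult_left_mono) auto
    qed
  qed
  also have "\<dots> = (LINT z|(lborel \<Otimes>\<^sub>M lborel). f z)" by (rule lborel_pair.integral_fst'[OF fi'])
  also have "\<dots> = (LINT z|lborel. f z)" by (simp only: lborel_prod)
  finally have "P * (LINT t|lborel. ?m t) \<le> P * (c * ((3 + r) * C) * (LINT t|lborel. \<bar>\<theta>' t\<bar>) + 2 * \<kappa> * C * (LINT t|lborel. \<theta> t))"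
    using upper by linarith
  then show ?thesis using P by (simp only: mult_le_cancel_left_pos)
qed

end

section \<open>The time average\<close>

text \<open>This brings the weight under \<open>1 / (1 + norm x)\<close>, the decay against which
  the density is known to be integrable.\<close>

lemma inverse_quadratic_le:
  fixes \<epsilon> n :: real
  assumes "\<epsilon> > 0" "n \<ge> 0"
  shows "1 / (1 + \<epsilon> * n\<^sup>2) \<le> (2 + 1 / \<epsilon>) / (1 + n)"
proof -
  have "0 \<le> (n - 1/2)\<^sup>2" by simp
  then have "1 + n \<le> 2 + n\<^sup>2" by (simp add: power2_diff power_divide)
  also have "\<dots> \<le> (2 + 1 / \<epsilon>) * (1 + \<epsilon> * n\<^sup>2)" using assms by (simp add: algebra_simps)
  finally show ?thesis using assms by (simp add: field_simps add_pos_nonneg)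
qed

text \<open>Half of \<open>\<epsilon>\<close> is spent on the defect \<open>\<kappa>\<close>, the
  other half on the loss \<open>\<eta>\<close> of the time profile. \<open>\<kappa>\<close>
  determines the field and with it \<open>r\<close> and \<open>c\<close>; these determine
  \<open>\<eta>\<close>, then the profile and \<open>B\<close>. None of these constants depends on
  \<open>T\<close>.\<close>

lemma (in vlasov_solution) average_mass_le:
  assumes "\<epsilon> > 0"
  obtains A where "A \<ge> 0" "\<And>T. T > 0 \<Longrightarrow>
    (LINT t|lborel. indicator {0..T} t * mass (\<lambda>x. 1 / (1 + \<epsilon> * (1 + (norm x)\<^sup>2))) t) \<le> (4 * Z + \<epsilon>) * T + A"
    "\<And>T. integrable lborel (\<lambda>t. indicator {0..T} t * mass (\<lambda>x. 1 / (1 + \<epsilon> * (1 + (norm x)\<^sup>2))) t)"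
proof -
  \<comment> \<open>In \<open>Z + 3\<close>, the part \<open>Z + 1\<close> is the error at fixed
    time and 2 the kinetic error of transport; the added 1 keeps the denominator positive when
    \<open>C = 0\<close>.\<close>
  define \<kappa> where "\<kappa> = \<epsilon> * Z / (2 * ((Z + 3) * C + 1))"
  have den: "(Z + 3) * C + 1 > 0" using Z_pos C_nonneg by (simp add: add_nonneg_pos)
  have \<kappa>: "\<kappa> > 0" using assms Z_pos den by (simp add: \<kappa>_def)
  have \<kappa>C: "\<kappa> * ((Z + 3) * C) \<le> Z * (\<epsilon> / 2)"
  proof -
    have "\<kappa> * ((Z + 3) * C) \<le> \<kappa> * ((Z + 3) * C + 1)" using \<kappa> by simp
    also have "\<dots> = Z * (\<epsilon> / 2)"
    proof -
      have "a / (2 * d) * d = a / 2" if "d > 0" for a d :: real using that by simp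
      from this[OF den] show ?thesis by (simp add: \<kappa>_def mult.commute)
    qed
    finally show ?thesis .
  qed
  obtain p p' :: "real \<Rightarrow> real" and w :: "v3 \<Rightarrow> real" and r where
    p: "smooth (\<lambda>x::v3. p ((norm x)\<^sup>2))" "\<And>s. s \<ge> 0 \<Longrightarrow> (p has_real_derivative p' s) (at s)"
      "continuous_on {0..} p'" "r > 0" "\<And>s. s \<ge> r\<^sup>2 \<Longrightarrow> p s = 0 \<and> p' s = 0"
    and two_point: "\<And>x y. 1/2 * (w x * w y * norm (x - y) ^ 3) - \<kappa> * (norm (x - y))\<^sup>2
      \<le> (p ((norm x)\<^sup>2) *\<^sub>R x - p ((norm y)\<^sup>2) *\<^sub>R y) \<bullet> (x - y)"
    and radial: "\<And>x. p ((norm x)\<^sup>2) \<le> w x * (norm x + \<kappa>)"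
    and w: "\<And>x. 1 / (1 + \<epsilon> * (1 + (norm x)\<^sup>2)) \<le> w x" "\<And>x. w x \<le> 1 / (1 + \<epsilon> * (norm x)\<^sup>2)"
    and w_cont: "continuous_on UNIV w"
    by (rule radial_weight_exists[OF assms \<kappa>, where 'a=v3]) (rule that; assumption)
  have "bounded ((\<lambda>s. \<bar>p s\<bar> + 2 * s * \<bar>p' s\<bar>) ` {0..r\<^sup>2})"
  proof (intro compact_imp_bounded compact_continuous_image)
    have "continuous_on {0..} p"
      using p(2) DERIV_isCont by (intro continuous_at_imp_continuous_on) auto
    then show "continuous_on {0..r\<^sup>2} (\<lambda>s. \<bar>p s\<bar> + 2 * s * \<bar>p' s\<bar>)"
      using p(3) by (intro continuous_intros) (auto intro: continuous_on_subset)
  qed simp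
  then obtain b where "\<And>s. s \<in> {0..r\<^sup>2} \<Longrightarrow> \<bar>p s\<bar> + 2 * s * \<bar>p' s\<bar> \<le> b"
    unfolding bounded_iff ball_simps real_norm_def by (meson abs_le_D1)
  then have b: "\<bar>p s\<bar> + 2 * s * \<bar>p' s\<bar> \<le> max b 0" if "s \<ge> 0" for s
    using that p(5)[of s] by (cases "s \<le> r\<^sup>2") (auto simp: le_max_iff_disj)
  \<comment> \<open>The summands bound the derivative of the field, the field on its support of
    radius \<open>r\<close>, and the decay of \<open>w\<close>.\<close>
  define c where "c = max b 0 + max b 0 * r + (2 + 1 / \<epsilon>)"
  have c_le: "max b 0 \<le> c" "max b 0 * r \<le> c" "2 + 1 / \<epsilon> \<le> c" "c \<ge> 0"
  proof -
    have "0 \<le> max b 0" "0 \<le> max b 0 * r" "0 \<le> 2 + 1 / \<epsilon>" using assms p(4) by auto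
    then show "max b 0 \<le> c" "max b 0 * r \<le> c" "2 + 1 / \<epsilon> \<le> c" "c \<ge> 0"
      unfolding c_def by linarith+
  qed
  note w_ge = w(1)
  have w0: "0 \<le> w x" for x
    using w(1)[of x] assms by (smt (verit) divide_nonneg_nonneg mult_nonneg_nonneg zero_le_power2)
  have decay: "1 / (1 + \<epsilon> * (norm x)\<^sup>2) \<le> c / (1 + norm x)" for x :: v3
  proof -
    have "1 / (1 + \<epsilon> * (norm x)\<^sup>2) \<le> (2 + 1 / \<epsilon>) / (1 + norm x)"
      using assms by (intro inverse_quadratic_le) auto
    also have "\<dots> \<le> c / (1 + norm x)" using c_le by (intro divide_right_mono) auto
    finally show ?thesis .
  qed
  have w_decay: "w x \<le> c / (1 + norm x)" for x using w(2)[of x] decay[of x] by linarith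
  have w1: "w x \<le> 1" for x
  proof -
    have "1 / (1 + \<epsilon> * (norm x)\<^sup>2) \<le> 1" using assms by (simp add: add_pos_nonneg)
    then show ?thesis using w(2)[of x] by linarith
  qed
  have w_meas: "w \<in> borel_measurable borel" using w_cont by (rule borel_measurable_continuous_onI)
  define \<eta> where "\<eta> = \<epsilon> / (2 * (c * C + 1))"
  have cC: "c * C \<ge> 0" using c_le C_nonneg by simp
  have \<eta>: "\<eta> > 0" "c * C * \<eta> \<le> \<epsilon> / 2"
    using assms cC by (auto simp: \<eta>_def field_simps add_nonneg_pos)
  obtain \<beta> \<beta>' a B where \<beta>: "0 < a" "smooth \<beta>" "\<And>u. (\<beta> has_real_derivative \<beta>' u) (at u)" "continuous_on UNIV \<beta>'"
    "\<And>u. 0 \<le> \<beta> u" "\<And>u. \<beta> u \<le> 1" "\<And>u. u \<notin> {a..1} \<Longrightarrow> \<beta> u = 0" "\<And>u. u \<notin> {a..1} \<Longrightarrow> \<beta>' u = 0"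
    "\<And>u. \<bar>\<beta>' u\<bar> \<le> B" "(LINT u|lborel. indicator {0..1} u * (1 - \<beta> u)) \<le> \<eta>"
    by (rule time_profile[OF \<eta>(1)]) (rule that; assumption)
  have B: "B \<ge> 0" using \<beta>(9)[of 0] by linarith
  \<comment> \<open>The price of switching the profile on and off, divided by
    \<open>Z\<close>.\<close>
  define A where "A = c * ((3 + r) * C) * B / Z"
  have A: "A \<ge> 0" using c_le p(4) C_nonneg B Z_pos by (simp add: A_def)
  let ?w = "\<lambda>x::v3. 1 / (1 + \<epsilon> * (1 + (norm x)\<^sup>2))"
  have w'_meas: "?w \<in> borel_measurable borel" by measurable
  have w'0: "0 \<le> ?w x" for x using assms by simp
  have w'_decay: "?w x \<le> c / (1 + norm x)" for x using w(1)[of x] w_decay[of x] by linarith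
  have ind: "integrable lborel (indicator {0..T} :: real \<Rightarrow> real)" for T
    by (intro integrable_real_indicator) (auto simp: emeasure_lborel_Icc_eq)
  have int: "integrable lborel (\<lambda>t. indicator {0..T} t * mass w' t)"
    if "w' \<in> borel_measurable borel" "\<And>x. 0 \<le> w' x" "\<And>x. w' x \<le> c / (1 + norm x)" for T w'
  proof (rule Bochner_Integration.integrable_bound[OF integrable_mult_right[OF ind, of "c * C"]])
    show "(\<lambda>t. indicator {0..T} t * mass w' t) \<in> borel_measurable lborel"
      using mass_measurable[OF that(1)] by simp
    show "AE t in lborel. norm (indicator {0..T} t * mass w' t) \<le> norm (c * C * indicator {0..T} t)"
      using good_AE
    proof eventually_elim
      case (elim t)
      show ?case using mass_bounds[OF elim that c_le(4)] by (auto simp: indicator_def)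
    qed
  qed
  show thesis
  proof
    show "A \<ge> 0" by fact
    show "integrable lborel (\<lambda>t. indicator {0..T} t * mass ?w t)" for T
      by (rule int[OF w'_meas w'0 w'_decay])
    fix T :: real assume T: "T > 0"
    define \<theta> where "\<theta> t = \<beta> (t / T)" for t
    define \<theta>' where "\<theta>' t = \<beta>' (t / T) / T" for t
    have supp: "t / T \<notin> {a..1}" if "t \<notin> {a * T..T}" for t
      using that T by (auto simp: field_simps)
    interpret virial_multiplier Z q C g \<theta> \<theta>' p p' "a * T" T r c \<kappa> w "\<lambda>x. p ((norm x)\<^sup>2) *\<^sub>R x"
    proof
      have "smooth (\<lambda>t. \<beta> (t * (1 / T)))"
        by (rule smooth_compose_linear[OF \<beta>(2)]) (auto intro!: linearI simp: algebra_simps add_divide_distrib)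
      then show "smooth \<theta>" by (simp add: \<theta>_def[abs_def])
      show "(\<theta> has_real_derivative \<theta>' t) (at t)" for t
        unfolding \<theta>_def[abs_def] \<theta>'_def
        using DERIV_chain2[OF \<beta>(3) DERIV_cdivide[OF DERIV_ident, of T]] by simp
      show "continuous_on UNIV \<theta>'"
        unfolding \<theta>'_def[abs_def] using T by (intro continuous_intros continuous_on_compose2[OF \<beta>(4)]) auto
      show "\<theta> t \<ge> 0" for t by (simp add: \<theta>_def \<beta>)
      show "0 < a * T" using \<beta> T by simp
      show "\<theta> t = 0" "\<theta>' t = 0" if "t \<notin> {a * T..T}" for t
        using \<beta>(7,8)[OF supp[OF that]] by (simp_all add: \<theta>_def \<theta>'_def)
      show "\<bar>p s\<bar> + 2 * s * \<bar>p' s\<bar> \<le> c" if "s \<ge> 0" for s using b[OF that] c_le by linarith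
      show "norm (p ((norm x)\<^sup>2) *\<^sub>R x) \<le> c" for x :: v3
      proof (cases "norm x \<le> r")
        case True
        have "\<bar>p ((norm x)\<^sup>2)\<bar> \<le> max b 0"
          using b[of "(norm x)\<^sup>2"] by (smt (verit) mult_nonneg_nonneg zero_le_power2 abs_ge_zero)
        then have "\<bar>p ((norm x)\<^sup>2)\<bar> * norm x \<le> max b 0 * r" using True by (intro mult_mono) auto
        then show ?thesis using c_le by simp
      next
        case False
        then have "r\<^sup>2 \<le> (norm x)\<^sup>2" using p(4) by (intro power_mono) auto
        then show ?thesis using p(5) c_le by simp
      qed
      show "(p ((norm x)\<^sup>2) *\<^sub>R x) \<bullet> x \<le> w x * (norm x + \<kappa>) * (norm x)\<^sup>2" for x
        using mult_right_mono[OF radial[of x], of "(norm x)\<^sup>2"] by (simp add: power2_norm_eq_inner)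
    qed (use p \<kappa> two_point w_meas w0 w1 w_decay in auto)
    note le = time_inequality
    have \<theta>1: "\<theta> t \<le> indicator {0..T} t" for t
    proof (cases "t \<in> {0..T}")
      case False
      have "t \<notin> {a * T..T}" using mult_pos_pos[OF \<beta>(1) T] False by auto
      from \<beta>(7)[OF supp[OF this]] show ?thesis by (simp add: \<theta>_def)
    qed (simp add: \<theta>_def \<beta>)
    have I\<theta>: "(LINT t|lborel. \<theta> t) \<le> T"
      using integral_mono[OF \<theta>_integrable(1) ind \<theta>1] T by simp
    have I\<theta>0: "(LINT t|lborel. \<theta> t) \<ge> 0" by (intro integral_nonneg_AE) (simp add: \<theta>_def \<beta>)
    \<comment> \<open>The derivative is of size \<open>B / T\<close> on an interval of length
      \<open>T\<close>.\<close>
    have I\<theta>': "(LINT t|lborel. \<bar>\<theta>' t\<bar>) \<le> B"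
    proof -
      have "(LINT t|lborel. \<bar>\<theta>' t\<bar>) \<le> (LINT t|lborel. B / T * indicator {0..T} t)"
      proof (rule integral_mono[OF \<theta>_integrable(2) integrable_mult_right[OF ind]])
        fix t
        show "\<bar>\<theta>' t\<bar> \<le> B / T * indicator {0..T} t"
        proof (cases "t \<in> {0..T}")
          case False
          have "t \<notin> {a * T..T}" using mult_pos_pos[OF \<beta>(1) T] False by auto
          from \<beta>(8)[OF supp[OF this]] show ?thesis using B T by (simp add: \<theta>'_def)
        qed (use T \<beta>(9) in \<open>simp add: \<theta>'_def divide_right_mono\<close>)
      qed
      then show ?thesis using T by simp
    qed
    have "(LINT t|lborel. \<theta> t * (Z * mass w t - 4 * Z\<^sup>2 - \<kappa> * (Z + 1) * C))
      = (LINT t|lborel. Z * (\<theta> t * mass w t) - (4 * Z\<^sup>2 + \<kappa> * (Z + 1) * C) * \<theta> t)"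
      by (simp add: algebra_simps)
    also have "\<dots> = Z * (LINT t|lborel. \<theta> t * mass w t) - (4 * Z\<^sup>2 + \<kappa> * (Z + 1) * C) * (LINT t|lborel. \<theta> t)"
      using mass_integrable[OF \<theta>_integrable(1)] \<theta>_integrable(1)
      by (subst Bochner_Integration.integral_diff) auto
    finally have "Z * (LINT t|lborel. \<theta> t * mass w t)
      \<le> (4 * Z\<^sup>2 + \<kappa> * ((Z + 3) * C)) * (LINT t|lborel. \<theta> t) + c * ((3 + r) * C) * (LINT t|lborel. \<bar>\<theta>' t\<bar>)"
      using le by (simp add: algebra_simps)
    also have "\<dots> \<le> (4 * Z\<^sup>2 + Z * (\<epsilon> / 2)) * T + c * ((3 + r) * C) * B"
    proof (rule add_mono)
      show "(4 * Z\<^sup>2 + \<kappa> * ((Z + 3) * C)) * (LINT t|lborel. \<theta> t) \<le> (4 * Z\<^sup>2 + Z * (\<epsilon> / 2)) * T"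
        using \<kappa>C I\<theta> I\<theta>0 Z_pos assms by (intro mult_mono) auto
      show "c * ((3 + r) * C) * (LINT t|lborel. \<bar>\<theta>' t\<bar>) \<le> c * ((3 + r) * C) * B"
        using I\<theta>' c_le p(4) C_nonneg by (intro mult_left_mono) auto
    qed
    also have "\<dots> = Z * ((4 * Z + \<epsilon> / 2) * T + A)"
    proof -
      have "Z * A = c * ((3 + r) * C) * B" using Z_pos by (simp add: A_def)
      then show ?thesis by (simp add: algebra_simps power2_eq_square)
    qed
    finally have main: "(LINT t|lborel. \<theta> t * mass w t) \<le> (4 * Z + \<epsilon> / 2) * T + A"
      using Z_pos by (simp only: mult_le_cancel_left_pos)
    have i: "integrable lborel (\<lambda>t. indicator {0..T} t - \<theta> t)"
      by (intro Bochner_Integration.integrable_diff ind \<theta>_integrable)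
    \<comment> \<open>\<open>?w\<close> is a lower bound of \<open>w\<close> in which only
      \<open>\<epsilon>\<close> occurs. For the part of \<open>[0, T]\<close> that the profile
      misses, the mass is replaced by its a priori bound \<open>c * C\<close>.\<close>
    have "(LINT t|lborel. indicator {0..T} t * mass ?w t)
      \<le> (LINT t|lborel. \<theta> t * mass w t + c * C * (indicator {0..T} t - \<theta> t))"
    proof (rule integral_mono_AE[OF int[OF w'_meas w'0 w'_decay]])
      show "integrable lborel (\<lambda>t. \<theta> t * mass w t + c * C * (indicator {0..T} t - \<theta> t))"
        by (intro Bochner_Integration.integrable_add mass_integrable \<theta>_integrable integrable_mult_right i)
      show "AE t in lborel. indicator {0..T} t * mass ?w t \<le> \<theta> t * mass w t + c * C * (indicator {0..T} t - \<theta> t)"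
        using good_AE
      proof eventually_elim
        case (elim t)
        interpret bounded_density C "rho t" using elim by (simp add: good_def)
        note m = mass_bounds[OF elim w_meas w0 w_decay c_le(4)]
        have "mass ?w t \<le> mass w t"
          unfolding mass_def
          by (intro integral_mono mass_bounds[OF elim w'_meas w'0 w'_decay c_le(4)] m mult_left_mono w_ge r_ge_0)
        then have "indicator {0..T} t * mass ?w t \<le> indicator {0..T} t * mass w t"
          by (intro mult_left_mono) auto
        also have "\<dots> = \<theta> t * mass w t + (indicator {0..T} t - \<theta> t) * mass w t" by (simp add: algebra_simps)
        also have "\<dots> \<le> \<theta> t * mass w t + (indicator {0..T} t - \<theta> t) * (c * C)"
          using m \<theta>1[of t] by (intro add_left_mono mult_left_mono) auto
        finally show ?case by (simp add: mult.commute)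
      qed
    qed
    also have "\<dots> = (LINT t|lborel. \<theta> t * mass w t) + c * C * (LINT t|lborel. indicator {0..T} t - \<theta> t)"
      using mass_integrable[OF \<theta>_integrable(1)] i by (subst Bochner_Integration.integral_add) auto
    \<comment> \<open>The substitution \<open>t = T * u\<close> reduces the loss to that of the
      unscaled profile.\<close>
    also have "(LINT t|lborel. indicator {0..T} t - \<theta> t) = T * (LINT u|lborel. indicator {0..1} u * (1 - \<beta> u))"
    proof -
      have "(LINT t|lborel. indicator {0..T} t - \<theta> t) = T * (LINT u|lborel. indicator {0..T} (T * u) - \<beta> u)"
        using lborel_integral_real_affine[of T "\<lambda>t. indicator {0..T} t - \<theta> t" 0] T by (simp add: \<theta>_def)
      moreover have "indicator {0..T} (T * u) - \<beta> u = indicator {0..1} u * (1 - \<beta> u)" for u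
        using T \<beta>(1) \<beta>(7)[of u] by (auto simp: indicator_def zero_le_mult_iff mult_le_cancel_left1)
      ultimately show ?thesis by simp
    qed
    also have "c * C * (T * (LINT u|lborel. indicator {0..1} u * (1 - \<beta> u))) \<le> c * C * (T * \<eta>)"
      using cC T \<beta>(10) by (intro mult_left_mono) auto
    also have "\<dots> = T * (c * C * \<eta>)" by simp
    also have "\<dots> \<le> T * (\<epsilon> / 2)" using T \<eta>(2) by (intro mult_left_mono) auto
    finally have "(LINT t|lborel. indicator {0..T} t * mass ?w t) \<le> (4 * Z + \<epsilon> / 2) * T + A + T * (\<epsilon> / 2)"
      using main by linarith
    then show "(LINT t|lborel. indicator {0..T} t * mass ?w t) \<le> (4 * Z + \<epsilon>) * T + A"
      by (simp add: algebra_simps)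
  qed
qed

section \<open>From the given solution to a Borel representative\<close>

lemma integral_lebesgue_cong_AE:
  fixes f h :: "'a::euclidean_space \<Rightarrow> 'b::euclidean_space"
  assumes "f \<in> borel_measurable lebesgue" "AE x in lebesgue. f x = h x"
  shows "integral\<^sup>L lebesgue h = integral\<^sup>L lebesgue f"
  \<comment> \<open>Completeness of Lebesgue measure makes \<open>h\<close> measurable as well; for
    slices of the given solution no measurability is at hand beforehand.\<close>
  using borel_measurable_AE[OF assms] assms by (intro integral_cong_AE) auto

context
  fixes u v :: "v3 \<Rightarrow> v3 \<Rightarrow> real"
  assumes eq: "AE x in lborel. AE \<xi> in lborel. u x \<xi> = v x \<xi>"
begin

lemma spatial_density_cong_AE: "AE x in lborel. spatial_density u x = spatial_density v x"
  using eq
proof eventually_elim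
  case (elim x)
  then show ?case unfolding spatial_density_eq by (intro nn_integral_cong_AE) (auto elim: eventually_mono)
qed

lemma vlasov_energy_cong_AE: "vlasov_energy Z u = vlasov_energy Z v"
proof -
  note ae = spatial_density_cong_AE
  have "kinetic_energy u = kinetic_energy v"
    unfolding kinetic_energy_eq kinetic_density_def
  proof (rule nn_integral_cong_AE, use eq in eventually_elim)
    case (elim x)
    then show ?case by (intro nn_integral_cong_AE) (auto elim: eventually_mono)
  qed
  moreover have "attraction_energy Z u = attraction_energy Z v"
    unfolding attraction_energy_eq using ae by (intro nn_integral_cong_AE) (auto elim: eventually_mono)
  moreover have "repulsion_energy u = repulsion_energy v"
    unfolding repulsion_energy_eq
  proof (intro arg_cong[where f="(*) _"] nn_integral_cong_AE, use ae in eventually_elim)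
    case (elim x)
    then show ?case using ae by (intro nn_integral_cong_AE) (auto elim: eventually_mono)
  qed
  ultimately show ?thesis by (simp add: vlasov_energy_def)
qed

text \<open>Equality holds at every \<open>x\<close>, since the integral over \<open>y\<close> does
  not see the null set where the densities differ.\<close>

lemma force_cong_AE:
  assumes [measurable]: "case_prod v \<in> borel_measurable (borel \<Otimes>\<^sub>M borel)"
  shows "force Z u x = force Z v x"
proof -
  have "(LINT y|lebesgue. (enn2real (spatial_density u y) / norm (x - y) ^ 3) *\<^sub>R (x - y))
    = (LINT y|lebesgue. (enn2real (spatial_density v y) / norm (x - y) ^ 3) *\<^sub>R (x - y))"
  proof (rule integral_lebesgue_cong_AE)
    show "(\<lambda>y. (enn2real (spatial_density v y) / norm (x - y) ^ 3) *\<^sub>R (x - y)) \<in> borel_measurable lebesgue"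
      by (rule measurable_completion) measurable
    show "AE y in lebesgue. (enn2real (spatial_density v y) / norm (x - y) ^ 3) *\<^sub>R (x - y)
      = (enn2real (spatial_density u y) / norm (x - y) ^ 3) *\<^sub>R (x - y)"
      by (rule AE_completion) (use spatial_density_cong_AE in \<open>auto elim: eventually_mono\<close>)
  qed
  then show ?thesis by (simp add: force_def)
qed

end

lemma AE_lborel3:
  assumes "AE z in lborel3. P z"
  shows "AE t in lborel. AE x in lborel. AE \<xi> in lborel. P (t, x, \<xi>)"
proof -
  have "AE z in lborel \<Otimes>\<^sub>M lborel. P z" using assms by (simp only: lborel_prod)
  from lborel_pair.AE_pair[OF this]
  have "AE t in lborel. AE y in lborel \<Otimes>\<^sub>M lborel. P (t, y)" by (simp only: lborel_prod)
  then show ?thesis by eventually_elim (rule lborel_pair.AE_pair)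
qed

text \<open>The exceptional set of \<open>P\<close> may fail to be Borel, so it is first enclosed in
  a Borel null set \<open>N\<close>.\<close>

lemma AE_lborel_fst:
  assumes "AE t in lborel. P t"
  shows "AE z in (lborel :: (real \<times> 'a::euclidean_space) measure). P (fst z)"
proof -
  obtain N where N: "N \<in> null_sets lborel" "{t. \<not> P t} \<subseteq> N"
    using assms unfolding eventually_ae_filter by auto
  have "AE z in lborel \<Otimes>\<^sub>M (lborel :: 'a measure). fst z \<notin> N"
  proof (rule lborel_pair.AE_pair_measure)
    have [measurable]: "N \<in> sets borel" using N by auto
    show "{z \<in> space (lborel \<Otimes>\<^sub>M lborel). fst z \<notin> N} \<in> sets (lborel \<Otimes>\<^sub>M (lborel :: 'a measure))" by measurable
    show "AE t in lborel. AE y in (lborel :: 'a measure). fst (t, y) \<notin> N"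
      using AE_not_in[OF N(1)] by eventually_elim simp
  qed
  then show ?thesis using N(2) by (simp only: lborel_prod) (auto elim!: eventually_mono)
qed

lemma ennreal_le_at_right_limit:
  fixes X :: ennreal and h :: "real \<Rightarrow> real"
  assumes "\<And>\<epsilon>. \<epsilon> > 0 \<Longrightarrow> X \<le> ennreal (h \<epsilon>)" "(h \<longlongrightarrow> l) (at_right 0)"
  shows "X \<le> ennreal l"
proof (rule tendsto_lowerbound)
  show "((\<lambda>\<epsilon>. ennreal (h \<epsilon>)) \<longlongrightarrow> ennreal l) (at_right 0)" using assms(2) by (rule tendsto_ennrealI)
  show "\<forall>\<^sub>F \<epsilon> in at_right 0. X \<le> ennreal (h \<epsilon>)"
    using eventually_at_right_less[of "0::real"] by (rule eventually_mono) (rule assms(1))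
qed simp

theorem theorem1:
  fixes Z q :: real
    and f :: "real \<Rightarrow> real^3 \<Rightarrow> real^3 \<Rightarrow> real"
    and B :: "(real^3) set"
  assumes "Z > 0" and "q > 0"
    and measurable: "(\<lambda>(t, x, \<xi>). f t x \<xi>) \<in> borel_measurable (lebesgue_on ({0..} \<times> UNIV))"
    and pauli: "\<And>t x \<xi>. t \<ge> 0 \<Longrightarrow> 0 \<le> f t x \<xi> \<and> f t x \<xi> \<le> q"
    and weak_solution: "vlasov_weak_solution Z f"
    and finite_energy: "\<exists>E :: real. \<forall>t\<ge>0. vlasov_energy Z (f t) = ereal E"
    and "bounded B" and "B \<in> sets lebesgue"
  shows "Limsup at_top (\<lambda>T :: real.
           (\<integral>\<^sup>+ t\<in>{0..T}. particle_number f t B \<partial>lebesgue) / ennreal T) \<le> ennreal (4 * Z)"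
proof -
  let ?f = "\<lambda>z :: real \<times> v3 \<times> v3. f (fst z) (fst (snd z)) (snd (snd z))"
  let ?H = "{0..} \<times> UNIV :: (real \<times> v3 \<times> v3) set"
  have "closed ?H" by (intro closed_Times) auto
  then have "?H \<in> sets lebesgue" by (intro sets_completionI_sets) auto
  from borel_measurable_if_I[OF _ this, of ?f] measurable
  have "(\<lambda>z. if z \<in> ?H then ?f z else 0) \<in> borel_measurable lebesgue" by (simp add: case_prod_unfold)
  from completion_ex_borel_measurable_real[OF this]
  obtain f1 where f1 [measurable]: "f1 \<in> borel_measurable lborel"
    and f1_AE: "AE z in lborel. (if z \<in> ?H then ?f z else 0) = f1 z" by blast
  \<comment> \<open>\<open>f1\<close> agrees with the solution only almost everywhere, so clipping
    to \<open>[0, q]\<close> restores the Pauli bounds at every point. Nonpositive times are set to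
    0, as the weak equation concerns \<open>t > 0\<close>.\<close>
  define g where "g z = (if fst z > 0 then max 0 (min q (f1 z)) else 0)" for z
  have "f1 \<in> borel_measurable borel3" using f1 by (simp add: borel_prod)
  then have g_meas: "g \<in> borel_measurable borel3" unfolding g_def[abs_def] by measurable
  have g_bounds: "0 \<le> g z" "g z \<le> q" for z using assms(2) by (auto simp: g_def)
  have fg: "AE z in lborel. fst z > 0 \<longrightarrow> ?f z = g z"
    using f1_AE
  proof eventually_elim
    case (elim z)
    show ?case using elim pauli[of "fst z" "fst (snd z)" "snd (snd z)"] by (cases z) (auto simp: g_def)
  qed
  have slices: "AE t in lborel. t > 0 \<longrightarrow> (AE x in lborel. AE \<xi> in lborel. f t x \<xi> = g (t, x, \<xi>))"
    using AE_lborel3[OF fg] by eventually_elim auto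
  obtain E where E: "\<And>t. t \<ge> 0 \<Longrightarrow> vlasov_energy Z (f t) = ereal E" using finite_energy by blast
  obtain C where C: "C \<ge> 0" "\<And>u. phase_space_density q u \<Longrightarrow> vlasov_energy Z u = ereal E \<Longrightarrow>
      kinetic_energy u \<le> ennreal C \<and> (AE x in lborel. spatial_density u x = ennreal (enn2real (spatial_density u x)))
      \<and> bounded_density C (\<lambda>x. enn2real (spatial_density u x))"
    using uniform_bounds[OF assms(1,2)] by metis
  interpret vlasov_flow Z q C g
    by unfold_locales (use assms(1,2) C(1) g_meas g_bounds in auto)
  have good: "AE t in lborel. good t"
    using slices
  proof eventually_elim
    case (elim t)
    show "good t"
    proof (cases "t > 0")
      case True
      then have ae: "AE x in lborel. AE \<xi> in lborel. f t x \<xi> = g (t, x, \<xi>)" using elim by blast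
      have "vlasov_energy Z (\<lambda>x \<xi>. g (t, x, \<xi>)) = ereal E"
        using vlasov_energy_cong_AE[OF ae] E[of t] True by simp
      from C(2)[OF slice.phase_space_density_axioms this] show ?thesis
        by (simp add: good_def rho_def[abs_def])
    next
      \<comment> \<open>At nonpositive times the density is 0 and all the bounds hold
        trivially.\<close>
      case False
      then have g0: "g (t, x, \<xi>) = 0" for x \<xi> by (simp add: g_def)
      then have rho0: "rho t x = 0" for x by (simp add: rho_def spatial_density_eq)
      show ?thesis
        unfolding good_def rho0[abs_def] using C(1)
        by (auto simp: g0 kinetic_energy_eq kinetic_density_def spatial_density_eq bounded_density_def)
    qed
  qed
  interpret vlasov_solution Z q C g
  proof
    show "AE t in lborel. good t" by fact
    fix \<phi> :: "real \<times> v3 \<times> v3 \<Rightarrow> real"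
    assume \<phi>: "test_function ({0<..} \<times> UNIV) \<phi>"
    define F where "F = (\<lambda>(t, x, \<xi>). f t x \<xi> *
               (frechet_derivative \<phi> (at (t, x, \<xi>)) (1, 0, 0)
              + frechet_derivative \<phi> (at (t, x, \<xi>)) (0, \<xi>, 0)
              + frechet_derivative \<phi> (at (t, x, \<xi>)) (0, 0, force Z (f t) x)))"
    have F: "set_integrable lebesgue ({0<..} \<times> UNIV) F" "(LINT z:{0<..} \<times> UNIV|lebesgue. F z) = 0"
      using weak_solution \<phi> unfolding vlasov_weak_solution_def F_def Let_def by auto
    \<comment> \<open>The restriction to \<open>t > 0\<close> is already contained in
      \<open>g\<close>, which vanishes elsewhere.\<close>
    have "(LINT z|lebesgue. integrand \<phi> z) = (LINT z|lebesgue. indicator ({0<..} \<times> UNIV) z *\<^sub>R F z)"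
    proof (rule integral_lebesgue_cong_AE)
      show "(\<lambda>z. indicator ({0<..} \<times> UNIV) z *\<^sub>R F z) \<in> borel_measurable lebesgue"
        using F(1) unfolding set_integrable_def by (rule borel_measurable_integrable)
      have "AE z in lborel. indicator ({0<..} \<times> UNIV) z *\<^sub>R F z = integrand \<phi> z"
        using fg AE_lborel_fst[OF slices]
      proof eventually_elim
        case (elim z)
        obtain t x \<xi> where z: "z = (t, x, \<xi>)" by (cases z)
        show ?case
        proof (cases "t > 0")
          case True
          have "case_prod (\<lambda>x \<xi>. g (t, x, \<xi>)) \<in> borel_measurable (borel \<Otimes>\<^sub>M borel)"
            by (rule slice.u_measurable)
          from force_cong_AE[OF _ this, of "f t" Z x] elim True
          have "force Z (f t) x = K t x" by (simp add: z force_eq_K)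
          then show ?thesis using elim True by (simp add: z F_def integrand_def)
        qed (simp add: z integrand_def g_def)
      qed
      then show "AE z in lebesgue. indicator ({0<..} \<times> UNIV) z *\<^sub>R F z = integrand \<phi> z" by (rule AE_completion)
    qed
    also have "\<dots> = 0" using F(2) by (simp add: set_lebesgue_integral_def)
    finally show "(LINT z|lebesgue. integrand \<phi> z) = 0" .
  qed
  obtain b where b: "b \<ge> 0" "B \<subseteq> cball 0 b"
    using \<open>bounded B\<close> by (metis bounded_subset_ballD ball_subset_cball less_imp_le subset_trans)
  let ?N = "\<lambda>T :: real. (\<integral>\<^sup>+ t\<in>{0..T}. particle_number f t B \<partial>lebesgue) / ennreal T"
  \<comment> \<open>The first factor is the reciprocal of the least value that the weight takes on
    the ball of radius \<open>b\<close>, the smallest possible at its boundary. As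
    \<open>\<epsilon> \<rightarrow> 0\<close> it tends to 1, and \<open>h\<close> to
    \<open>4 * Z\<close>.\<close>
  define h where "h \<epsilon> = (1 + \<epsilon> * (1 + b\<^sup>2)) * (4 * Z + \<epsilon>)" for \<epsilon>
  have "Limsup at_top ?N \<le> ennreal (h \<epsilon>)" if \<epsilon>: "\<epsilon> > 0" for \<epsilon>
  proof -
    let ?w = "\<lambda>x::v3. 1 / (1 + \<epsilon> * (1 + (norm x)\<^sup>2))"
    define c where "c = 1 + \<epsilon> * (1 + b\<^sup>2)"
    have c: "c > 0" using \<epsilon> by (simp add: c_def add_pos_nonneg)
    obtain A where A: "A \<ge> 0" "\<And>T. T > 0 \<Longrightarrow>
      (LINT t|lborel. indicator {0..T} t * mass ?w t) \<le> (4 * Z + \<epsilon>) * T + A"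
      "\<And>T. integrable lborel (\<lambda>t. indicator {0..T} t * mass ?w t)"
      by (rule average_mass_le[OF \<epsilon>]) (rule that; assumption)
    have w_meas: "?w \<in> borel_measurable borel" by measurable
    have w_pos: "?w x > 0" for x using \<epsilon> by (simp add: add_pos_nonneg)
    have w_decay: "?w x \<le> (2 + 1 / \<epsilon>) / (1 + norm x)" for x
    proof -
      have "?w x \<le> 1 / (1 + \<epsilon> * (norm x)\<^sup>2)"
        using \<epsilon> by (intro divide_left_mono mult_pos_pos) (auto simp: add_pos_nonneg)
      also have "\<dots> \<le> (2 + 1 / \<epsilon>) / (1 + norm x)" using \<epsilon> by (intro inverse_quadratic_le) auto
      finally show ?thesis .
    qed
    have number: "AE t in lborel. t > 0 \<longrightarrow> particle_number f t B \<le> ennreal (c * mass ?w t)"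
      using slices good
    proof eventually_elim
      case (elim t)
      interpret bounded_density C "rho t" using elim by (simp add: good_def)
      show ?case
      proof
        assume "t > 0"
        with elim have ae: "AE x in lborel. AE \<xi> in lborel. f t x \<xi> = g (t, x, \<xi>)" by blast
        have rho: "AE x in lborel. spatial_density (\<lambda>x \<xi>. g (t, x, \<xi>)) x = ennreal (rho t x)"
          using elim by (simp add: good_def)
        note m = mass_bounds[OF elim(2) w_meas less_imp_le[OF w_pos] w_decay]
        have "particle_number f t B = (\<integral>\<^sup>+ x. spatial_density (f t) x * indicator B x \<partial>lborel)"
          by (simp add: particle_number_def spatial_density_def nn_integral_completion)
        also have "\<dots> \<le> (\<integral>\<^sup>+ x. ennreal (c * (rho t x * ?w x)) \<partial>lborel)"
        proof (rule nn_integral_mono_AE, use spatial_density_cong_AE[OF ae] rho in eventually_elim)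
          case (elim x)
          show ?case
          proof (cases "x \<in> B")
            case True
            then have "(norm x)\<^sup>2 \<le> b\<^sup>2" using b by (intro power_mono) auto
            then have "1 \<le> c * ?w x" using \<epsilon> by (simp add: c_def add_pos_nonneg)
            from mult_left_mono[OF this r_ge_0[of x]] show ?thesis
              using True elim by (simp add: ennreal_leI mult_ac)
          qed simp
        qed
        also have "\<dots> = ennreal (c * mass ?w t)"
        proof -
          have "integrable lborel (\<lambda>x. c * (rho t x * ?w x))"
            using m(3) \<epsilon> by (intro integrable_mult_right) auto
          moreover have "AE x in lborel. 0 \<le> c * (rho t x * ?w x)"
            using c r_ge_0 less_imp_le[OF w_pos] by (intro AE_I2 mult_nonneg_nonneg) auto
          ultimately show ?thesis
            unfolding mass_def integral_mult_right_zero[symmetric] by (rule nn_integral_eq_integral)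
        qed
        finally show "particle_number f t B \<le> ennreal (c * mass ?w t)" .
      qed
    qed
    have mass0: "AE t in lborel. mass ?w t \<ge> 0"
      using good by eventually_elim (rule mass_bounds(1)[OF _ w_meas less_imp_le[OF w_pos] w_decay], use \<epsilon> in auto)
    have bound: "?N T \<le> ennreal (c * (4 * Z + \<epsilon> + A * inverse T))" if T: "T > 0" for T
    proof -
      have "(\<integral>\<^sup>+ t\<in>{0..T}. particle_number f t B \<partial>lebesgue) = (\<integral>\<^sup>+ t. particle_number f t B * indicator {0..T} t \<partial>lborel)"
        by (simp add: nn_integral_completion)
      also have "\<dots> \<le> (\<integral>\<^sup>+ t. ennreal (c * (indicator {0..T} t * mass ?w t)) \<partial>lborel)"
      \<comment> \<open>The comparison of the particle number with the mass is available for
        \<open>t > 0\<close>; the single time 0 is a null set.\<close>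
      proof (rule nn_integral_mono_AE, use number AE_lborel_singleton[of 0] in eventually_elim)
        case (elim t)
        then show ?case by (cases "t \<in> {0..T}") auto
      qed
      also have "\<dots> = ennreal (c * (LINT t|lborel. indicator {0..T} t * mass ?w t))"
        using A(3)[of T] mass0 c
        by (subst nn_integral_eq_integral) (auto elim!: eventually_mono)
      also have "\<dots> \<le> ennreal (c * ((4 * Z + \<epsilon>) * T + A))"
        using A(2)[OF T] c by (intro ennreal_leI mult_left_mono) auto
      finally have "?N T \<le> ennreal (c * ((4 * Z + \<epsilon>) * T + A)) / ennreal T"
        by (rule divide_right_mono_ennreal)
      also have "\<dots> = ennreal (c * ((4 * Z + \<epsilon>) * T + A) / T)"
        using T c A(1) assms(1) \<epsilon> by (intro divide_ennreal) auto
      also have "c * ((4 * Z + \<epsilon>) * T + A) / T = c * (4 * Z + \<epsilon> + A * inverse T)"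
        using T by (simp add: field_simps)
      finally show ?thesis .
    qed
    have "((\<lambda>T. c * (4 * Z + \<epsilon> + A * inverse T)) \<longlongrightarrow> c * (4 * Z + \<epsilon> + A * 0)) at_top"
      by (intro tendsto_intros tendsto_inverse_0_at_top filterlim_ident)
    then have lim: "((\<lambda>T. ennreal (c * (4 * Z + \<epsilon> + A * inverse T))) \<longlongrightarrow> ennreal (h \<epsilon>)) at_top"
      by (intro tendsto_ennrealI) (simp add: h_def c_def)
    have "Limsup at_top ?N \<le> Limsup at_top (\<lambda>T. ennreal (c * (4 * Z + \<epsilon> + A * inverse T)))"
      using bound by (intro Limsup_mono) (auto intro: eventually_mono[OF eventually_gt_at_top[of "0::real"]])
    also have "\<dots> = ennreal (h \<epsilon>)" by (intro lim_imp_Limsup lim) simp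
    finally show ?thesis .
  qed
  moreover have "(h \<longlongrightarrow> (1 + 0 * (1 + b\<^sup>2)) * (4 * Z + 0)) (at_right 0)"
    unfolding h_def[abs_def] by (intro tendsto_intros)
  ultimately show ?thesis using ennreal_le_at_right_limit[of "Limsup at_top ?N" h "4 * Z"] by simp
qed

end
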